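(* Let $f:\mathcal{N}\to\mathbb{R}$, $f(\mathbf{P})=-\sum_{i=1}^{U}w_i\mathcal{R}_i$, be the negative weighted sum rate. The Euclidean gradient of $f$ at $\mathbf{P}$ (the gradient on $\mathcal{N}$ with respect to $g^{\mathcal{N}}$) is $$\mathrm{grad}_{\mathcal{N}}f(\mathbf{P})=\left(\mathrm{grad}_{\mathcal{N}_1}f(\mathbf{P}_1),\cdots,\mathrm{grad}_{\mathcal{N}_U}f(\mathbf{P}_U)\right),$$ where $$\mathrm{grad}_{\mathcal{N}_i}f(\mathbf{P}_i)=\left(\mathrm{grad}_{\mathcal{N}_{i,i_1}}f(\mathbf{P}_{i,i_1})^T,\cdots,\mathrm{grad}_{\mathcal{N}_{i,i_{B_i}}}f(\mathbf{P}_{i,i_{B_i}})^T\right)^T$$ and, for $i\in\{1,\dots,U\}$ and $k\in\mathcal{B}_i$, $$\mathrm{grad}_{\mathcal{N}_{i,k}}f(\mathbf{P}_{i,k})=-2\Big(w_i\mathbf{H}_{i,k}^H\mathbf{R}_i^{-1}\mathbf{H}_i\mathbf{W}_i\mathbf{P}_i\mathbf{C}_i-\sum_{j\neq i}w_j\mathbf{H}_{j,k}^H\mathbf{R}_j^{-1}\mathbf{H}_j\mathbf{W}_j\mathbf{P}_j\mathbf{C}_j\mathbf{P}_j^H\mathbf{W}_j^H\mathbf{H}_j^H\mathbf{R}_j^{-1}\mathbf{H}_j\mathbf{W}_i\mathbf{P}_i\Big)\in\mathbb{C}^{M_t\times d_i}.$$ Moreover, for $\mathbf{P}\in\mathcal{M}$,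 the Riemannian gradient of $f$ (restricted to $\mathcal{M}$) in $T_{\mathbf{P}}\mathcal{M}$ is $$\mathrm{grad}_{\mathcal{M}}f(\mathbf{P})=\Big(\mathrm{grad}_{\mathcal{N}_1}f(\mathbf{P}_1)-\sum_{k\in\mathcal{B}_1}\lambda_k\mathbf{W}_1^H\mathbf{Q}_k\mathbf{W}_1\mathbf{P}_1,\ \cdots,\ \mathrm{grad}_{\mathcal{N}_U}f(\mathbf{P}_U)-\sum_{k\in\mathcal{B}_U}\lambda_k\mathbf{W}_U^H\mathbf{Q}_k\mathbf{W}_U\mathbf{P}_U\Big),$$ where $$\lambda_k=\frac{1}{P_k}\sum_{i\in\mathcal{U}_k}\Re\left\{\mathrm{tr}\left(\mathbf{P}_i^H\mathbf{W}_i^H\mathbf{Q}_k\mathbf{W}_i\,\mathrm{grad}_{\mathcal{N}_i}f(\mathbf{P}_i)\right)\right\}.$$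
   Context: Let $B,U,M_t,M_r$ and $d_1,\dots,d_U$ be positive integers. For each $i\in\{1,\dots,U\}$, $\mathcal{B}_i=\{i_1,\dots,i_{B_i}\}\subseteq\{1,\dots,B\}$ is a nonempty set with $B_i$ (distinct) elements. For each $k\in\{1,\dots,B\}$, $\mathcal{U}_k=\{i\in\{1,\dots,U\}: k\in\mathcal{B}_i\}$. The numbers $P_k>0$, $k\in\{1,\dots,B\}$, the noise variance $\sigma_z^2>0$, and the real weights $w_1,\dots,w_U$ are given. $\mathcal{N}=\mathcal{N}_1\times\cdots\times\mathcal{N}_U$ with $\mathcal{N}_i=\mathbb{C}^{B_iM_t\times d_i}$, regarded as a real linear manifold, so $T_{\mathbf{P}}\mathcal{N}=\mathcal{N}$. A point is $\mathbf{P}=(\mathbf{P}_1,\dots,\mathbf{P}_U)$ with $\mathbf{P}_i=[\mathbf{P}_{i,i_1}^T,\dots,\mathbf{P}_{i,i_{B_i}}^T]^T$, $\mathbf{P}_{i,k}\in\mathcal{N}_{i,k}=\mathbb{C}^{M_t\times d_i}$ for $k\in\mathcal{B}_i$. The Riemannian metric on $\mathcal{N}$ is $g^{\mathcal{N}}_{\mathbf{P}}(\boldsymbol{\xi}_{\mathbf{P}},\boldsymbol{\zeta}_{\mathbf{P}})=\sum_{i=1}^{U}\Re\{\mathrm{tr}(\boldsymbol{\zeta}_{\mathbf{P}_i}^H\boldsymbol{\xi}_{\mathbf{P}_i})\}$, and each $\mathcal{N}_i$, $\mathcal{N}_{i,k}$ carries the metric $\Re\{\mathrm{tr}(\boldsymbol{\zeta}^H\boldsymbol{\xi})\}$.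 The notation $f(\mathbf{P}_i)$ (resp. $f(\mathbf{P}_{i,k})$) means $f$ regarded as a function of $\mathbf{P}_i$ (resp. of the block $\mathbf{P}_{i,k}$) only, all other variables being fixed. $\mathbf{W}_i\in\mathbb{R}^{BM_t\times B_iM_t}$ is the block matrix made of $B\times B_i$ blocks of size $M_t\times M_t$ whose $(i_n,n)$ block is $\mathbf{I}_{M_t}$ for $n=1,\dots,B_i$ and whose other blocks are zero. $\mathbf{Q}_k\in\mathbb{C}^{BM_t\times BM_t}$ is the block diagonal matrix with $B$ diagonal blocks of size $M_t\times M_t$, whose $k$-th diagonal block is $\mathbf{I}_{M_t}$ and whose other blocks are zero. The channel matrices $\mathbf{H}_{i,k}\in\mathbb{C}^{M_r\times M_t}$, $i\in\{1,\dots,U\}$, $k\in\{1,\dots,B\}$, are given, and $\mathbf{H}_i=[\mathbf{H}_{i,1},\dots,\mathbf{H}_{i,B}]\in\mathbb{C}^{M_r\times BM_t}$. Set $$\mathbf{R}_i=\mathbf{H}_i\sum_{j\neq i}\mathbf{W}_j\mathbf{P}_j\mathbf{P}_j^H\mathbf{W}_j^H\mathbf{H}_i^H+\sigma_z^2\mathbf{I}_{M_r},\qquad \mathbf{C}_i=\left(\mathbf{I}_{d_i}+\mathbf{P}_i^H\mathbf{W}_i^H\mathbf{H}_i^H\mathbf{R}_i^{-1}\mathbf{H}_i\mathbf{W}_i\mathbf{P}_i\right)^{-1},$$ $$\mathcal{R}_i=\log\det\left(\mathbf{R}_i+\mathbf{H}_i\mathbf{W}_i\mathbf{P}_i\mathbf{P}_i^H\mathbf{W}_i^H\mathbf{H}_i^H\right)-\log\det(\mathbf{R}_i),$$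 where sums over $j\neq i$ run over $j\in\{1,\dots,U\}\setminus\{i\}$ and $\log$ is the natural logarithm. $\mathcal{M}$ is the Riemannian submanifold of $\mathcal{N}$ (with the induced metric $g^{\mathcal{M}}$) $$\mathcal{M}=\Big\{\mathbf{P}\in\mathcal{N}\ \Big|\ \sum_{i\in\mathcal{U}_k}\mathrm{tr}(\mathbf{P}_i^H\mathbf{W}_i^H\mathbf{Q}_k\mathbf{W}_i\mathbf{P}_i)=P_k,\ k=1,\dots,B\Big\}.$$ The Riemannian gradient $\mathrm{grad}_{\mathcal{M}}f(\mathbf{P})$ is the unique element of $T_{\mathbf{P}}\mathcal{M}$ with $g^{\mathcal{M}}_{\mathbf{P}}(\mathrm{grad}_{\mathcal{M}}f(\mathbf{P}),\boldsymbol{\xi}_{\mathbf{P}})=\mathrm{D}f(\mathbf{P})[\boldsymbol{\xi}_{\mathbf{P}}]$ for all $\boldsymbol{\xi}_{\mathbf{P}}\in T_{\mathbf{P}}\mathcal{M}$; gradients on $\mathcal{N}$, $\mathcal{N}_i$, $\mathcal{N}_{i,k}$ are defined in the same way. *)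

theory Defs
  imports "Jordan_Normal_Form.Gauss_Jordan_Elimination" "Jordan_Normal_Form.Schur_Decomposition"
begin

section \<open>Matrices of variable size\<close>

text \<open>The block sizes differ from user to user, so matrices are those of \<^theory>\<open>Jordan_Normal_Form.Matrix\<close>,
  with explicit dimensions. All indices start at 0.\<close>

abbreviation herm :: "complex mat \<Rightarrow> complex mat" (\<open>(_\<^sup>H)\<close> [1000] 999)
  where "A\<^sup>H \<equiv> mat_adjoint A"

abbreviation rsmult :: "real \<Rightarrow> complex mat \<Rightarrow> complex mat" (infixl \<open>*\<^sub>r\<close> 70)
  where "a *\<^sub>r A \<equiv> complex_of_real a \<cdot>\<^sub>m A"

definition tr :: "complex mat \<Rightarrow> complex"
  where "tr A = (\<Sum>a<dim_row A. A $$ (a, a))"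

text \<open>Only meaningful for invertible matrices.\<close>

definition minv :: "complex mat \<Rightarrow> complex mat"
  where "minv A = the (mat_inverse A)"

text \<open>The type of matrices of all sizes has no zero, hence no \<^const>\<open>sum\<close>; a sum of \<open>nr \<times> nc\<close> matrices
  is formed entrywise.\<close>

definition msum :: "nat \<Rightarrow> nat \<Rightarrow> ('i \<Rightarrow> complex mat) \<Rightarrow> 'i set \<Rightarrow> complex mat"
  where "msum nr nc F I = mat nr nc (\<lambda>ab. \<Sum>j\<in>I. F j $$ ab)"

text \<open>\<open>nr \<times> nc\<close> blocks, the block \<open>F r c\<close> in position \<open>(r, c)\<close> having size \<open>br \<times> bc\<close>.\<close>

definition block_matrix ::
  "nat \<Rightarrow> nat \<Rightarrow> nat \<Rightarrow> nat \<Rightarrow> (nat \<Rightarrow> nat \<Rightarrow> complex mat) \<Rightarrow> complex mat"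
  where "block_matrix nr nc br bc F =
    mat (nr * br) (nc * bc) (\<lambda>(a, b). F (a div br) (b div bc) $$ (a mod br, b mod bc))"

definition mat_ip :: "complex mat \<Rightarrow> complex mat \<Rightarrow> real"
  where "mat_ip \<xi> \<zeta> = Re (tr (\<zeta>\<^sup>H * \<xi>))"


section \<open>The network\<close>

text \<open>\<open>bss S i\<close> is the enumeration \<open>[i\<^sub>1, \<dots>]\<close> of the base stations that serve user \<open>i\<close>;
  \<open>nvar S\<close> is the noise variance (not its square root).\<close>

record network =
  nBS :: nat
  nUE :: nat
  nTx :: nat
  nRx :: nat
  nStr :: "nat \<Rightarrow> nat"
  bss :: "nat \<Rightarrow> nat list"
  pwr :: "nat \<Rightarrow> real"
  nvar :: real
  wt :: "nat \<Rightarrow> real"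
  chan :: "nat \<Rightarrow> nat \<Rightarrow> complex mat"

definition valid_network :: "network \<Rightarrow> bool"
  where "valid_network S \<longleftrightarrow>
    0 < nBS S \<and> 0 < nUE S \<and> 0 < nTx S \<and> 0 < nRx S \<and> 0 < nvar S \<and>
    (\<forall>k<nBS S. 0 < pwr S k) \<and>
    (\<forall>i<nUE S. 0 < nStr S i \<and> bss S i \<noteq> [] \<and> distinct (bss S i) \<and> set (bss S i) \<subseteq> {..<nBS S} \<and>
       (\<forall>k<nBS S. chan S i k \<in> carrier_mat (nRx S) (nTx S)))"

abbreviation nserv :: "network \<Rightarrow> nat \<Rightarrow> nat"
  where "nserv S i \<equiv> length (bss S i)"

definition served :: "network \<Rightarrow> nat \<Rightarrow> nat set"
  where "served S k = {i. i < nUE S \<and> k \<in> set (bss S i)}"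

definition Wm :: "network \<Rightarrow> nat \<Rightarrow> complex mat"
  where "Wm S i = block_matrix (nBS S) (nserv S i) (nTx S) (nTx S)
    (\<lambda>r n. if r = bss S i ! n then 1\<^sub>m (nTx S) else 0\<^sub>m (nTx S) (nTx S))"

definition Qm :: "network \<Rightarrow> nat \<Rightarrow> complex mat"
  where "Qm S k = block_matrix (nBS S) (nBS S) (nTx S) (nTx S)
    (\<lambda>r c. if r = k \<and> c = k then 1\<^sub>m (nTx S) else 0\<^sub>m (nTx S) (nTx S))"

definition Hm :: "network \<Rightarrow> nat \<Rightarrow> complex mat"
  where "Hm S i = block_matrix 1 (nBS S) (nRx S) (nTx S) (\<lambda>_ k. chan S i k)"

definition Rm :: "network \<Rightarrow> complex mat list \<Rightarrow> nat \<Rightarrow> complex mat"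
  where "Rm S P i =
    Hm S i * msum (nBS S * nTx S) (nBS S * nTx S)
      (\<lambda>j. Wm S j * P ! j * (P ! j)\<^sup>H * (Wm S j)\<^sup>H) ({..<nUE S} - {i}) * (Hm S i)\<^sup>H
    + nvar S *\<^sub>r 1\<^sub>m (nRx S)"

definition Cm :: "network \<Rightarrow> complex mat list \<Rightarrow> nat \<Rightarrow> complex mat"
  where "Cm S P i = minv (1\<^sub>m (nStr S i) +
    (P ! i)\<^sup>H * (Wm S i)\<^sup>H * (Hm S i)\<^sup>H * minv (Rm S P i) * Hm S i * Wm S i * P ! i)"

text \<open>The determinants are those of Hermitian positive definite matrices, hence real; \<^const>\<open>Re\<close> only
  changes the type.\<close>

definition rate :: "network \<Rightarrow> complex mat list \<Rightarrow> nat \<Rightarrow> real"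
  where "rate S P i =
    ln (Re (det (Rm S P i + Hm S i * Wm S i * P ! i * (P ! i)\<^sup>H * (Wm S i)\<^sup>H * (Hm S i)\<^sup>H)))
    - ln (Re (det (Rm S P i)))"

definition neg_wsr :: "network \<Rightarrow> complex mat list \<Rightarrow> real"
  where "neg_wsr S P = - (\<Sum>i<nUE S. wt S i * rate S P i)"


section \<open>The spaces of precoders\<close>

definition Ni :: "network \<Rightarrow> nat \<Rightarrow> complex mat set"
  where "Ni S i = carrier_mat (nserv S i * nTx S) (nStr S i)"

definition Nik :: "network \<Rightarrow> nat \<Rightarrow> complex mat set"
  where "Nik S i = carrier_mat (nTx S) (nStr S i)"

definition Nn :: "network \<Rightarrow> complex mat list set"
  where "Nn S = {P. length P = nUE S \<and> (\<forall>i<nUE S. P ! i \<in> Ni S i)}"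

definition ipN :: "network \<Rightarrow> complex mat list \<Rightarrow> complex mat list \<Rightarrow> real"
  where "ipN S \<xi> \<zeta> = (\<Sum>i<nUE S. mat_ip (\<xi> ! i) (\<zeta> ! i))"

definition Mm :: "network \<Rightarrow> complex mat list set"
  where "Mm S = {P \<in> Nn S. \<forall>k<nBS S.
    (\<Sum>i\<in>served S k. tr ((P ! i)\<^sup>H * (Wm S i)\<^sup>H * Qm S k * Wm S i * P ! i)) = complex_of_real (pwr S k)}"

text \<open>Vertical stacking of the \<open>nserv S i\<close> blocks of user \<open>i\<close>, and extraction of the block in position
  \<open>n\<close>, i.e. of \<open>P\<^bsub>i,k\<^esub>\<close> for \<open>k = bss S i ! n\<close>.\<close>

definition stack :: "network \<Rightarrow> nat \<Rightarrow> (nat \<Rightarrow> complex mat) \<Rightarrow> complex mat"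
  where "stack S i X = block_matrix (nserv S i) 1 (nTx S) (nStr S i) (\<lambda>n _. X n)"

definition block :: "network \<Rightarrow> nat \<Rightarrow> complex mat \<Rightarrow> nat \<Rightarrow> complex mat"
  where "block S i X n = mat (nTx S) (nStr S i) (\<lambda>(a, b). X $$ (n * nTx S + a, b))"


section \<open>Gradients on linear spaces\<close>

text \<open>For a finite-dimensional real linear space \<open>V\<close> with addition \<open>pl\<close> and inner product \<open>g\<close>:
  \<open>G\<close> lies in \<open>V\<close>, and the linear map \<open>\<xi> \<mapsto> g G \<xi>\<close> is the Frechet differential of \<open>f\<close> at \<open>x\<close>.\<close>

definition is_gradient ::
  "'v set \<Rightarrow> ('v \<Rightarrow> 'v \<Rightarrow> 'v) \<Rightarrow> ('v \<Rightarrow> 'v \<Rightarrow> real) \<Rightarrow> ('v \<Rightarrow> real) \<Rightarrow> 'v \<Rightarrow> 'v \<Rightarrow> bool"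
  where "is_gradient V pl g f x G \<longleftrightarrow> G \<in> V \<and>
    (\<forall>\<epsilon>>0. \<exists>\<delta>>0. \<forall>\<xi>\<in>V. sqrt (g \<xi> \<xi>) < \<delta> \<longrightarrow>
       \<bar>f (pl x \<xi>) - f x - g G \<xi>\<bar> \<le> \<epsilon> * sqrt (g \<xi> \<xi>))"

definition is_grad_N :: "network \<Rightarrow> (complex mat list \<Rightarrow> real) \<Rightarrow> complex mat list \<Rightarrow> complex mat list \<Rightarrow> bool"
  where "is_grad_N S f P = is_gradient (Nn S) (map2 (+)) (ipN S) f P"

definition is_grad_Ni ::
  "network \<Rightarrow> (complex mat list \<Rightarrow> real) \<Rightarrow> complex mat list \<Rightarrow> nat \<Rightarrow> complex mat \<Rightarrow> bool"
  where "is_grad_Ni S f P i =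
    is_gradient (Ni S i) (+) mat_ip (\<lambda>X. f (P[i := X])) (P ! i)"

text \<open>Here \<open>f\<close> is a function of the block \<open>P\<^bsub>i,k\<^esub>\<close>, \<open>k = bss S i ! n\<close>, all other blocks being fixed.\<close>

definition is_grad_Nik ::
  "network \<Rightarrow> (complex mat list \<Rightarrow> real) \<Rightarrow> complex mat list \<Rightarrow> nat \<Rightarrow> nat \<Rightarrow> complex mat \<Rightarrow> bool"
  where "is_grad_Nik S f P i n =
    is_gradient (Nik S i) (+) mat_ip
      (\<lambda>X. f (P[i := stack S i ((block S i (P ! i))(n := X))])) (block S i (P ! i) n)"

definition grad_N :: "network \<Rightarrow> (complex mat list \<Rightarrow> real) \<Rightarrow> complex mat list \<Rightarrow> complex mat list"
  where "grad_N S f P = (THE G. is_grad_N S f P G)"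

definition grad_Ni :: "network \<Rightarrow> (complex mat list \<Rightarrow> real) \<Rightarrow> complex mat list \<Rightarrow> nat \<Rightarrow> complex mat"
  where "grad_Ni S f P i = (THE G. is_grad_Ni S f P i G)"

definition grad_Nik ::
  "network \<Rightarrow> (complex mat list \<Rightarrow> real) \<Rightarrow> complex mat list \<Rightarrow> nat \<Rightarrow> nat \<Rightarrow> complex mat"
  where "grad_Nik S f P i n = (THE G. is_grad_Nik S f P i n G)"


section \<open>Gradients on submanifolds\<close>

definition smooth_on_interval :: "real \<Rightarrow> (real \<Rightarrow> complex) \<Rightarrow> bool"
  where "smooth_on_interval e h \<longleftrightarrow> (\<exists>D. \<forall>t\<in>{-e<..<e}. D 0 t = h t \<and>
    (\<forall>n::nat. (D n has_vector_derivative D (Suc n) t) (at t)))"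

text \<open>\<open>c\<close> restricts to a smooth curve, defined on an open interval around 0, in the subset \<open>A\<close> of
  \<^term>\<open>Nn S\<close>, with \<open>c 0 = P\<close> and velocity \<open>c' 0 = X\<close>.\<close>

definition smooth_curve ::
  "network \<Rightarrow> complex mat list set \<Rightarrow> complex mat list \<Rightarrow> complex mat list \<Rightarrow> (real \<Rightarrow> complex mat list) \<Rightarrow> bool"
  where "smooth_curve S A P X c \<longleftrightarrow> c 0 = P \<and> X \<in> Nn S \<and>
    (\<exists>e>0. (\<forall>t\<in>{-e<..<e}. c t \<in> A) \<and>
      (\<forall>i<nUE S. \<forall>a<nserv S i * nTx S. \<forall>b<nStr S i.
         smooth_on_interval e (\<lambda>t. (c t ! i) $$ (a, b)) \<and>
         ((\<lambda>t. (c t ! i) $$ (a, b)) has_vector_derivative (X ! i) $$ (a, b)) (at 0)))"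

definition tangent_space :: "network \<Rightarrow> complex mat list set \<Rightarrow> complex mat list \<Rightarrow> complex mat list set"
  where "tangent_space S A P = {X. \<exists>c. smooth_curve S A P X c}"

text \<open>The differential of \<open>f\<close> restricted to the submanifold, in the direction of \<open>X\<close>, is the derivative
  at 0 of \<open>f \<circ> c\<close> for the curves \<open>c\<close> with velocity \<open>X\<close>. The metric is the induced one.\<close>

definition is_riem_grad ::
  "network \<Rightarrow> complex mat list set \<Rightarrow> (complex mat list \<Rightarrow> real) \<Rightarrow> complex mat list \<Rightarrow> complex mat list \<Rightarrow> bool"
  where "is_riem_grad S A f P G \<longleftrightarrow> G \<in> tangent_space S A P \<and>
    (\<forall>X c. smooth_curve S A P X c \<longrightarrow> ((\<lambda>t. f (c t)) has_real_derivative ipN S G X) (at 0))"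

definition riem_grad ::
  "network \<Rightarrow> complex mat list set \<Rightarrow> (complex mat list \<Rightarrow> real) \<Rightarrow> complex mat list \<Rightarrow> complex mat list"
  where "riem_grad S A f P = (THE G. is_riem_grad S A f P G)"

end

theory Submission
  imports Defs "HOL-Library.Landau_Symbols"
begin

text \<open>With \<open>K\<^sub>i\<^sub>j = H\<^sub>i W\<^sub>j\<close>, the rate of user \<open>i\<close> is \<open>ln det Y\<^sub>i - ln det R\<^sub>i\<close> for covariance matrices of the form
  \<open>\<Sum>\<^sub>j K\<^sub>i\<^sub>j P\<^sub>j P\<^sub>j\<^sup>H K\<^sub>i\<^sub>j\<^sup>H + \<sigma>\<^sup>2 I\<close>, and the differential of \<open>ln det Y\<close> is \<open>tr (Y\<^sup>-\<^sup>1 dY)\<close>. The Woodbury identity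
  for \<open>Y\<^sub>i = R\<^sub>i + B B\<^sup>H\<close> turns the resulting \<open>Y\<^sub>i\<^sup>-\<^sup>1\<close> into \<open>R\<^sub>i\<^sup>-\<^sup>1\<close> and \<open>C\<^sub>i\<close>. As matrices of variable size are not a
  normed type, differentials are little-o expansions along a filter of small increments. The manifold is a product
  of spheres, one per base station, so a tangent vector is the velocity of a curve of rotations, and the Riemannian
  gradient is the Euclidean one minus its radial component on every sphere.\<close>

section \<open>First-order expansions\<close>

text \<open>Every gradient is a \<open>THE\<close>, so each formula carries an existence and a
  uniqueness claim. Existence is proved only on the whole space; zero padding passes it on to single
  users and single blocks. Uniqueness is proved on spaces of matrices and lifted to the whole space
  component by component. Expansions take complex values throughout, because Landau symbols compare
  functions into one common field and entries, determinants and rates have to be combined. The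
  covariance depends on a precoder through \<open>B * B^H\<close>, whose two first-order terms have
  conjugate traces; hence the factor 2. The precoder of user j enters both covariance matrices of
  another receiver, but only the larger one of its own. This gives the coefficients
  \<open>Y^-1 - R^-1\<close> and \<open>Y^-1\<close>, and the opposite signs in the final formula. A
  power constraint belongs to a base station and cuts across the users, whereas the data are sorted
  by user. Hence the manifold is studied through single entries grouped by station. The number
  \<open>lambda_k\<close> is the coefficient of the orthogonal projection onto the component of
  \<open>P\<close> at station k, whose squared norm is \<open>P_k\<close>.\<close>

locale infinitesimal =
  fixes F :: "'v filter" and r :: "'v \<Rightarrow> complex"
  assumes r_small: "r \<in> o[F](\<lambda>_. 1)"
begin

text \<open>Here \<open>l\<close> plays the differential, but linearity is not demanded: the
  argument type has no vector space structure. The bound \<open>O[F](r)\<close> is what the product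
  rule needs.\<close>

definition expands :: "('v \<Rightarrow> complex) \<Rightarrow> complex \<Rightarrow> ('v \<Rightarrow> complex) \<Rightarrow> bool"
  where "expands u u0 l \<longleftrightarrow> (\<lambda>x. u x - u0 - l x) \<in> o[F](r) \<and> l \<in> O[F](r)"

lemma expandsD:
  assumes "expands u u0 l"
  shows "(\<lambda>x. u x - u0) \<in> O[F](r)" "(\<lambda>x. u x - u0) \<in> o[F](\<lambda>_. 1)" "u \<in> O[F](\<lambda>_. 1)"
proof -
  have "(\<lambda>x. (u x - u0 - l x) + l x) \<in> O[F](r)"
    using assms unfolding expands_def by (intro sum_in_bigo(1)) (auto intro: landau_o.small_imp_big)
  then show 1: "(\<lambda>x. u x - u0) \<in> O[F](r)"
    by simp
  then show 2: "(\<lambda>x. u x - u0) \<in> o[F](\<lambda>_. 1)"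
    using r_small by (rule landau_o.big_small_trans)
  have "(\<lambda>x. (u x - u0) + u0) \<in> O[F](\<lambda>_. 1)"
    by (intro sum_in_bigo(1) landau_o.small_imp_big[OF 2]) simp
  then show "u \<in> O[F](\<lambda>_. 1)"
    by simp
qed

lemma expands_cong:
  assumes "expands u u0 l" "\<forall>\<^sub>F x in F. u' x = u x" "\<forall>\<^sub>F x in F. l' x = l x"
  shows "expands u' u0 l'"
proof -
  have "\<forall>\<^sub>F x in F. u' x - u0 - l' x = u x - u0 - l x"
    using assms(2,3) by eventually_elim simp
  then have "(\<lambda>x. u' x - u0 - l' x) \<in> o[F](r) \<longleftrightarrow> (\<lambda>x. u x - u0 - l x) \<in> o[F](r)"
    by (rule landau_o.small.in_cong)
  moreover have "l' \<in> O[F](r) \<longleftrightarrow> l \<in> O[F](r)"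
    using assms(3) by (rule landau_o.big.in_cong)
  ultimately show ?thesis
    using assms(1) by (simp add: expands_def)
qed

lemma expands_const: "expands (\<lambda>_. c) c (\<lambda>_. 0)"
  by (simp add: expands_def)

lemma expands_linear: "l \<in> O[F](r) \<Longrightarrow> expands l 0 l"
  by (simp add: expands_def)

lemma expands_add:
  assumes "expands u u0 l" "expands v v0 m"
  shows "expands (\<lambda>x. u x + v x) (u0 + v0) (\<lambda>x. l x + m x)"
proof -
  have "(\<lambda>x. (u x - u0 - l x) + (v x - v0 - m x)) \<in> o[F](r)"
    using assms unfolding expands_def by (intro sum_in_smallo(1)) auto
  then show ?thesis
    using assms unfolding expands_def by (auto intro: sum_in_bigo simp: algebra_simps)
qed

lemma expands_sum:
  assumes "\<And>i. i \<in> I \<Longrightarrow> expands (u i) (u0 i) (l i)"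
  shows "expands (\<lambda>x. \<Sum>i\<in>I. u i x) (\<Sum>i\<in>I. u0 i) (\<lambda>x. \<Sum>i\<in>I. l i x)"
proof -
  have "(\<lambda>x. \<Sum>i\<in>I. (u i x - u0 i - l i x)) \<in> o[F](r)"
    using assms unfolding expands_def by (intro big_sum_in_smallo) auto
  then show ?thesis
    using assms unfolding expands_def by (auto intro: big_sum_in_bigo simp: sum_subtractf)
qed

text \<open>The error of the product telescopes into (error of \<open>u\<close>) times
  \<open>v\<close>, (error of \<open>v\<close>) times \<open>u0\<close>, and \<open>l\<close> times
  \<open>v - v0\<close>. Each is a bounded function times a small one, or the reverse.\<close>

lemma expands_mult:
  assumes "expands u u0 l" "expands v v0 m"
  shows "expands (\<lambda>x. u x * v x) (u0 * v0) (\<lambda>x. u0 * m x + v0 * l x)"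
proof -
  have l: "(\<lambda>x. u x - u0 - l x) \<in> o[F](r)" "l \<in> O[F](r)"
    and m: "(\<lambda>x. v x - v0 - m x) \<in> o[F](r)" "m \<in> O[F](r)"
    using assms by (auto simp: expands_def)
  have 1: "(\<lambda>x. (u x - u0 - l x) * v x) \<in> o[F](r)"
    using landau_o.small_big_mult[OF l(1) expandsD(3)[OF assms(2)]] by simp
  have 2: "(\<lambda>x. (v x - v0 - m x) * u0) \<in> o[F](r)"
    using landau_o.small_big_mult[OF m(1) bigo_const] by simp
  have 3: "(\<lambda>x. l x * (v x - v0)) \<in> o[F](r)"
    using landau_o.big_small_mult[OF l(2) expandsD(2)[OF assms(2)]] by simp
  have "(\<lambda>x. (u x - u0 - l x) * v x + (v x - v0 - m x) * u0 + l x * (v x - v0)) \<in> o[F](r)"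
    by (intro sum_in_smallo(1) 1 2 3)
  also have "(\<lambda>x. (u x - u0 - l x) * v x + (v x - v0 - m x) * u0 + l x * (v x - v0)) =
    (\<lambda>x. u x * v x - u0 * v0 - (u0 * m x + v0 * l x))"
    by (simp add: fun_eq_iff algebra_simps)
  finally show ?thesis
    using l m unfolding expands_def by (auto intro!: sum_in_bigo)
qed

lemma expands_cmult:
  assumes "expands u u0 l"
  shows "expands (\<lambda>x. c * u x) (c * u0) (\<lambda>x. c * l x)"
  using expands_mult[OF expands_const[of c] assms] by simp

lemma expands_cnj:
  assumes "expands u u0 l"
  shows "expands (\<lambda>x. cnj (u x)) (cnj u0) (\<lambda>x. cnj (l x))"
proof -
  have "(\<lambda>x. cnj (u x) - cnj u0 - cnj (l x)) \<in> o[F](r)" if "(\<lambda>x. u x - u0 - l x) \<in> o[F](r)"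
  proof (rule landau_o.smallI)
    fix c :: real assume "c > 0"
    from landau_o.smallD[OF that this]
    show "\<forall>\<^sub>F x in F. norm (cnj (u x) - cnj u0 - cnj (l x)) \<le> c * norm (r x)"
      by (simp flip: complex_cnj_diff)
  qed
  moreover have "(\<lambda>x. cnj (l x)) \<in> O[F](r)" if "l \<in> O[F](r)"
    using that by (elim landau_o.bigE) (auto intro: bigoI)
  ultimately show ?thesis
    using assms by (simp add: expands_def)
qed

lemma expands_prod:
  assumes "finite I" "\<And>i. i \<in> I \<Longrightarrow> expands (u i) (u0 i) (l i)"
  shows "expands (\<lambda>x. \<Prod>i\<in>I. u i x) (\<Prod>i\<in>I. u0 i) (\<lambda>x. \<Sum>i\<in>I. l i x * (\<Prod>j\<in>I - {i}. u0 j))"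
  using assms
proof (induction I rule: finite_induct)
  case empty
  then show ?case by (simp add: expands_const)
next
  case (insert k I)
  have eq: "(\<Sum>i\<in>insert k I. l i x * (\<Prod>j\<in>insert k I - {i}. u0 j)) =
    u0 k * (\<Sum>i\<in>I. l i x * (\<Prod>j\<in>I - {i}. u0 j)) + (\<Prod>i\<in>I. u0 i) * l k x" for x
  proof -
    have "(\<Prod>j\<in>insert k I - {i}. u0 j) = u0 k * (\<Prod>j\<in>I - {i}. u0 j)" if "i \<in> I" for i
    proof -
      have "insert k I - {i} = insert k (I - {i})"
        using insert that by auto
      then show ?thesis
        using insert by simp
    qed
    then have "(\<Sum>i\<in>I. l i x * (\<Prod>j\<in>insert k I - {i}. u0 j)) =
        u0 k * (\<Sum>i\<in>I. l i x * (\<Prod>j\<in>I - {i}. u0 j))"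
      unfolding sum_distrib_left by (intro sum.cong) simp_all
    then show ?thesis
      using insert by (simp add: mult_ac)
  qed
  have "expands (\<lambda>x. u k x * (\<Prod>i\<in>I. u i x)) (u0 k * (\<Prod>i\<in>I. u0 i))
      (\<lambda>x. u0 k * (\<Sum>i\<in>I. l i x * (\<Prod>j\<in>I - {i}. u0 j)) + (\<Prod>i\<in>I. u0 i) * l k x)"
    using insert by (intro expands_mult) auto
  then show ?case
    unfolding eq using insert.hyps by simp
qed

text \<open>A non-identity permutation moves at least two points, so its term in the Leibniz formula
  vanishes to second order at the identity matrix.\<close>

lemma expands_det_one:
  fixes k :: "'v \<Rightarrow> nat \<times> nat \<Rightarrow> complex"
  assumes "\<And>a b. a < n \<Longrightarrow> b < n \<Longrightarrow>
    expands (\<lambda>x. k x (a, b)) (if a = b then 1 else 0) (\<lambda>x. l x (a, b))"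
  shows "expands (\<lambda>x. det (mat n n (k x))) 1 (\<lambda>x. tr (mat n n (l x)))"
proof -
  let ?U = "{0..<n}" and ?\<delta> = "\<lambda>a b :: nat. if a = b then 1 else 0 :: complex"
  let ?S = "{p. p permutes ?U}"
  have lt: "p i < n" if "p \<in> ?S" "i < n" for p i
    using that permutes_in_image[of p ?U i] by auto
  have det: "det (mat n n m) = (\<Sum>p\<in>?S. signof p * (\<Prod>i\<in>?U. m (i, p i)))" for m :: "nat \<times> nat \<Rightarrow> complex"
    by (subst det_def'[of _ n]) (auto intro!: sum.cong prod.cong simp: lt)
  have "expands (\<lambda>x. \<Sum>p\<in>?S. signof p * (\<Prod>i\<in>?U. k x (i, p i)))
      (\<Sum>p\<in>?S. signof p * (\<Prod>i\<in>?U. ?\<delta> i (p i)))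
      (\<lambda>x. \<Sum>p\<in>?S. signof p * (\<Sum>i\<in>?U. l x (i, p i) * (\<Prod>j\<in>?U - {i}. ?\<delta> j (p j))))"
    by (intro expands_sum expands_cmult expands_prod assms) (auto simp: lt)
  also have "(\<lambda>x. \<Sum>p\<in>?S. signof p * (\<Prod>i\<in>?U. k x (i, p i))) = (\<lambda>x. det (mat n n (k x)))"
    by (simp add: det)
  also have "(\<Sum>p\<in>?S. signof p * (\<Prod>i\<in>?U. ?\<delta> i (p i))) = det (mat n n (\<lambda>(a, b). ?\<delta> a b))"
    by (simp add: det)
  also have "mat n n (\<lambda>(a, b). ?\<delta> a b) = 1\<^sub>m n"
    by (auto simp: one_mat_def)
  also have "(\<lambda>x. \<Sum>p\<in>?S. signof p * (\<Sum>i\<in>?U. l x (i, p i) * (\<Prod>j\<in>?U - {i}. ?\<delta> j (p j)))) =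
      (\<lambda>x. tr (mat n n (l x)))"
  proof
    fix x
    have "(\<Prod>j\<in>?U - {i}. ?\<delta> j (p j)) = 0" if p: "p \<in> ?S - {id}" for p i
    proof -
      have "\<exists>j\<in>?U - {i}. p j \<noteq> j"
      proof (rule ccontr)
        assume "\<not> ?thesis"
        then have fix_pt: "p j = j" if "j \<noteq> i" for j
          using that p by (cases "j < n") (auto simp: permutes_def)
        \<comment> \<open>If \<open>p i\<close> differed from \<open>i\<close>, it would be a fixed
          point with the two preimages \<open>i\<close> and \<open>p i\<close>.\<close>
        then have "p i = i"
          using p by (metis DiffD1 mem_Collect_eq permutes_def)
        with fix_pt have "p = id"
          by (metis eq_id_iff)
        with p show False by simp
      qed
      then obtain j where "j \<in> ?U - {i}" "p j \<noteq> j" ..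
      then show ?thesis
        by (intro prod_zero bexI[of _ j]) auto
    qed
    then have "(\<Sum>p\<in>?S. signof p * (\<Sum>i\<in>?U. l x (i, p i) * (\<Prod>j\<in>?U - {i}. ?\<delta> j (p j)))) =
        (\<Sum>p\<in>{id}. signof p * (\<Sum>i\<in>?U. l x (i, p i) * (\<Prod>j\<in>?U - {i}. ?\<delta> j (p j))))"
      by (intro sum.mono_neutral_right) (auto simp: permutes_id finite_permutations)
    also have "\<dots> = tr (mat n n (l x))"
      by (simp add: tr_def lessThan_atLeast0)
    finally show "(\<Sum>p\<in>?S. signof p * (\<Sum>i\<in>?U. l x (i, p i) * (\<Prod>j\<in>?U - {i}. ?\<delta> j (p j)))) =
      tr (mat n n (l x))" .
  qed
  finally show ?thesis by simp
qed

text \<open>Multiplication by the left inverse \<open>N\<close> moves the base point to the identity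
  matrix. Since \<open>det N\<close> is the reciprocal of \<open>det k0\<close>, multiplying by
  \<open>det k0\<close> undoes this.\<close>

lemma expands_det:
  fixes k :: "'v \<Rightarrow> nat \<times> nat \<Rightarrow> complex"
  assumes k: "\<And>a b. a < n \<Longrightarrow> b < n \<Longrightarrow> expands (\<lambda>x. k x (a, b)) (k0 (a, b)) (\<lambda>x. l x (a, b))"
    and N: "N \<in> carrier_mat n n" "N * mat n n k0 = 1\<^sub>m n"
  shows "expands (\<lambda>x. det (mat n n (k x))) (det (mat n n k0))
    (\<lambda>x. det (mat n n k0) * tr (N * mat n n (l x)))"
proof -
  have mult: "N * mat n n m = mat n n (\<lambda>(a, b). \<Sum>c\<in>{0..<n}. N $$ (a, c) * m (c, b))" for m
    using N(1) by (intro eq_matI) (auto simp: scalar_prod_def)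
  have "expands (\<lambda>x. \<Sum>c\<in>{0..<n}. N $$ (a, c) * k x (c, b)) (if a = b then 1 else 0)
     (\<lambda>x. \<Sum>c\<in>{0..<n}. N $$ (a, c) * l x (c, b))" if "a < n" "b < n" for a b
  proof -
    have "(\<Sum>c\<in>{0..<n}. N $$ (a, c) * k0 (c, b)) = (if a = b then 1 else 0)"
      using arg_cong[OF N(2)[unfolded mult], of "\<lambda>A. A $$ (a, b)"] that by simp
    moreover have "expands (\<lambda>x. \<Sum>c\<in>{0..<n}. N $$ (a, c) * k x (c, b))
        (\<Sum>c\<in>{0..<n}. N $$ (a, c) * k0 (c, b)) (\<lambda>x. \<Sum>c\<in>{0..<n}. N $$ (a, c) * l x (c, b))"
      using that by (intro expands_sum expands_cmult k) auto
    ultimately show ?thesis by simp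
  qed
  then have "expands (\<lambda>x. det (N * mat n n (k x))) 1 (\<lambda>x. tr (N * mat n n (l x)))"
    unfolding mult by (intro expands_det_one) auto
  then have "expands (\<lambda>x. det (mat n n k0) * det (N * mat n n (k x))) (det (mat n n k0) * 1)
      (\<lambda>x. det (mat n n k0) * tr (N * mat n n (l x)))"
    by (rule expands_cmult)
  moreover have "det (mat n n k0) * det (N * mat n n m) = det (mat n n m)" for m
  proof -
    have "det N * det (mat n n k0) = 1"
      using det_mult[OF N(1), of "mat n n k0"] N(2) by simp
    then show ?thesis
      using det_mult[OF N(1), of "mat n n m"] by (simp add: algebra_simps)
  qed
  ultimately show ?thesis by simp
qed

text \<open>The linear part is assumed in the form \<open>c * l\<close>, which is how the
  determinant supplies it (\<open>det\<close> times a trace); the derivative \<open>1 / c\<close> of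
  the logarithm then cancels \<open>c\<close>.\<close>

lemma expands_ln_Re:
  assumes u: "expands u (complex_of_real c) (\<lambda>x. complex_of_real c * l x)" and c: "c > 0"
  shows "expands (\<lambda>x. complex_of_real (ln (Re (u x)))) (complex_of_real (ln c))
    (\<lambda>x. complex_of_real (Re (l x)))"
proof -
  have l: "l \<in> O[F](r)"
    using u c by (simp add: expands_def)
  have Re_norm: "(\<lambda>x. complex_of_real (Re (f x))) \<in> o[F](r)" if "f \<in> o[F](r)" for f
  proof (rule landau_o.smallI)
    fix e :: real assume "e > 0"
    from landau_o.smallD[OF that this]
    show "\<forall>\<^sub>F x in F. norm (complex_of_real (Re (f x))) \<le> e * norm (r x)"
      by eventually_elim (metis abs_Re_le_cmod norm_of_real order_trans)
  qed
  have Re_norm': "(\<lambda>x. complex_of_real (Re (f x))) \<in> O[F](r)" if f: "f \<in> O[F](r)" for f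
  proof -
    obtain e where "\<forall>\<^sub>F x in F. norm (f x) \<le> e * norm (r x)"
      using f by (elim landau_o.bigE)
    then have "\<forall>\<^sub>F x in F. norm (complex_of_real (Re (f x))) \<le> e * norm (r x)"
      by eventually_elim (metis abs_Re_le_cmod norm_of_real order_trans)
    then show ?thesis by (rule bigoI)
  qed
  have "((\<lambda>x. u x - complex_of_real c) \<longlongrightarrow> 0) F"
    using smalloD_tendsto[OF expandsD(2)[OF u]] by simp
  then have "((\<lambda>x. Re (u x - complex_of_real c)) \<longlongrightarrow> Re 0) F"
    by (rule tendsto_Re)
  then have lim: "((\<lambda>x. Re (u x)) \<longlongrightarrow> c) F"
    by (simp add: LIM_zero_iff)
  \<comment> \<open>Along \<open>nhds c\<close> rather than \<open>at c\<close>, because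
    \<open>Re (u x)\<close> may hit \<open>c\<close> itself. At \<open>y = c\<close> both sides are
    0, so the punctured estimate extends.\<close>
  have "(\<lambda>y. ln y - ln c - (y - c) / c) \<in> o[nhds c](\<lambda>y. y - c)"
  proof (rule landau_o.smallI)
    fix e :: real assume "e > 0"
    have "(ln has_real_derivative inverse c) (at c)"
      using DERIV_ln[OF c] by simp
    then have "((\<lambda>y. (ln y - ln c) / (y - c)) \<longlongrightarrow> inverse c) (at c)"
      by (simp add: has_field_derivative_iff)
    then have "\<forall>\<^sub>F y in at c. \<bar>(ln y - ln c) / (y - c) - inverse c\<bar> < e"
      using \<open>e > 0\<close> by (auto simp: tendsto_iff dist_real_def)
    then have "\<forall>\<^sub>F y in at c. norm (ln y - ln c - (y - c) / c) \<le> e * norm (y - c)"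
      unfolding eventually_at_filter
    proof eventually_elim
      case (elim y)
      show ?case
      proof (intro impI)
        assume "y \<noteq> c"
        then have "(ln y - ln c) - (y - c) / c = ((ln y - ln c) / (y - c) - inverse c) * (y - c)"
          by (simp add: field_simps)
        then have "\<bar>ln y - ln c - (y - c) / c\<bar> = \<bar>(ln y - ln c) / (y - c) - inverse c\<bar> * \<bar>y - c\<bar>"
          by (simp only: abs_mult)
        also have "\<dots> \<le> e * \<bar>y - c\<bar>"
          using elim \<open>y \<noteq> c\<close> by (intro mult_right_mono) auto
        finally show "norm (ln y - ln c - (y - c) / c) \<le> e * norm (y - c)"
          by simp
      qed
    qed
    then show "\<forall>\<^sub>F y in nhds c. norm (ln y - ln c - (y - c) / c) \<le> e * norm (y - c)"
      by (auto simp: eventually_at_filter elim!: eventually_mono)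
  qed
  then have 1: "(\<lambda>x. ln (Re (u x)) - ln c - (Re (u x) - c) / c) \<in> o[F](\<lambda>x. Re (u x) - c)"
    using lim by (rule landau_o.small.compose)
  have "(\<lambda>x. complex_of_real (ln (Re (u x)) - ln c - (Re (u x) - c) / c)) \<in>
      o[F](\<lambda>x. complex_of_real (Re (u x - complex_of_real c)))"
    using 1 by (subst landau_o.small.of_real_iff) simp
  then have 2: "(\<lambda>x. complex_of_real (ln (Re (u x)) - ln c - (Re (u x) - c) / c)) \<in> o[F](r)"
    by (rule landau_o.small_big_trans) (rule Re_norm'[OF expandsD(1)[OF u]])
  have "(\<lambda>x. complex_of_real (Re (u x - complex_of_real c - complex_of_real c * l x))) \<in> o[F](r)"
    using u by (intro Re_norm) (simp add: expands_def)
  then have 3: "(\<lambda>x. complex_of_real (inverse c) * complex_of_real (Re (u x - complex_of_real c - complex_of_real c * l x))) \<in> o[F](r)"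
    using c by (intro landau_o.small.cmult_in_iff[THEN iffD2]) auto
  have "(\<lambda>x. complex_of_real (ln (Re (u x))) - complex_of_real (ln c) - complex_of_real (Re (l x))) \<in> o[F](r)"
  proof -
    \<comment> \<open>The remainder of \<open>ln\<close> and \<open>1 / c\<close> times the
      remainder of \<open>u\<close> add up to the remainder claimed.\<close>
    have eq: "complex_of_real (ln (Re (u x)) - ln c - (Re (u x) - c) / c) +
        complex_of_real (inverse c) *
          complex_of_real (Re (u x - complex_of_real c - complex_of_real c * l x)) =
      complex_of_real (ln (Re (u x))) - complex_of_real (ln c) - complex_of_real (Re (l x))" for x
      unfolding of_real_mult[symmetric] of_real_add[symmetric] of_real_diff[symmetric]
      using c by (intro arg_cong[of _ _ complex_of_real]) (simp add: field_simps)
    show ?thesis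
      using sum_in_smallo(1)[OF 2 3] unfolding eq .
  qed
  then show ?thesis
    using Re_norm'[OF l] by (simp add: expands_def)
qed

end

section \<open>Matrix algebra and covariance matrices\<close>

lemma dim_herm [simp]: "dim_row (A\<^sup>H) = dim_col A" "dim_col (A\<^sup>H) = dim_row A"
  by (simp_all add: mat_adjoint_def)

lemma index_herm [simp]: "i < dim_col A \<Longrightarrow> j < dim_row A \<Longrightarrow> A\<^sup>H $$ (i, j) = cnj (A $$ (j, i))"
  by (simp add: mat_adjoint_def mat_of_rows_def)

lemma herm_carrier [simp]: "A \<in> carrier_mat m n \<Longrightarrow> A\<^sup>H \<in> carrier_mat n m"
  by (rule carrier_matI) auto

lemma herm_herm [simp]: "((A :: complex mat)\<^sup>H)\<^sup>H = A"
  by (rule eq_matI) auto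

lemma herm_mult:
  "dim_col A = dim_row B \<Longrightarrow> (A * B)\<^sup>H = B\<^sup>H * (A :: complex mat)\<^sup>H"
  by (rule eq_matI) (auto simp: scalar_prod_def intro!: sum.cong)

lemma herm_one [simp]: "(1\<^sub>m n)\<^sup>H = (1\<^sub>m n :: complex mat)"
  by (rule eq_matI) auto

lemma mult_mat_assoc:
  "dim_col A = dim_row B \<Longrightarrow> dim_col B = dim_row C \<Longrightarrow> (A * B) * C = A * (B * (C :: complex mat))"
  by (rule assoc_mult_mat[of A "dim_row A" "dim_col A" B "dim_col B" C "dim_col C"]) auto

lemma mat_distrib:
  fixes A B C :: "complex mat"
  shows "dim_col A = dim_row B \<Longrightarrow> dim_row B = dim_row C \<Longrightarrow> dim_col B = dim_col C \<Longrightarrow>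
      A * (B + C) = A * B + A * C"
    and "dim_col A = dim_row B \<Longrightarrow> dim_row B = dim_row C \<Longrightarrow> dim_col B = dim_col C \<Longrightarrow>
      A * (B - C) = A * B - A * C"
    and "dim_col A = dim_row C \<Longrightarrow> dim_row A = dim_row B \<Longrightarrow> dim_col A = dim_col B \<Longrightarrow>
      (A + B) * C = A * C + B * C"
    and "dim_col A = dim_row C \<Longrightarrow> dim_row A = dim_row B \<Longrightarrow> dim_col A = dim_col B \<Longrightarrow>
      (A - B) * C = A * C - B * C"
  by (rule mult_add_distrib_mat[of A "dim_row A" "dim_col A" B "dim_col B" C]
        mult_minus_distrib_mat[of A "dim_row A" "dim_col A" B "dim_col B" C]
        add_mult_distrib_mat[of A "dim_row A" "dim_col A" B C "dim_col C"]
        minus_mult_distrib_mat[of A "dim_row A" "dim_col A" B C "dim_col C"]; auto)+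

lemma msum_dim [simp]: "dim_row (msum m n f I) = m" "dim_col (msum m n f I) = n"
  by (simp_all add: msum_def)

lemma msum_carrier [simp]: "msum m n f I \<in> carrier_mat m n"
  by (simp add: msum_def)

lemma msum_index [simp]: "a < m \<Longrightarrow> b < n \<Longrightarrow> msum m n f I $$ (a, b) = (\<Sum>i\<in>I. f i $$ (a, b))"
  by (simp add: msum_def)

lemma msum_cong:
  assumes "\<And>i a b. i \<in> I \<Longrightarrow> a < m \<Longrightarrow> b < n \<Longrightarrow> f i $$ (a, b) = g i $$ (a, b)"
  shows "msum m n f I = msum m n g I"
  using assms by (intro eq_matI) (auto intro!: sum.cong)

lemma mult_msum:
  assumes "dim_col A = m" "\<And>i. i \<in> I \<Longrightarrow> f i \<in> carrier_mat m n" "dim_row A = k"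
  shows "A * msum m n f I = msum k n (\<lambda>i. A * f i) I"
proof (rule eq_matI)
  fix a b assume ab: "a < dim_row (msum k n (\<lambda>i. A * f i) I)" "b < dim_col (msum k n (\<lambda>i. A * f i) I)"
  have "(A * msum m n f I) $$ (a, b) = (\<Sum>c\<in>{0..<m}. \<Sum>i\<in>I. A $$ (a, c) * f i $$ (c, b))"
    using ab assms by (simp add: scalar_prod_def sum_distrib_left)
  also have "\<dots> = (\<Sum>i\<in>I. \<Sum>c\<in>{0..<m}. A $$ (a, c) * f i $$ (c, b))"
    by (rule sum.swap)
  also have "\<dots> = (\<Sum>i\<in>I. (A * f i) $$ (a, b))"
  proof (rule sum.cong)
    fix i assume "i \<in> I"
    then have "f i \<in> carrier_mat m n" by (rule assms)
    then show "(\<Sum>c\<in>{0..<m}. A $$ (a, c) * f i $$ (c, b)) = (A * f i) $$ (a, b)"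
      using ab assms by (simp add: scalar_prod_def)
  qed simp
  finally show "(A * msum m n f I) $$ (a, b) = msum k n (\<lambda>i. A * f i) I $$ (a, b)"
    using ab by simp
qed (use assms in auto)

lemma herm_msum:
  assumes "\<And>i. i \<in> I \<Longrightarrow> f i \<in> carrier_mat m n"
  shows "(msum m n f I)\<^sup>H = msum n m (\<lambda>i. (f i)\<^sup>H) I"
proof (rule eq_matI)
  fix a b assume ab: "a < dim_row (msum n m (\<lambda>i. (f i)\<^sup>H) I)" "b < dim_col (msum n m (\<lambda>i. (f i)\<^sup>H) I)"
  have "cnj (f i $$ (b, a)) = (f i)\<^sup>H $$ (a, b)" if "i \<in> I" for i
    using ab assms[OF that] by simp
  then show "(msum m n f I)\<^sup>H $$ (a, b) = msum n m (\<lambda>i. (f i)\<^sup>H) I $$ (a, b)"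
    using ab by simp
qed auto

text \<open>Adjoints reverse products, so this is \<open>mult_msum\<close> applied to the
  adjoints.\<close>

lemma msum_mult:
  assumes "dim_row A = n" "\<And>i. i \<in> I \<Longrightarrow> f i \<in> carrier_mat m n" "dim_col A = k"
  shows "msum m n f I * A = msum m k (\<lambda>i. f i * A) I"
proof -
  have "msum m n f I * A = (A\<^sup>H * (msum m n f I)\<^sup>H)\<^sup>H"
    using assms by (simp add: herm_mult)
  also have "\<dots> = (msum k m (\<lambda>i. A\<^sup>H * (f i)\<^sup>H) I)\<^sup>H"
    using assms by (simp add: herm_msum mult_msum[of _ n I _ m k])
  also have "\<dots> = msum m k (\<lambda>i. (A\<^sup>H * (f i)\<^sup>H)\<^sup>H) I"
  proof (rule herm_msum)
    have "A \<in> carrier_mat n k"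
      using assms by auto
    then show "A\<^sup>H * (f i)\<^sup>H \<in> carrier_mat k m" if "i \<in> I" for i
      using assms(2)[OF that] by (intro mult_carrier_mat[of _ _ n]) auto
  qed
  also have "\<dots> = msum m k (\<lambda>i. f i * A) I"
  proof (rule msum_cong)
    fix i a b assume "i \<in> I"
    then have "dim_col (f i) = dim_row A"
      using assms by auto
    then show "(A\<^sup>H * (f i)\<^sup>H)\<^sup>H $$ (a, b) = (f i * A) $$ (a, b)"
      by (simp add: herm_mult)
  qed
  finally show ?thesis .
qed

lemma msum_remove:
  assumes "finite I" "i \<in> I" "f i \<in> carrier_mat m n"
  shows "msum m n f I = f i + msum m n f (I - {i})"
  using assms by (intro eq_matI) (auto simp: sum.remove)

lemma tr_comm:
  assumes "A \<in> carrier_mat m n" "B \<in> carrier_mat n m"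
  shows "tr (A * B) = tr (B * A)"
proof -
  have "tr (A * B) = (\<Sum>a<m. \<Sum>c<n. A $$ (a, c) * B $$ (c, a))"
    using assms by (simp add: tr_def scalar_prod_def lessThan_atLeast0)
  also have "\<dots> = (\<Sum>c<n. \<Sum>a<m. B $$ (c, a) * A $$ (a, c))"
    by (subst sum.swap) (simp add: mult.commute)
  also have "\<dots> = tr (B * A)"
    using assms by (simp add: tr_def scalar_prod_def lessThan_atLeast0)
  finally show ?thesis .
qed

lemma tr_herm: "dim_row A = dim_col A \<Longrightarrow> tr (A\<^sup>H) = cnj (tr A)"
  by (simp add: tr_def)

lemma tr_add: "dim_row A = dim_row B \<Longrightarrow> dim_col B = dim_row B \<Longrightarrow> tr (A + B) = tr A + tr B"
  by (simp add: tr_def sum.distrib)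

lemma tr_msum:
  assumes "\<And>i. i \<in> I \<Longrightarrow> f i \<in> carrier_mat m m"
  shows "tr (msum m m f I) = (\<Sum>i\<in>I. tr (f i))"
proof -
  have "tr (msum m m f I) = (\<Sum>a<m. \<Sum>i\<in>I. f i $$ (a, a))"
    by (simp add: tr_def)
  also have "\<dots> = (\<Sum>i\<in>I. \<Sum>a<m. f i $$ (a, a))"
    by (rule sum.swap)
  also have "\<dots> = (\<Sum>i\<in>I. tr (f i))"
    using assms by (intro sum.cong) (auto simp: tr_def)
  finally show ?thesis .
qed

lemma tr_herm_mult:
  assumes "A \<in> carrier_mat m n" "B \<in> carrier_mat m n"
  shows "tr (A\<^sup>H * B) = (\<Sum>a<m. \<Sum>b<n. cnj (A $$ (a, b)) * B $$ (a, b))"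
  using assms by (subst sum.swap) (simp add: tr_def scalar_prod_def lessThan_atLeast0)

lemma mat_ip_entries:
  assumes "A \<in> carrier_mat m n" "B \<in> carrier_mat m n"
  shows "mat_ip A B = (\<Sum>a<m. \<Sum>b<n. Re (cnj (B $$ (a, b)) * A $$ (a, b)))"
  using assms by (simp add: mat_ip_def tr_herm_mult)

section \<open>Inverses, and determinants of positive matrices\<close>

lemma minv_eq:
  assumes A: "A \<in> carrier_mat n n" and det: "det A \<noteq> 0"
  shows "minv A \<in> carrier_mat n n" "A * minv A = 1\<^sub>m n" "minv A * A = 1\<^sub>m n"
proof -
  have "A \<in> Units (ring_mat TYPE(complex) n ())"
    by (rule det_non_zero_imp_unit[OF A det])
  with mat_inverse(1)[OF A, of "()"] obtain B where "mat_inverse A = Some B"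
    by (cases "mat_inverse A") auto
  with mat_inverse(2)[OF A this]
  show "minv A \<in> carrier_mat n n" "A * minv A = 1\<^sub>m n" "minv A * A = 1\<^sub>m n"
    by (simp_all add: minv_def)
qed

lemma minv_unique:
  assumes A: "A \<in> carrier_mat n n" and B: "B \<in> carrier_mat n n" and AB: "A * B = 1\<^sub>m n"
  shows "minv A = B"
proof -
  have "det A * det B = 1"
    using det_mult[OF A B] AB by simp
  then have "det A \<noteq> 0"
    by auto
  note inv = minv_eq[OF A this]
  have "minv A = minv A * (A * B)"
    using inv AB by simp
  also have "\<dots> = (minv A * A) * B"
    by (rule assoc_mult_mat[symmetric, OF inv(1) A B])
  also have "\<dots> = B"
    using inv B by simp
  finally show ?thesis .
qed

text \<open>Each eigenvalue is the quotient of the positive numbers \<open>(A v, v)\<close> and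
  \<open>(v, v)\<close> at an eigenvector \<open>v\<close>. By the Schur form the determinant is the
  product of the eigenvalues.\<close>

lemma det_positive:
  fixes A :: "complex mat"
  assumes A: "A \<in> carrier_mat n n"
    and pos: "\<And>v. v \<in> carrier_vec n \<Longrightarrow> v \<noteq> 0\<^sub>v n \<Longrightarrow> \<exists>q>0. (A *\<^sub>v v) \<bullet>c v = complex_of_real q"
  shows "\<exists>d>0. det A = complex_of_real d"
proof -
  obtain es where es: "char_poly A = (\<Prod>e\<leftarrow>es. [:- e, 1:])"
    using char_poly_factorized[OF A] by blast
  obtain B where B: "B \<in> carrier_mat n n" "upper_triangular B" "similar_mat A B"
    using schur_decomposition_exists[OF A es] by blast
  have "\<exists>d>0. e = complex_of_real d" if "e \<in> set (diag_mat B)" for e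
  proof -
    \<comment> \<open>Similar matrices share the characteristic polynomial, and for the triangular
      \<open>B\<close> its roots are the diagonal entries.\<close>
    have "poly (char_poly A) e = 0"
      using that by (simp add: char_poly_similar[OF B(3)] char_poly_upper_triangular[OF B(1,2)]
          poly_prod_list prod_list_zero_iff image_iff)
    then obtain v where v: "v \<in> carrier_vec n" "v \<noteq> 0\<^sub>v n" "A *\<^sub>v v = e \<cdot>\<^sub>v v"
      using eigenvalue_root_char_poly[OF A] A unfolding eigenvalue_def eigenvector_def by auto
    obtain q where q: "q > 0" "(A *\<^sub>v v) \<bullet>c v = complex_of_real q"
      using pos v by blast
    have "v \<bullet>c v > 0"
      using v by (simp add: conjugate_square_greater_0_vec)
    then obtain p where p: "p > 0" "v \<bullet>c v = complex_of_real p"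
      by (intro that[of "Re (v \<bullet>c v)"]) (auto simp: less_complex_def complex_eq_iff)
    have "e * complex_of_real p = complex_of_real q"
      using q(2) v p(2) by simp
    then have "e = complex_of_real (q / p)"
      using p by (simp add: field_simps)
    with p q show ?thesis
      by (intro exI[of _ "q / p"]) simp
  qed
  moreover have "\<exists>d>0. prod_list xs = complex_of_real d"
    if "\<And>e. e \<in> set xs \<Longrightarrow> \<exists>d>0. e = complex_of_real d" for xs
    using that
  proof (induction xs)
    case Nil
    show ?case by (intro exI[of _ 1]) simp
  next
    case (Cons x xs)
    then obtain d d' where "d > 0" "x = complex_of_real d" "d' > 0" "prod_list xs = complex_of_real d'"
      by (metis list.set_intros)
    then show ?case
      by (intro exI[of _ "d * d'"]) simp
  qed
  ultimately have "\<exists>d>0. prod_list (diag_mat B) = complex_of_real d"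
    by blast
  then show ?thesis
    by (simp add: det_similar[OF B(3)] det_upper_triangular[OF B(2,1)])
qed

text \<open>Both determinants in the rate of a user are of this form: the users in \<open>J\<close> transmit, \<open>B j\<close> is
  the received precoder of user \<open>j\<close> and \<open>s\<close> the noise variance.\<close>

definition covariance :: "nat \<Rightarrow> real \<Rightarrow> (nat \<Rightarrow> complex mat) \<Rightarrow> nat set \<Rightarrow> complex mat"
  where "covariance m s B J = msum m m (\<lambda>j. B j * (B j)\<^sup>H) J + s *\<^sub>r 1\<^sub>m m"

lemma covariance_carrier [simp]: "covariance m s B J \<in> carrier_mat m m"
  by (simp add: covariance_def)

lemma covariance_dim [simp]: "dim_row (covariance m s B J) = m" "dim_col (covariance m s B J) = m"
  by (simp_all add: covariance_def)

lemma covariance_index: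
  assumes "\<And>j. j \<in> J \<Longrightarrow> B j \<in> carrier_mat m (d j)" "a < m" "b < m"
  shows "covariance m s B J $$ (a, b) =
    (\<Sum>j\<in>J. \<Sum>c<d j. B j $$ (a, c) * cnj (B j $$ (b, c))) + (if a = b then complex_of_real s else 0)"
proof -
  have "(B j * (B j)\<^sup>H) $$ (a, b) = (\<Sum>c<d j. B j $$ (a, c) * cnj (B j $$ (b, c)))" if "j \<in> J" for j
    using assms(1)[OF that] assms(2,3) by (simp add: scalar_prod_def lessThan_atLeast0)
  then show ?thesis
    using assms(2,3) by (simp add: covariance_def)
qed

lemma covariance_herm:
  assumes "\<And>j. j \<in> J \<Longrightarrow> B j \<in> carrier_mat m (d j)"
  shows "(covariance m s B J)\<^sup>H = covariance m s B J"
proof (rule eq_matI)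
  fix a b assume "a < dim_row (covariance m s B J)" "b < dim_col (covariance m s B J)"
  then show "(covariance m s B J)\<^sup>H $$ (a, b) = covariance m s B J $$ (a, b)"
    by (simp add: covariance_index[where d = d] assms mult.commute)
qed simp_all

text \<open>The quadratic form of the covariance at \<open>v\<close> is the sum of the squared norms
  of \<open>B_j^H v\<close> plus \<open>s\<close> times the squared norm of \<open>v\<close>. The
  noise term makes it strictly positive for nonzero \<open>v\<close>.\<close>

lemma covariance_det:
  assumes B: "\<And>j. j \<in> J \<Longrightarrow> B j \<in> carrier_mat m (d j)" and s: "s > 0"
  shows "\<exists>t>0. det (covariance m s B J) = complex_of_real t"
proof (rule det_positive)
  fix v :: "complex vec" assume v: "v \<in> carrier_vec m" "v \<noteq> 0\<^sub>v m"
  let ?Y = "covariance m s B J"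
  let ?n = "\<Sum>a<m. (cmod (v $ a))\<^sup>2" and ?g = "\<Sum>j\<in>J. \<Sum>c<d j. (cmod (\<Sum>b<m. cnj (B j $$ (b, c)) * v $ b))\<^sup>2"
  have "(?Y *\<^sub>v v) \<bullet>c v = (\<Sum>a<m. \<Sum>b<m. ?Y $$ (a, b) * v $ b * cnj (v $ a))"
    using v by (simp add: scalar_prod_def lessThan_atLeast0 sum_distrib_right)
  also have "\<dots> = (\<Sum>a<m. \<Sum>b<m. (\<Sum>j\<in>J. \<Sum>c<d j. B j $$ (a, c) * cnj (B j $$ (b, c)) * v $ b * cnj (v $ a))
     + (if a = b then complex_of_real s * v $ b * cnj (v $ a) else 0))"
    by (intro sum.cong refl)
       (auto simp: covariance_index[where d = d] B algebra_simps sum_distrib_left sum_distrib_right)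
  also have "\<dots> = (\<Sum>a<m. \<Sum>b<m. \<Sum>j\<in>J. \<Sum>c<d j. B j $$ (a, c) * cnj (B j $$ (b, c)) * v $ b * cnj (v $ a))
     + (\<Sum>a<m. complex_of_real s * v $ a * cnj (v $ a))"
    by (simp add: sum.distrib)
  also have "(\<Sum>a<m. complex_of_real s * v $ a * cnj (v $ a)) = complex_of_real (s * ?n)"
    by (simp add: sum_distrib_left mult.assoc flip: complex_norm_square)
  also have "(\<Sum>a<m. \<Sum>b<m. \<Sum>j\<in>J. \<Sum>c<d j. B j $$ (a, c) * cnj (B j $$ (b, c)) * v $ b * cnj (v $ a)) =
    (\<Sum>j\<in>J. \<Sum>c<d j. \<Sum>a<m. \<Sum>b<m. B j $$ (a, c) * cnj (B j $$ (b, c)) * v $ b * cnj (v $ a))"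
  proof -
    have "(\<Sum>b<m. \<Sum>j\<in>J. \<Sum>c<d j. f a b j c) = (\<Sum>j\<in>J. \<Sum>c<d j. \<Sum>b<m. f a b j c)"
      for f :: "nat \<Rightarrow> nat \<Rightarrow> nat \<Rightarrow> nat \<Rightarrow> complex" and a
      by (subst sum.swap) (intro sum.cong refl sum.swap)
    then have "(\<Sum>a<m. \<Sum>b<m. \<Sum>j\<in>J. \<Sum>c<d j. f a b j c) = (\<Sum>a<m. \<Sum>j\<in>J. \<Sum>c<d j. \<Sum>b<m. f a b j c)"
      for f :: "nat \<Rightarrow> nat \<Rightarrow> nat \<Rightarrow> nat \<Rightarrow> complex"
      by simp
    also have "\<dots> f = (\<Sum>j\<in>J. \<Sum>c<d j. \<Sum>a<m. \<Sum>b<m. f a b j c)"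
      for f :: "nat \<Rightarrow> nat \<Rightarrow> nat \<Rightarrow> nat \<Rightarrow> complex"
      by (subst sum.swap) (intro sum.cong refl sum.swap)
    finally show ?thesis .
  qed
  also have "\<dots> = complex_of_real ?g"
  proof -
    have "(\<Sum>a<m. \<Sum>b<m. B j $$ (a, c) * cnj (B j $$ (b, c)) * v $ b * cnj (v $ a)) =
      complex_of_real ((cmod (\<Sum>b<m. cnj (B j $$ (b, c)) * v $ b))\<^sup>2)" for j c
    proof -
      have "complex_of_real ((cmod (\<Sum>b<m. cnj (B j $$ (b, c)) * v $ b))\<^sup>2) =
        (\<Sum>a<m. B j $$ (a, c) * cnj (v $ a)) * (\<Sum>b<m. cnj (B j $$ (b, c)) * v $ b)"
        by (simp add: complex_norm_square mult.commute del: of_real_power)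
      also have "\<dots> = (\<Sum>a<m. \<Sum>b<m. B j $$ (a, c) * cnj (B j $$ (b, c)) * v $ b * cnj (v $ a))"
        unfolding sum_product by (simp add: mult_ac)
      finally show ?thesis by simp
    qed
    then show ?thesis
      by simp
  qed
  finally have "(?Y *\<^sub>v v) \<bullet>c v = complex_of_real (?g + s * ?n)"
    by simp
  moreover have "?g + s * ?n > 0"
  proof -
    obtain a where "a < m" "v $ a \<noteq> 0"
      using v by (metis carrier_vecD eq_vecI index_zero_vec)
    then have "?n > 0"
      by (intro sum_pos2[of _ a]) auto
    then show ?thesis
      using s by (intro add_nonneg_pos sum_nonneg) auto
  qed
  ultimately show "\<exists>q>0. (?Y *\<^sub>v v) \<bullet>c v = complex_of_real q"
    by blast
qed simp

text \<open>A positive determinant gives invertibility. The adjoint of the inverse also inverts the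
  Hermitian matrix \<open>Y\<close>, so it equals the inverse.\<close>

lemma covariance_minv:
  assumes "\<And>j. j \<in> J \<Longrightarrow> B j \<in> carrier_mat m (d j)" "s > 0"
  defines "Y \<equiv> covariance m s B J"
  shows "minv Y \<in> carrier_mat m m" "dim_row (minv Y) = m" "dim_col (minv Y) = m"
    "Y * minv Y = 1\<^sub>m m" "minv Y * Y = 1\<^sub>m m" "(minv Y)\<^sup>H = minv Y"
proof -
  have Y: "Y \<in> carrier_mat m m"
    by (simp add: Y_def)
  have det: "det Y \<noteq> 0"
    using covariance_det[of J B m d s] assms(1,2) by (auto simp: Y_def)
  note * = minv_eq[OF Y det]
  show "minv Y \<in> carrier_mat m m" "Y * minv Y = 1\<^sub>m m" "minv Y * Y = 1\<^sub>m m"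
    by (fact *)+
  then show dim: "dim_row (minv Y) = m" "dim_col (minv Y) = m"
    by auto
  have "Y\<^sup>H = Y"
    unfolding Y_def using assms(1) by (rule covariance_herm)
  then have "Y * (minv Y)\<^sup>H = (minv Y * Y)\<^sup>H"
    using Y dim by (simp add: herm_mult)
  then have "Y * (minv Y)\<^sup>H = 1\<^sub>m m"
    using * by simp
  then show "(minv Y)\<^sup>H = minv Y"
    using minv_unique[OF Y, of "(minv Y)\<^sup>H"] * by simp
qed

text \<open>The inverse is explicit: \<open>C = 1 - B\<^sup>H M B\<close>.\<close>

lemma woodbury:
  fixes R Y B :: "complex mat"
  assumes R: "R \<in> carrier_mat m m" "N \<in> carrier_mat m m" "N * R = 1\<^sub>m m"
    and Y: "Y \<in> carrier_mat m m" "M \<in> carrier_mat m m" "Y * M = 1\<^sub>m m" "M * Y = 1\<^sub>m m"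
    and RN: "R * N = 1\<^sub>m m"
    and B: "B \<in> carrier_mat m n" and sum: "Y = R + B * B\<^sup>H"
  defines "C \<equiv> minv (1\<^sub>m n + B\<^sup>H * N * B)"
  shows "C \<in> carrier_mat n n" "N * B * C = M * B" "N * B * C * B\<^sup>H * N = N - M"
proof -
  have dims [simp]: "dim_row R = m" "dim_col R = m" "dim_row N = m" "dim_col N = m" "dim_row Y = m"
    "dim_col Y = m" "dim_row M = m" "dim_col M = m" "dim_row B = m" "dim_col B = n"
    using R Y B by auto
  have BB: "B * B\<^sup>H = Y - R"
    unfolding sum by (rule eq_matI) auto
  \<comment> \<open>The resolvent identity \<open>N (Y - R) M = N - M\<close>, valid because
    \<open>N\<close> inverts \<open>R\<close> and \<open>M\<close> inverts \<open>Y\<close>.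
    \<open>MN\<close> is the same identity with the outer factors exchanged.\<close>
  have NM: "N * (B * (B\<^sup>H * M)) = N - M"
  proof -
    have "N * (B * (B\<^sup>H * M)) = N * ((B * B\<^sup>H) * M)"
      by (simp add: mult_mat_assoc)
    also have "\<dots> = N * (Y * M) - (N * R) * M"
      unfolding BB by (simp add: mat_distrib mult_mat_assoc del: assoc_mult_mat)
    also have "\<dots> = N - M"
      using R Y by simp
    finally show ?thesis .
  qed
  have MN: "M * (B * (B\<^sup>H * N)) = N - M"
  proof -
    have "M * (B * (B\<^sup>H * N)) = M * ((B * B\<^sup>H) * N)"
      by (simp add: mult_mat_assoc)
    also have "\<dots> = (M * Y) * N - M * (R * N)"
      unfolding BB by (simp add: mat_distrib mult_mat_assoc)
    also have "\<dots> = N - M"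
      using R Y RN by simp
    finally show ?thesis .
  qed
  let ?C = "1\<^sub>m n - B\<^sup>H * M * B"
  \<comment> \<open>This collapses the longest product both in the check that \<open>?C\<close> is
    the inverse and in the computation of \<open>N * B * C\<close>.\<close>
  have NMB: "N * (B * (B\<^sup>H * (M * B))) = N * B - M * B"
    using arg_cong[OF NM, of "\<lambda>X. X * B"] by (simp add: mult_mat_assoc mat_distrib)
  have "(1\<^sub>m n + B\<^sup>H * N * B) * ?C = 1\<^sub>m n"
  proof -
    have "(1\<^sub>m n + B\<^sup>H * N * B) * ?C =
        1\<^sub>m n + B\<^sup>H * (N * B) - (B\<^sup>H * (M * B) + B\<^sup>H * (N * (B * (B\<^sup>H * (M * B)))))"
      by (simp add: mat_distrib mult_mat_assoc)
    also have "\<dots> = 1\<^sub>m n"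
      unfolding NMB by (simp add: mat_distrib) (rule eq_matI; simp)
    finally show ?thesis .
  qed
  then have C: "C = ?C"
    unfolding C_def by (intro minv_unique[of _ n] carrier_matI) simp_all
  then show "C \<in> carrier_mat n n"
    by (intro carrier_matI) simp_all
  have "N * B * C = N * B - N * (B * (B\<^sup>H * (M * B)))"
    unfolding C by (simp add: mat_distrib mult_mat_assoc)
  also have "\<dots> = M * B"
    unfolding NMB by (rule eq_matI) auto
  finally show NBC: "N * B * C = M * B" .
  show "N * B * C * B\<^sup>H * N = N - M"
    unfolding NBC using MN by (simp add: mult_mat_assoc)
qed

context infinitesimal
begin

text \<open>The first-order change of \<open>Y\<close> is the sum of
  \<open>B_j Z_j^H + Z_j B_j^H\<close>. As \<open>Y^-1\<close> is Hermitian, its traces against the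
  two terms are conjugate, and the real part doubles one of them. The increments are given both as
  entries \<open>z\<close>, for the estimates, and as matrices \<open>Z\<close>, for the inner
  product.\<close>

lemma expands_ln_det_covariance:
  assumes B: "\<And>j. j \<in> J \<Longrightarrow> B j \<in> carrier_mat m (d j)" and s: "s > 0"
    and z: "\<And>j a c. j \<in> J \<Longrightarrow> a < m \<Longrightarrow> c < d j \<Longrightarrow> (\<lambda>x. z x j (a, c)) \<in> O[F](r)"
  defines "Z \<equiv> \<lambda>x j. mat m (d j) (z x j)"
  defines "Y \<equiv> covariance m s B J"
  shows "expands (\<lambda>x. complex_of_real (ln (Re (det (covariance m s (\<lambda>j. B j + Z x j) J)))))
    (complex_of_real (ln (Re (det Y))))
    (\<lambda>x. complex_of_real (\<Sum>j\<in>J. 2 * mat_ip (minv Y * B j) (Z x j)))"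
proof -
  let ?\<delta> = "\<lambda>a b :: nat. if a = b then complex_of_real s else 0"
  define k where "k x = (\<lambda>(a, b). (\<Sum>j\<in>J. \<Sum>c<d j. (B j $$ (a, c) + z x j (a, c)) *
    cnj (B j $$ (b, c) + z x j (b, c))) + ?\<delta> a b)" for x
  define k0 where "k0 = (\<lambda>(a, b). (\<Sum>j\<in>J. \<Sum>c<d j. B j $$ (a, c) * cnj (B j $$ (b, c))) + ?\<delta> a b)"
  \<comment> \<open>The product rule applied to the entry \<open>(a, b)\<close> of
    \<open>(B_j + Z_j) (B_j + Z_j)^H\<close>.\<close>
  define l where "l x = (\<lambda>(a, b). \<Sum>j\<in>J. \<Sum>c<d j. B j $$ (a, c) * cnj (z x j (b, c)) +
    cnj (B j $$ (b, c)) * z x j (a, c))" for x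
  note N = covariance_minv[of J B m d s, OF B s, folded Y_def]
  have BZ: "B j + Z x j \<in> carrier_mat m (d j)" if "j \<in> J" for x j
    using B[OF that] by (simp add: Z_def)
  have cov: "covariance m s (\<lambda>j. B j + Z x j) J = mat m m (k x)" for x
  proof (rule eq_matI)
    fix a b assume ab: "a < dim_row (mat m m (k x))" "b < dim_col (mat m m (k x))"
    have "(\<Sum>j\<in>J. \<Sum>c<d j. (B j + Z x j) $$ (a, c) * cnj ((B j + Z x j) $$ (b, c))) =
      (\<Sum>j\<in>J. \<Sum>c<d j. (B j $$ (a, c) + z x j (a, c)) * cnj (B j $$ (b, c) + z x j (b, c)))"
      using ab by (intro sum.cong refl) (simp add: Z_def)
    then show "covariance m s (\<lambda>j. B j + Z x j) J $$ (a, b) = mat m m (k x) $$ (a, b)"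
      using ab by (subst covariance_index[where d = d]) (auto simp: BZ k_def)
  qed simp_all
  have cov0: "Y = mat m m k0"
    by (rule eq_matI) (auto simp: Y_def k0_def covariance_index[where d = d] B)
  have "expands (\<lambda>x. k x (a, b)) (k0 (a, b)) (\<lambda>x. l x (a, b))" if ab: "a < m" "b < m" for a b
  proof -
    have 1: "expands (\<lambda>x. B j $$ (e, c) + z x j (e, c)) (B j $$ (e, c) + 0) (\<lambda>x. 0 + z x j (e, c))"
      if "j \<in> J" "e < m" "c < d j" for j c e
      using that by (intro expands_add expands_const expands_linear z)
    have "expands (\<lambda>x. (\<Sum>j\<in>J. \<Sum>c<d j. (B j $$ (a, c) + z x j (a, c)) *
          cnj (B j $$ (b, c) + z x j (b, c))) + ?\<delta> a b)
        ((\<Sum>j\<in>J. \<Sum>c<d j. (B j $$ (a, c) + 0) * cnj (B j $$ (b, c) + 0)) + ?\<delta> a b)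
        (\<lambda>x. (\<Sum>j\<in>J. \<Sum>c<d j. (B j $$ (a, c) + 0) * cnj (0 + z x j (b, c)) +
           cnj (B j $$ (b, c) + 0) * (0 + z x j (a, c))) + 0)"
      using ab by (intro expands_add[OF _ expands_const] expands_sum expands_mult expands_cnj 1) auto
    then show ?thesis
      by (simp add: k_def k0_def l_def)
  qed
  then have "expands (\<lambda>x. det (mat m m (k x))) (det (mat m m k0))
      (\<lambda>x. det (mat m m k0) * tr (minv Y * mat m m (l x)))"
    using N by (intro expands_det) (auto simp: cov0)
  moreover obtain t where t: "t > 0" "det Y = complex_of_real t"
    using covariance_det[of J B m d s] B s by (auto simp: Y_def)
  ultimately have "expands (\<lambda>x. complex_of_real (ln (Re (det (covariance m s (\<lambda>j. B j + Z x j) J)))))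
    (complex_of_real (ln t)) (\<lambda>x. complex_of_real (Re (tr (minv Y * mat m m (l x)))))"
    unfolding cov cov0[symmetric] by (intro expands_ln_Re) auto
  moreover have "Re (tr (minv Y * mat m m (l x))) = (\<Sum>j\<in>J. 2 * mat_ip (minv Y * B j) (Z x j))" for x
  proof -
    have Z: "Z x j \<in> carrier_mat m (d j)" for j
      by (simp add: Z_def)
    have L: "mat m m (l x) = msum m m (\<lambda>j. B j * (Z x j)\<^sup>H + Z x j * (B j)\<^sup>H) J"
    proof (rule eq_matI)
      fix a b assume "a < dim_row (msum m m (\<lambda>j. B j * (Z x j)\<^sup>H + Z x j * (B j)\<^sup>H) J)"
        "b < dim_col (msum m m (\<lambda>j. B j * (Z x j)\<^sup>H + Z x j * (B j)\<^sup>H) J)"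
      then have ab: "a < m" "b < m" by simp_all
      have "(B j * (Z x j)\<^sup>H + Z x j * (B j)\<^sup>H) $$ (a, b) =
        (\<Sum>c<d j. B j $$ (a, c) * cnj (z x j (b, c)) + cnj (B j $$ (b, c)) * z x j (a, c))"
        if "j \<in> J" for j
        using B[OF that] ab
        by (simp add: Z_def scalar_prod_def lessThan_atLeast0 sum.distrib mult.commute)
      then show "mat m m (l x) $$ (a, b) = msum m m (\<lambda>j. B j * (Z x j)\<^sup>H + Z x j * (B j)\<^sup>H) J $$ (a, b)"
        using ab by (simp add: l_def)
    qed simp_all
    have C: "B j * (Z x j)\<^sup>H + Z x j * (B j)\<^sup>H \<in> carrier_mat m m" if "j \<in> J" for j
      using B[OF that] Z[of j] by (intro carrier_matI) auto
    have "tr (minv Y * mat m m (l x)) =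
      (\<Sum>j\<in>J. tr (minv Y * (B j * (Z x j)\<^sup>H + Z x j * (B j)\<^sup>H)))"
    proof -
      have "minv Y * mat m m (l x) = msum m m (\<lambda>j. minv Y * (B j * (Z x j)\<^sup>H + Z x j * (B j)\<^sup>H)) J"
        unfolding L using N(2,3) C by (intro mult_msum) auto
      then show ?thesis
        by (simp only:) (intro tr_msum mult_carrier_mat[OF N(1)] C)
    qed
    also have "Re \<dots> = (\<Sum>j\<in>J. 2 * mat_ip (minv Y * B j) (Z x j))"
      unfolding Re_sum
    proof (rule sum.cong)
      fix j assume "j \<in> J"
      note Bj = B[OF this]
      then have [simp]: "dim_row (B j) = m" "dim_col (B j) = d j" "dim_row (Z x j) = m" "dim_col (Z x j) = d j"
        using Z by auto
      have ZH: "(Z x j)\<^sup>H \<in> carrier_mat (d j) m" and BH: "(B j)\<^sup>H \<in> carrier_mat (d j) m"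
        and NB: "minv Y * B j \<in> carrier_mat m (d j)" and NZ: "minv Y * Z x j \<in> carrier_mat m (d j)"
        and BN: "(B j)\<^sup>H * minv Y \<in> carrier_mat (d j) m"
        using N(2,3) by (intro carrier_matI; simp)+
      have "tr (minv Y * (B j * (Z x j)\<^sup>H + Z x j * (B j)\<^sup>H)) =
          tr ((minv Y * B j) * (Z x j)\<^sup>H) + tr ((minv Y * Z x j) * (B j)\<^sup>H)"
        using N(2,3) by (simp add: mat_distrib tr_add mult_mat_assoc)
      also have "tr ((minv Y * B j) * (Z x j)\<^sup>H) = tr ((Z x j)\<^sup>H * (minv Y * B j))"
        by (rule tr_comm[OF NB ZH])
      \<comment> \<open>Adjoint and cyclic invariance of the trace; this is where
        \<open>minv Y\<close> being Hermitian enters.\<close>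
      also have "tr ((minv Y * Z x j) * (B j)\<^sup>H) = cnj (tr ((minv Y * B j) * (Z x j)\<^sup>H))"
      proof -
        have "((minv Y * B j) * (Z x j)\<^sup>H)\<^sup>H = Z x j * ((B j)\<^sup>H * minv Y)"
          using N(2,3,6) by (simp add: herm_mult)
        moreover have "tr (Z x j * ((B j)\<^sup>H * minv Y)) = tr (((B j)\<^sup>H * minv Y) * Z x j)"
          by (rule tr_comm[OF Z BN])
        moreover have "((B j)\<^sup>H * minv Y) * Z x j = (B j)\<^sup>H * (minv Y * Z x j)"
          using N(2,3) by (simp add: mult_mat_assoc)
        moreover have "tr ((B j)\<^sup>H * (minv Y * Z x j)) = tr ((minv Y * Z x j) * (B j)\<^sup>H)"
          by (rule tr_comm[OF BH NZ])
        ultimately show ?thesis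
          using tr_herm[of "(minv Y * B j) * (Z x j)\<^sup>H"] N(2,3) by simp
      qed
      also have "tr ((minv Y * B j) * (Z x j)\<^sup>H) = tr ((Z x j)\<^sup>H * (minv Y * B j))"
        by (rule tr_comm[OF NB ZH])
      finally show "Re (tr (minv Y * (B j * (Z x j)\<^sup>H + Z x j * (B j)\<^sup>H))) = 2 * mat_ip (minv Y * B j) (Z x j)"
        by (simp add: mat_ip_def)
    qed simp
    finally show ?thesis .
  qed
  ultimately show ?thesis
    using t by simp
qed

end

section \<open>Gradients and their restrictions to blocks\<close>

lemma mat_ip_self:
  assumes "A \<in> carrier_mat m n"
  shows "mat_ip A A = (\<Sum>a<m. \<Sum>b<n. (cmod (A $$ (a, b)))\<^sup>2)"
  unfolding mat_ip_entries[OF assms assms] cmod_power2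
  by (intro sum.cong refl) (simp add: power2_eq_square)

lemma mat_ip_nonneg: "0 \<le> mat_ip A A"
  by (subst mat_ip_self[of A "dim_row A" "dim_col A"]) (auto intro!: sum_nonneg)

lemma mat_ip_self_zero:
  assumes "A \<in> carrier_mat m n" "mat_ip A A = 0"
  shows "A = 0\<^sub>m m n"
proof (rule eq_matI)
  fix a b assume "a < dim_row (0\<^sub>m m n :: complex mat)" "b < dim_col (0\<^sub>m m n :: complex mat)"
  then have ab: "a < m" "b < n" by auto
  have "(\<Sum>a<m. \<Sum>b<n. (cmod (A $$ (a, b)))\<^sup>2) = 0"
    using assms(2) unfolding mat_ip_self[OF assms(1)] .
  then have "(cmod (A $$ (a, b)))\<^sup>2 = 0"
    using ab by (simp add: sum_nonneg_eq_0_iff sum_nonneg)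
  then show "A $$ (a, b) = 0\<^sub>m m n $$ (a, b)"
    using ab by simp
qed (use assms in auto)

lemma mat_ip_diff:
  assumes "A \<in> carrier_mat m n" "B \<in> carrier_mat m n" "C \<in> carrier_mat m n"
  shows "mat_ip (A - B) C = mat_ip A C - mat_ip B C"
proof -
  have "A - B \<in> carrier_mat m n"
    using assms by auto
  with assms show ?thesis
    by (simp add: mat_ip_entries[of _ m n] sum_subtractf algebra_simps)
qed

lemma mat_ip_scale:
  assumes "A \<in> carrier_mat m n" "B \<in> carrier_mat m n"
  shows "mat_ip (c *\<^sub>r A) B = c * mat_ip A B" "mat_ip A (c *\<^sub>r B) = c * mat_ip A B"
proof -
  have "c *\<^sub>r A \<in> carrier_mat m n" "c *\<^sub>r B \<in> carrier_mat m n"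
    using assms by auto
  with assms show "mat_ip (c *\<^sub>r A) B = c * mat_ip A B" "mat_ip A (c *\<^sub>r B) = c * mat_ip A B"
    by (simp_all add: mat_ip_entries[of _ m n] sum_distrib_left algebra_simps)
qed

lemma mat_ip_msum:
  assumes "\<And>i. i \<in> I \<Longrightarrow> f i \<in> carrier_mat m n" "B \<in> carrier_mat m n"
  shows "mat_ip (msum m n f I) B = (\<Sum>i\<in>I. mat_ip (f i) B)"
proof -
  have "mat_ip (msum m n f I) B = (\<Sum>a<m. \<Sum>b<n. \<Sum>i\<in>I. Re (cnj (B $$ (a, b)) * f i $$ (a, b)))"
    unfolding mat_ip_entries[OF msum_carrier assms(2)]
    by (intro sum.cong refl) (simp only: msum_index lessThan_iff sum_distrib_left Re_sum)
  also have "\<dots> = (\<Sum>a<m. \<Sum>i\<in>I. \<Sum>b<n. Re (cnj (B $$ (a, b)) * f i $$ (a, b)))"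
    by (intro sum.cong refl sum.swap)
  also have "\<dots> = (\<Sum>i\<in>I. \<Sum>a<m. \<Sum>b<n. Re (cnj (B $$ (a, b)) * f i $$ (a, b)))"
    by (rule sum.swap)
  also have "\<dots> = (\<Sum>i\<in>I. mat_ip (f i) B)"
    by (intro sum.cong refl) (simp add: mat_ip_entries[of _ m n] assms)
  finally show ?thesis .
qed

text \<open>Adjointness of left multiplication: it moves the channel from the increment to the
  coefficient and so produces the factor \<open>K^H\<close> of the gradient.\<close>

lemma mat_ip_mult:
  assumes "A \<in> carrier_mat m p" "K \<in> carrier_mat m n" "X \<in> carrier_mat n p"
  shows "mat_ip A (K * X) = mat_ip (K\<^sup>H * A) X"
proof -
  have "dim_row A = m" "dim_row K = m" "dim_col K = n" "dim_row X = n"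
    using assms by auto
  then show ?thesis
    by (simp add: mat_ip_def herm_mult mult_mat_assoc)
qed

lemma mat_diff_zero:
  assumes "A \<in> carrier_mat m n" "B \<in> carrier_mat m n" "A - B = 0\<^sub>m m n"
  shows "A = (B :: complex mat)"
proof (rule eq_matI)
  fix a b assume "a < dim_row B" "b < dim_col B"
  then show "A $$ (a, b) = B $$ (a, b)"
    using arg_cong[OF assms(3), of "\<lambda>X. X $$ (a, b)"] assms(1,2) by auto
qed (use assms in auto)

text \<open>Both candidates predict the change of \<open>f\<close> along a short multiple of their
  difference \<open>E\<close>. The predictions differ by \<open>t\<close> times the squared norm of
  \<open>E\<close>, more than the two error bounds allow.\<close>

lemma is_gradient_mat_unique:
  assumes G: "is_gradient (carrier_mat m n) (+) mat_ip f x G"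
    and G': "is_gradient (carrier_mat m n) (+) mat_ip f x G'"
  shows "G = G'"
proof (rule ccontr)
  assume neq: "G \<noteq> G'"
  have car: "G \<in> carrier_mat m n" "G' \<in> carrier_mat m n"
    using G G' by (auto simp: is_gradient_def)
  define E where "E = G - G'"
  have E: "E \<in> carrier_mat m n"
    using car by (auto simp: E_def)
  define e where "e = sqrt (mat_ip E E)"
  have "mat_ip E E \<noteq> 0"
    using mat_ip_self_zero[OF E] mat_diff_zero[OF car] neq by (auto simp: E_def)
  then have e: "e > 0"
    using mat_ip_nonneg[of E] by (simp add: e_def less_le)
  have ee: "mat_ip G E - mat_ip G' E = e\<^sup>2"
    using mat_ip_diff[OF car E] mat_ip_nonneg[of E] by (simp add: e_def flip: E_def)
  \<comment> \<open>With \<open>e / 4\<close> for each candidate the errors add up to half of the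
    discrepancy \<open>t * e^2\<close>.\<close>
  obtain \<delta> where d: "\<delta> > 0" "\<And>\<xi>. \<xi> \<in> carrier_mat m n \<Longrightarrow> sqrt (mat_ip \<xi> \<xi>) < \<delta> \<Longrightarrow>
      \<bar>f (x + \<xi>) - f x - mat_ip G \<xi>\<bar> \<le> e / 4 * sqrt (mat_ip \<xi> \<xi>)"
    using G e unfolding is_gradient_def by (metis divide_pos_pos zero_less_numeral)
  obtain \<delta>' where d': "\<delta>' > 0" "\<And>\<xi>. \<xi> \<in> carrier_mat m n \<Longrightarrow> sqrt (mat_ip \<xi> \<xi>) < \<delta>' \<Longrightarrow>
      \<bar>f (x + \<xi>) - f x - mat_ip G' \<xi>\<bar> \<le> e / 4 * sqrt (mat_ip \<xi> \<xi>)"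
    using G' e unfolding is_gradient_def by (metis divide_pos_pos zero_less_numeral)
  \<comment> \<open>The increment \<open>t *\<^sub>r E\<close> has norm \<open>t * e\<close>, which
    is half of the smaller radius.\<close>
  define t where "t = min \<delta> \<delta>' / (2 * e)"
  have t: "t > 0" "t * e < \<delta>" "t * e < \<delta>'"
    using d(1) d'(1) e by (auto simp: t_def field_simps min_def)
  have tE: "t *\<^sub>r E \<in> carrier_mat m n"
    using E by auto
  have nt: "sqrt (mat_ip (t *\<^sub>r E) (t *\<^sub>r E)) = t * e"
    using t(1) by (simp add: mat_ip_scale[OF E tE] mat_ip_scale[OF E E] real_sqrt_mult e_def)
  have "\<bar>f (x + t *\<^sub>r E) - f x - t * mat_ip G E\<bar> \<le> e / 4 * (t * e)"
    using d(2)[OF tE] t nt by (simp add: mat_ip_scale[OF car(1) E])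
  moreover have "\<bar>f (x + t *\<^sub>r E) - f x - t * mat_ip G' E\<bar> \<le> e / 4 * (t * e)"
    using d'(2)[OF tE] t nt by (simp add: mat_ip_scale[OF car(2) E])
  ultimately have "t * mat_ip G E - t * mat_ip G' E \<le> e / 2 * (t * e)"
    unfolding abs_le_iff by linarith
  then have "t * e\<^sup>2 \<le> t * e\<^sup>2 / 2"
    by (simp add: ee power2_eq_square mult_ac flip: right_diff_distrib)
  then show False
    using t(1) e by simp
qed

text \<open>An isometric embedding \<open>emb\<close> of increments pulls back the estimate with the
  same \<open>\<delta>\<close>. The vector \<open>G'\<close> represents the functional of
  \<open>G\<close> on the image of \<open>emb\<close>.\<close>

lemma is_gradient_restrict:
  assumes G: "is_gradient V pl g f x G" and G': "G' \<in> V'"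
    and "\<And>\<xi>. \<xi> \<in> V' \<Longrightarrow> emb \<xi> \<in> V"
    and "\<And>\<xi>. \<xi> \<in> V' \<Longrightarrow> g (emb \<xi>) (emb \<xi>) = g' \<xi> \<xi>"
    and "\<And>\<xi>. \<xi> \<in> V' \<Longrightarrow> g G (emb \<xi>) = g' G' \<xi>"
    and "\<And>\<xi>. \<xi> \<in> V' \<Longrightarrow> f' (pl' x' \<xi>) = f (pl x (emb \<xi>))" "f' x' = f x"
  shows "is_gradient V' pl' g' f' x' G'"
  unfolding is_gradient_def
proof (intro conjI allI impI G')
  fix \<epsilon> :: real assume "\<epsilon> > 0"
  then obtain \<delta> where "\<delta> > 0" and d: "\<And>\<xi>. \<xi> \<in> V \<Longrightarrow> sqrt (g \<xi> \<xi>) < \<delta> \<Longrightarrow>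
      \<bar>f (pl x \<xi>) - f x - g G \<xi>\<bar> \<le> \<epsilon> * sqrt (g \<xi> \<xi>)"
    using G unfolding is_gradient_def by blast
  have "\<bar>f' (pl' x' \<xi>) - f' x' - g' G' \<xi>\<bar> \<le> \<epsilon> * sqrt (g' \<xi> \<xi>)"
    if "\<xi> \<in> V'" "sqrt (g' \<xi> \<xi>) < \<delta>" for \<xi>
    using d[of "emb \<xi>"] that assms(3-7) by simp
  with \<open>\<delta> > 0\<close> show "\<exists>\<delta>>0. \<forall>\<xi>\<in>V'. sqrt (g' \<xi> \<xi>) < \<delta> \<longrightarrow>
      \<bar>f' (pl' x' \<xi>) - f' x' - g' G' \<xi>\<bar> \<le> \<epsilon> * sqrt (g' \<xi> \<xi>)"
    by blast
qed

section \<open>Passage from the whole space to single users and blocks\<close>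

lemma sum_div_mod: "(\<Sum>a<N * T. f a) = (\<Sum>m<N. \<Sum>a<T. f (m * T + a))" for f :: "nat \<Rightarrow> real"
proof -
  have "(\<Sum>a<T. f (m * T + a)) = sum f {m * T..<m * T + T}" for m
    by (simp add: sum.shift_bounds_nat_ivl[of _ 0 "m * T" T, simplified] add.commute lessThan_atLeast0)
  then show ?thesis
    by (simp add: sum.nat_group)
qed

lemma block_index_less: "m < N \<Longrightarrow> a < T \<Longrightarrow> m * T + a < N * (T :: nat)"
  using mult_le_mono1[of "Suc m" N T] by simp

lemma stack_block:
  assumes "X \<in> Ni S i"
  shows "stack S i (block S i X) = X"
proof (rule eq_matI)
  fix a b assume "a < dim_row X" "b < dim_col X"
  then have ab: "a < nserv S i * nTx S" "b < nStr S i"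
    using assms by (auto simp: Ni_def)
  then have "nTx S > 0" by (cases "nTx S") auto
  with ab show "stack S i (block S i X) $$ (a, b) = X $$ (a, b)"
    by (simp add: stack_def block_matrix_def block_def)
qed (use assms in \<open>auto simp: stack_def block_matrix_def Ni_def\<close>)

lemma stack_carrier [simp]: "stack S i X \<in> Ni S i"
  by (simp add: stack_def block_matrix_def Ni_def)

lemma block_carrier [simp]: "block S i X n \<in> Nik S i"
  by (simp add: block_def Nik_def)

lemma block_stack:
  assumes "\<And>n. n < nserv S i \<Longrightarrow> X n \<in> Nik S i" "n < nserv S i"
  shows "block S i (stack S i X) n = X n"
  using assms(1)[OF assms(2)] assms(2)
  by (intro eq_matI) (auto simp: block_def stack_def block_matrix_def Nik_def block_index_less)

lemma mat_ip_blocks: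
  assumes "X \<in> Ni S i" "Y \<in> Ni S i"
  shows "mat_ip X Y = (\<Sum>n<nserv S i. mat_ip (block S i X n) (block S i Y n))"
proof -
  have b: "block S i Z n \<in> carrier_mat (nTx S) (nStr S i)" for Z n
    by (simp add: block_def)
  have "mat_ip (block S i X n) (block S i Y n) = (\<Sum>a<nTx S. \<Sum>b<nStr S i.
      Re (cnj (Y $$ (n * nTx S + a, b)) * X $$ (n * nTx S + a, b)))" for n
    unfolding mat_ip_entries[OF b b] by (intro sum.cong refl) (simp add: block_def)
  then show ?thesis
    using assms unfolding Ni_def
    by (simp only: mat_ip_entries[of _ "nserv S i * nTx S" "nStr S i"] sum_div_mod)
qed

text \<open>Increments of one block embed as increments of the user that vanish in all other blocks.
  The inner product with such an increment sees only block \<open>n\<close> of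
  \<open>G\<close>.\<close>

lemma is_grad_Nik_block:
  assumes G: "is_grad_Ni S f P i G" and P: "P ! i \<in> Ni S i" and n: "n < nserv S i"
  shows "is_grad_Nik S f P i n (block S i G n)"
proof -
  define emb where "emb \<xi> = stack S i (\<lambda>m. if m = n then \<xi> else 0\<^sub>m (nTx S) (nStr S i))" for \<xi>
  have GN: "G \<in> Ni S i"
    using G by (simp add: is_grad_Ni_def is_gradient_def)
  have bemb: "block S i (emb \<xi>) m = (if m = n then \<xi> else 0\<^sub>m (nTx S) (nStr S i))"
    if "\<xi> \<in> Nik S i" "m < nserv S i" for \<xi> m
    unfolding emb_def using that by (intro block_stack) (auto simp: Nik_def)
  have z: "mat_ip A (0\<^sub>m (nTx S) (nStr S i)) = 0" if "A \<in> Nik S i" for A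
    using that by (simp add: Nik_def mat_ip_entries[of _ "nTx S" "nStr S i"])
  have ip: "mat_ip X (emb \<xi>) = mat_ip (block S i X n) \<xi>" if "\<xi> \<in> Nik S i" "X \<in> Ni S i" for X \<xi>
  proof -
    have "mat_ip X (emb \<xi>) = (\<Sum>m<nserv S i. mat_ip (block S i X m) (block S i (emb \<xi>) m))"
      using that by (intro mat_ip_blocks) (auto simp: emb_def)
    also have "\<dots> = (\<Sum>m<nserv S i. if m = n then mat_ip (block S i X n) \<xi> else 0)"
      using that by (intro sum.cong) (auto simp: bemb z)
    finally show ?thesis
      using n by simp
  qed
  show ?thesis
    unfolding is_grad_Nik_def
  proof (rule is_gradient_restrict[where emb = emb])
    show "is_gradient (Ni S i) (+) mat_ip (\<lambda>X. f (P[i := X])) (P ! i) G"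
      using G by (simp add: is_grad_Ni_def)
  next
    fix \<xi> assume xi: "\<xi> \<in> Nik S i"
    show "emb \<xi> \<in> Ni S i"
      by (simp add: emb_def)
    show "mat_ip (emb \<xi>) (emb \<xi>) = mat_ip \<xi> \<xi>"
      using xi n by (subst ip) (auto simp: bemb emb_def[symmetric], simp add: emb_def)
    show "mat_ip G (emb \<xi>) = mat_ip (block S i G n) \<xi>"
      using xi GN by (rule ip)
    have "stack S i ((block S i (P ! i))(n := block S i (P ! i) n + \<xi>)) = P ! i + emb \<xi>"
    proof (rule eq_matI)
      fix a b assume "a < dim_row (P ! i + emb \<xi>)" "b < dim_col (P ! i + emb \<xi>)"
      then have ab: "a < nserv S i * nTx S" "b < nStr S i"
        by (auto simp: emb_def stack_def block_matrix_def)
      then have "nTx S > 0" by (cases "nTx S") auto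
      with ab show "stack S i ((block S i (P ! i))(n := block S i (P ! i) n + \<xi>)) $$ (a, b) = (P ! i + emb \<xi>) $$ (a, b)"
        using xi by (auto simp: stack_def block_matrix_def block_def emb_def Nik_def)
    qed (auto simp: emb_def stack_def block_matrix_def)
    then show "f (P[i := stack S i ((block S i (P ! i))(n := block S i (P ! i) n + \<xi>))]) = f (P[i := P ! i + emb \<xi>])"
      by simp
  qed (simp_all add: stack_block P)
qed

text \<open>Origin of the space of precoders; an increment of a single user is embedded by
  overwriting one component.\<close>

definition zero_N :: "network \<Rightarrow> complex mat list"
  where "zero_N S = map (\<lambda>i. 0\<^sub>m (nserv S i * nTx S) (nStr S i)) [0..<nUE S]"

lemma is_grad_Ni_nth:
  assumes G: "is_grad_N S f P G" and P: "P \<in> Nn S" and i: "i < nUE S"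
  shows "is_grad_Ni S f P i (G ! i)"
proof -
  define emb where "emb \<xi> = (zero_N S)[i := \<xi>]" for \<xi>
  have GN: "G \<in> Nn S"
    using G by (simp add: is_grad_N_def is_gradient_def)
  have nth: "emb \<xi> ! j = (if j = i then \<xi> else 0\<^sub>m (nserv S j * nTx S) (nStr S j))" if "j < nUE S" for \<xi> j
    using that by (auto simp: emb_def zero_N_def)
  have emb: "emb \<xi> \<in> Nn S" if "\<xi> \<in> Ni S i" for \<xi>
    using that by (auto simp: Nn_def nth) (auto simp: emb_def zero_N_def Ni_def)
  have ip: "ipN S X (emb \<xi>) = mat_ip (X ! i) \<xi>" if "X \<in> Nn S" for X \<xi>
  proof -
    have "mat_ip (X ! j) (0\<^sub>m (nserv S j * nTx S) (nStr S j)) = 0" if "j < nUE S" for j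
      using that \<open>X \<in> Nn S\<close>
      by (auto simp: Nn_def Ni_def mat_ip_entries[of _ "nserv S j * nTx S" "nStr S j"])
    then have "ipN S X (emb \<xi>) = (\<Sum>j<nUE S. if j = i then mat_ip (X ! i) \<xi> else 0)"
      unfolding ipN_def by (intro sum.cong) (auto simp: nth)
    then show ?thesis
      using i by simp
  qed
  show ?thesis
    unfolding is_grad_Ni_def
  proof (rule is_gradient_restrict[where emb = emb])
    show "is_gradient (Nn S) (map2 (+)) (ipN S) f P G"
      using G by (simp add: is_grad_N_def)
    show "G ! i \<in> Ni S i"
      using GN i by (auto simp: Nn_def)
  next
    fix \<xi> assume xi: "\<xi> \<in> Ni S i"
    show "emb \<xi> \<in> Nn S"
      using xi by (rule emb)
    show "ipN S (emb \<xi>) (emb \<xi>) = mat_ip \<xi> \<xi>"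
      using emb[OF xi] i by (simp add: ip nth)
    show "ipN S G (emb \<xi>) = mat_ip (G ! i) \<xi>"
      using GN by (rule ip)
    have "P[i := P ! i + \<xi>] = map2 (+) P (emb \<xi>)"
    proof (rule nth_equalityI)
      show "length (P[i := P ! i + \<xi>]) = length (map2 (+) P (emb \<xi>))"
        using P by (simp add: Nn_def emb_def zero_N_def)
      fix j assume "j < length (P[i := P ! i + \<xi>])"
      then have j: "j < nUE S" "P ! j \<in> carrier_mat (nserv S j * nTx S) (nStr S j)"
        using P by (auto simp: Nn_def Ni_def)
      then show "P[i := P ! i + \<xi>] ! j = map2 (+) P (emb \<xi>) ! j"
      proof -
        have len: "length P = nUE S" "length (emb \<xi>) = nUE S"
          using P by (auto simp: Nn_def emb_def zero_N_def)
        have "P[i := P ! i + \<xi>] ! j = P ! j + emb \<xi> ! j"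
          using j len by (cases "j = i") (simp_all add: nth)
        then show ?thesis
          using j len by simp
      qed
    qed
    then show "f (P[i := P ! i + \<xi>]) = f (map2 (+) P (emb \<xi>))"
      by simp
  qed simp_all
qed

lemma ex1_the:
  assumes "Q x" "\<And>y. Q y \<Longrightarrow> y = x"
  shows "\<exists>!y. Q y" "(THE y. Q y) = x"
  using assms by blast+

text \<open>One gradient \<open>G\<close> on the whole space decides everything: its components and
  their blocks are gradients on the smaller spaces, where uniqueness is known. Another gradient on
  the whole space has the same components and so equals \<open>G\<close>.\<close>

lemma gradients_unique:
  assumes G: "is_grad_N S f P G" and P: "P \<in> Nn S"
  shows "\<exists>!G. is_grad_N S f P G" "grad_N S f P = G"
    and "i < nUE S \<Longrightarrow> \<exists>!G. is_grad_Ni S f P i G" "i < nUE S \<Longrightarrow> grad_Ni S f P i = G ! i"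
    and "i < nUE S \<Longrightarrow> n < nserv S i \<Longrightarrow> \<exists>!G. is_grad_Nik S f P i n G"
    and "i < nUE S \<Longrightarrow> n < nserv S i \<Longrightarrow> grad_Nik S f P i n = block S i (G ! i) n"
proof -
  have Ni: "X = G ! i" if "i < nUE S" "is_grad_Ni S f P i X" for i X
    using is_grad_Ni_nth[OF G P that(1)] that(2) unfolding is_grad_Ni_def Ni_def
    by (metis is_gradient_mat_unique)
  have N: "G' = G" if G': "is_grad_N S f P G'" for G'
  proof (rule nth_equalityI)
    have "G \<in> Nn S" "G' \<in> Nn S"
      using G G' by (simp_all add: is_grad_N_def is_gradient_def)
    then show "length G' = length G"
      by (simp add: Nn_def)
    fix i assume "i < length G'"
    then have "i < nUE S"
      using \<open>G' \<in> Nn S\<close> by (simp add: Nn_def)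
    then show "G' ! i = G ! i"
      using Ni is_grad_Ni_nth[OF G' P] by blast
  qed
  show "\<exists>!G. is_grad_N S f P G" "grad_N S f P = G"
    using ex1_the[of "is_grad_N S f P", OF G N] by (simp_all add: grad_N_def)
  show "\<exists>!G. is_grad_Ni S f P i G" "grad_Ni S f P i = G ! i" if "i < nUE S"
    using ex1_the[of "is_grad_Ni S f P i", OF is_grad_Ni_nth[OF G P that] Ni[OF that]]
    by (simp_all add: grad_Ni_def)
  assume i: "i < nUE S" and n: "n < nserv S i"
  have "P ! i \<in> Ni S i"
    using P i by (simp add: Nn_def)
  note ex = is_grad_Nik_block[OF is_grad_Ni_nth[OF G P i] this n]
  have Nik: "X = block S i (G ! i) n" if "is_grad_Nik S f P i n X" for X
    using ex that unfolding is_grad_Nik_def Nik_def by (metis is_gradient_mat_unique)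
  show "\<exists>!G. is_grad_Nik S f P i n G" "grad_Nik S f P i n = block S i (G ! i) n"
    using ex1_the[of "is_grad_Nik S f P i n", OF ex Nik] by (simp_all add: grad_Nik_def)
qed

section \<open>The Euclidean gradient of the weighted sum rate\<close>

text \<open>Neighbourhoods of 0 for the norm of \<open>g\<close>, restricted to \<open>V\<close>.
  They are pulled back from the reals because the type carrying \<open>V\<close> has no topology of
  its own.\<close>

definition small :: "'v set \<Rightarrow> ('v \<Rightarrow> 'v \<Rightarrow> real) \<Rightarrow> 'v filter"
  where "small V g = inf (filtercomap (\<lambda>\<xi>. sqrt (g \<xi> \<xi>)) (nhds 0)) (principal V)"

lemma eventually_small:
  assumes "\<And>\<xi>. \<xi> \<in> V \<Longrightarrow> 0 \<le> g \<xi> \<xi>"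
  shows "eventually Q (small V g) \<longleftrightarrow> (\<exists>\<delta>>0. \<forall>\<xi>\<in>V. sqrt (g \<xi> \<xi>) < \<delta> \<longrightarrow> Q \<xi>)"
proof
  assume "eventually Q (small V g)"
  then obtain R where R: "eventually R (nhds 0)" "\<And>\<xi>. R (sqrt (g \<xi> \<xi>)) \<Longrightarrow> \<xi> \<in> V \<Longrightarrow> Q \<xi>"
    by (auto simp: small_def eventually_inf_principal eventually_filtercomap)
  then obtain \<delta> where "\<delta> > 0" "\<And>y. dist y 0 < \<delta> \<Longrightarrow> R y"
    by (auto simp: eventually_nhds_metric)
  with R(2) assms show "\<exists>\<delta>>0. \<forall>\<xi>\<in>V. sqrt (g \<xi> \<xi>) < \<delta> \<longrightarrow> Q \<xi>"
    by (intro exI[of _ \<delta>]) auto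
next
  assume "\<exists>\<delta>>0. \<forall>\<xi>\<in>V. sqrt (g \<xi> \<xi>) < \<delta> \<longrightarrow> Q \<xi>"
  then obtain \<delta> where d: "\<delta> > 0" "\<And>\<xi>. \<xi> \<in> V \<Longrightarrow> sqrt (g \<xi> \<xi>) < \<delta> \<Longrightarrow> Q \<xi>"
    by blast
  have "eventually (\<lambda>y. y < \<delta>) (nhds (0 :: real))"
    using d(1) by (auto simp: eventually_nhds_metric)
  with d(2) show "eventually Q (small V g)"
    by (auto simp: small_def eventually_inf_principal eventually_filtercomap)
qed

lemma infinitesimal_small:
  assumes "\<And>\<xi>. \<xi> \<in> V \<Longrightarrow> 0 \<le> g \<xi> \<xi>"
  shows "infinitesimal (small V g) (\<lambda>\<xi>. complex_of_real (sqrt (g \<xi> \<xi>)))"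
proof
  show "(\<lambda>\<xi>. complex_of_real (sqrt (g \<xi> \<xi>))) \<in> o[small V g](\<lambda>_. 1)"
  proof (rule landau_o.smallI)
    fix c :: real assume "c > 0"
    with assms show "\<forall>\<^sub>F \<xi> in small V g. norm (complex_of_real (sqrt (g \<xi> \<xi>))) \<le> c * norm (1 :: complex)"
      by (subst eventually_small) (auto intro!: exI[of _ c])
  qed
qed

text \<open>Little-o along \<open>small V g\<close>, with the norm as comparison function, unfolds
  to the epsilon-delta clause of \<open>is_gradient\<close>.\<close>

lemma is_gradientI:
  assumes nonneg: "\<And>\<xi>. \<xi> \<in> V \<Longrightarrow> 0 \<le> g \<xi> \<xi>" and G: "G \<in> V"
    and exp: "infinitesimal.expands (small V g) (\<lambda>\<xi>. complex_of_real (sqrt (g \<xi> \<xi>)))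
      (\<lambda>\<xi>. complex_of_real (f (pl x \<xi>))) (complex_of_real (f x)) (\<lambda>\<xi>. complex_of_real (g G \<xi>))"
  shows "is_gradient V pl g f x G"
  unfolding is_gradient_def
proof (intro conjI allI impI G)
  fix \<epsilon> :: real assume e: "\<epsilon> > 0"
  have "(\<lambda>\<xi>. complex_of_real (f (pl x \<xi>) - f x - g G \<xi>)) \<in>
      o[small V g](\<lambda>\<xi>. complex_of_real (sqrt (g \<xi> \<xi>)))"
    using exp infinitesimal_small[of V g, OF nonneg] by (simp add: infinitesimal.expands_def)
  from landau_o.smallD[OF this e]
  have "\<exists>\<delta>>0. \<forall>\<xi>\<in>V. sqrt (g \<xi> \<xi>) < \<delta> \<longrightarrow> cmod (complex_of_real (f (pl x \<xi>) - f x - g G \<xi>))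
      \<le> \<epsilon> * cmod (complex_of_real (sqrt (g \<xi> \<xi>)))"
    by (subst (asm) eventually_small[OF nonneg])
  then show "\<exists>\<delta>>0. \<forall>\<xi>\<in>V. sqrt (g \<xi> \<xi>) < \<delta> \<longrightarrow> \<bar>f (pl x \<xi>) - f x - g G \<xi>\<bar> \<le> \<epsilon> * sqrt (g \<xi> \<xi>)"
    unfolding norm_of_real using nonneg by (auto simp del: of_real_diff)
qed

lemma ipN_nonneg: "0 \<le> ipN S \<xi> \<xi>"
  by (simp add: ipN_def sum_nonneg mat_ip_nonneg)

lemma Nn_nth: "P \<in> Nn S \<Longrightarrow> i < nUE S \<Longrightarrow> P ! i \<in> carrier_mat (nserv S i * nTx S) (nStr S i)"
  by (simp add: Nn_def Ni_def)

lemma Nn_length: "P \<in> Nn S \<Longrightarrow> length P = nUE S"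
  by (simp add: Nn_def)

text \<open>This makes every coordinate of the increment \<open>O\<close> of the norm, so that it
  qualifies as the linear part of an expansion.\<close>

lemma entry_le_ipN:
  assumes "\<xi> \<in> Nn S" "j < nUE S" "a < nserv S j * nTx S" "b < nStr S j"
  shows "cmod (\<xi> ! j $$ (a, b)) \<le> sqrt (ipN S \<xi> \<xi>)"
proof -
  have "(cmod (\<xi> ! j $$ (a, b)))\<^sup>2 \<le> (\<Sum>b<nStr S j. (cmod (\<xi> ! j $$ (a, b)))\<^sup>2)"
    using assms by (intro member_le_sum) auto
  also have "\<dots> \<le> (\<Sum>a<nserv S j * nTx S. \<Sum>b<nStr S j. (cmod (\<xi> ! j $$ (a, b)))\<^sup>2)"
    using assms by (intro member_le_sum[of a _ "\<lambda>a. \<Sum>b<nStr S j. (cmod (\<xi> ! j $$ (a, b)))\<^sup>2"]) (auto intro: sum_nonneg)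
  also have "\<dots> = mat_ip (\<xi> ! j) (\<xi> ! j)"
    using Nn_nth[OF assms(1,2)] by (simp add: mat_ip_self)
  also have "\<dots> \<le> ipN S \<xi> \<xi>"
    unfolding ipN_def using assms(2) by (intro member_le_sum) (auto simp: mat_ip_nonneg)
  finally show ?thesis
    by (rule real_le_rsqrt)
qed

section \<open>Selection and channel matrices in coordinates\<close>

lemma Wm_carrier [simp]: "Wm S i \<in> carrier_mat (nBS S * nTx S) (nserv S i * nTx S)"
  by (simp add: Wm_def block_matrix_def)

lemma Wm_dim [simp]: "dim_row (Wm S i) = nBS S * nTx S" "dim_col (Wm S i) = nserv S i * nTx S"
  by (simp_all add: Wm_def block_matrix_def)

lemma Hm_carrier [simp]: "Hm S i \<in> carrier_mat (nRx S) (nBS S * nTx S)"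
  by (simp add: Hm_def block_matrix_def)

lemma Hm_dim [simp]: "dim_row (Hm S i) = nRx S" "dim_col (Hm S i) = nBS S * nTx S"
  by (simp_all add: Hm_def block_matrix_def)

text \<open>The row holding the only 1 of column \<open>b\<close> of \<open>Wm S i\<close>. Right
  multiplication by \<open>Wm S i\<close> thus selects the columns
  \<open>bs_row S i b\<close>.\<close>

definition bs_row :: "network \<Rightarrow> nat \<Rightarrow> nat \<Rightarrow> nat"
  where "bs_row S i b = bss S i ! (b div nTx S) * nTx S + b mod nTx S"

definition Km :: "network \<Rightarrow> nat \<Rightarrow> nat \<Rightarrow> complex mat"
  where "Km S i j = Hm S i * Wm S j"

lemma Km_carrier [simp]: "Km S i j \<in> carrier_mat (nRx S) (nserv S j * nTx S)"
  by (rule carrier_matI) (simp_all add: Km_def)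

lemma Km_dim [simp]: "dim_row (Km S i j) = nRx S" "dim_col (Km S i j) = nserv S j * nTx S"
  by (simp_all add: Km_def)

lemma bs_row_div_mod:
  assumes "nTx S > 0"
  shows "bs_row S i b div nTx S = bss S i ! (b div nTx S)" "bs_row S i b mod nTx S = b mod nTx S"
  using assms by (simp_all add: bs_row_def)

lemma less_mult_pos: "b < n * (t :: nat) \<Longrightarrow> t > 0"
  by (cases t) auto

lemma bss_less:
  assumes "valid_network S" "j < nUE S" "n < nserv S j"
  shows "bss S j ! n < nBS S"
proof -
  have "set (bss S j) \<subseteq> {..<nBS S}"
    using assms(1,2) by (simp add: valid_network_def)
  moreover have "bss S j ! n \<in> set (bss S j)"
    using assms(3) by (rule nth_mem)
  ultimately show ?thesis
    by blast
qed

lemma bs_row_less: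
  assumes "valid_network S" "i < nUE S" "b < nserv S i * nTx S"
  shows "bs_row S i b < nBS S * nTx S"
proof -
  have "b div nTx S < nserv S i"
    using assms(3) by (simp add: less_mult_imp_div_less)
  then have "bss S i ! (b div nTx S) < nBS S"
    using assms(1,2) by (intro bss_less)
  then show ?thesis
    unfolding bs_row_def using less_mult_pos[OF assms(3)] by (intro block_index_less) auto
qed

lemma Wm_index:
  assumes "c < nBS S * nTx S" "b < nserv S i * nTx S"
  shows "Wm S i $$ (c, b) = (if c = bs_row S i b then 1 else 0)"
proof -
  have t: "nTx S > 0"
    using assms(1) by (rule less_mult_pos)
  have "c = bs_row S i b \<longleftrightarrow> c div nTx S = bss S i ! (b div nTx S) \<and> c mod nTx S = b mod nTx S"
    using bs_row_div_mod[OF t] by (metis bs_row_def div_mult_mod_eq)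
  then show ?thesis
    using assms t by (auto simp: Wm_def block_matrix_def)
qed

lemma mult_Wm_index:
  assumes "valid_network S" "i < nUE S" "A \<in> carrier_mat k (nBS S * nTx S)" "a < k" "b < nserv S i * nTx S"
  shows "(A * Wm S i) $$ (a, b) = A $$ (a, bs_row S i b)"
proof -
  have "(A * Wm S i) $$ (a, b) = (\<Sum>c\<in>{0..<nBS S * nTx S}. A $$ (a, c) * Wm S i $$ (c, b))"
    using assms by (auto simp: scalar_prod_def)
  also have "\<dots> = (\<Sum>c\<in>{0..<nBS S * nTx S}. if c = bs_row S i b then A $$ (a, c) else 0)"
    using assms by (intro sum.cong) (auto simp: Wm_index)
  finally show ?thesis
    using bs_row_less[OF assms(1,2,5)] by simp
qed

lemma chan_carrier:
  assumes "valid_network S" "i < nUE S" "j < nUE S" "n < nserv S j"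
  shows "chan S i (bss S j ! n) \<in> carrier_mat (nRx S) (nTx S)"
proof -
  have "bss S j ! n < nBS S"
    using assms by (intro bss_less)
  then show ?thesis
    using assms(1,2) by (simp add: valid_network_def)
qed

lemma Km_index:
  assumes "valid_network S" "j < nUE S" "a < nRx S" "n < nserv S j" "b < nTx S"
  shows "Km S i j $$ (a, n * nTx S + b) = chan S i (bss S j ! n) $$ (a, b)"
proof -
  have nb: "n * nTx S + b < nserv S j * nTx S"
    using assms by (intro block_index_less)
  have "Km S i j $$ (a, n * nTx S + b) = Hm S i $$ (a, bs_row S j (n * nTx S + b))"
    unfolding Km_def using assms nb by (intro mult_Wm_index[of S j _ "nRx S"]) auto
  also have "\<dots> = chan S i (bss S j ! n) $$ (a, b)"
    using bs_row_less[OF assms(1,2) nb] assms(3,5) bs_row_div_mod[of S j "n * nTx S + b"]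
    by (simp add: Hm_def block_matrix_def)
  finally show ?thesis .
qed

text \<open>Column block \<open>n\<close> of \<open>K_ij\<close> is the channel from station
  \<open>bss S j ! n\<close> to receiver \<open>i\<close>. This replaces \<open>K_ij^H\<close> by
  the single channel matrix in the gradient with respect to one block.\<close>

lemma herm_Km_mult_index:
  assumes "valid_network S" "i < nUE S" "j < nUE S" "n < nserv S j" "a < nTx S" "b < d"
    "X \<in> carrier_mat (nRx S) d"
  shows "((Km S i j)\<^sup>H * X) $$ (n * nTx S + a, b) = ((chan S i (bss S j ! n))\<^sup>H * X) $$ (a, b)"
proof -
  have na: "n * nTx S + a < nserv S j * nTx S"
    using assms by (intro block_index_less)
  have c: "chan S i (bss S j ! n) \<in> carrier_mat (nRx S) (nTx S)"
    using assms by (intro chan_carrier)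
  have "((Km S i j)\<^sup>H * X) $$ (n * nTx S + a, b) =
      (\<Sum>c\<in>{0..<nRx S}. cnj (Km S i j $$ (c, n * nTx S + a)) * X $$ (c, b))"
    using assms na by (auto simp: scalar_prod_def)
  also have "\<dots> = (\<Sum>c\<in>{0..<nRx S}. cnj (chan S i (bss S j ! n) $$ (c, a)) * X $$ (c, b))"
    using assms by (intro sum.cong) (auto simp: Km_index)
  also have "\<dots> = ((chan S i (bss S j ! n))\<^sup>H * X) $$ (a, b)"
    using assms c by (auto simp: scalar_prod_def)
  finally show ?thesis .
qed

text \<open>Seen from receiver \<open>i\<close>: all users give the argument of the first
  determinant in the rate, all users but \<open>i\<close> give \<open>Rm S P i\<close>.\<close>

definition rx_cov :: "network \<Rightarrow> complex mat list \<Rightarrow> nat \<Rightarrow> nat set \<Rightarrow> complex mat"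
  where "rx_cov S P i J = covariance (nRx S) (nvar S) (\<lambda>j. Km S i j * P ! j) J"

lemma Rm_eq:
  assumes P: "P \<in> Nn S"
  shows "Rm S P i = rx_cov S P i ({..<nUE S} - {i})"
proof -
  let ?J = "{..<nUE S} - {i}" and ?n = "nBS S * nTx S" and ?m = "nRx S"
  let ?W = "\<lambda>j. Wm S j * P ! j * (P ! j)\<^sup>H * (Wm S j)\<^sup>H"
  have W: "?W j \<in> carrier_mat ?n ?n" if "j \<in> ?J" for j
    by (rule carrier_matI) simp_all
  have HW: "Hm S i * ?W j \<in> carrier_mat ?m ?n" if "j \<in> ?J" for j
    by (rule carrier_matI) simp_all
  have "Hm S i * msum ?n ?n ?W ?J = msum ?m ?n (\<lambda>j. Hm S i * ?W j) ?J"
    using W by (intro mult_msum) auto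
  moreover have "msum ?m ?n (\<lambda>j. Hm S i * ?W j) ?J * (Hm S i)\<^sup>H =
      msum ?m ?m (\<lambda>j. Hm S i * ?W j * (Hm S i)\<^sup>H) ?J"
    using HW by (intro msum_mult) auto
  moreover have "\<dots> = msum ?m ?m (\<lambda>j. (Km S i j * P ! j) * (Km S i j * P ! j)\<^sup>H) ?J"
  proof (rule msum_cong)
    fix j a b assume "j \<in> ?J"
    then have "dim_row (P ! j) = nserv S j * nTx S"
      using Nn_nth[OF P, of j] by auto
    then show "(Hm S i * ?W j * (Hm S i)\<^sup>H) $$ (a, b) = ((Km S i j * P ! j) * (Km S i j * P ! j)\<^sup>H) $$ (a, b)"
      by (simp add: Km_def herm_mult mult_mat_assoc)
  qed
  ultimately show ?thesis
    by (simp add: Rm_def rx_cov_def covariance_def)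
qed

lemma rx_cov_all:
  assumes "i < nUE S" "P \<in> Nn S"
  shows "rx_cov S P i {..<nUE S} = Rm S P i + (Km S i i * P ! i) * (Km S i i * P ! i)\<^sup>H"
proof -
  let ?f = "\<lambda>j. (Km S i j * P ! j) * (Km S i j * P ! j)\<^sup>H"
  have "msum (nRx S) (nRx S) ?f {..<nUE S} = ?f i + msum (nRx S) (nRx S) ?f ({..<nUE S} - {i})"
    using assms by (intro msum_remove) (auto intro!: carrier_matI)
  then show ?thesis
    unfolding Rm_eq[OF assms(2)] rx_cov_def covariance_def
    by (intro eq_matI) (auto simp del: index_mult_mat(1))
qed

lemma rate_eq:
  assumes "i < nUE S" "P \<in> Nn S"
  shows "rate S P i = ln (Re (det (rx_cov S P i {..<nUE S}))) -
    ln (Re (det (rx_cov S P i ({..<nUE S} - {i}))))"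
proof -
  have "dim_row (P ! i) = nserv S i * nTx S"
    using Nn_nth[OF assms(2,1)] by auto
  then have "Hm S i * Wm S i * P ! i * (P ! i)\<^sup>H * (Wm S i)\<^sup>H * (Hm S i)\<^sup>H =
      (Km S i i * P ! i) * (Km S i i * P ! i)\<^sup>H"
    by (simp add: Km_def herm_mult mult_mat_assoc)
  then show ?thesis
    unfolding rate_def rx_cov_all[OF assms] Rm_eq[OF assms(2), symmetric] by simp
qed

lemma map2_add_nth:
  assumes "P \<in> Nn S" "\<xi> \<in> Nn S" "j < nUE S"
  shows "map2 (+) P \<xi> ! j = P ! j + \<xi> ! j"
  using assms by (simp add: Nn_length)

lemma map2_add_Nn:
  assumes "P \<in> Nn S" "\<xi> \<in> Nn S"
  shows "map2 (+) P \<xi> \<in> Nn S"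
  unfolding Nn_def
proof (intro CollectI conjI allI impI)
  show "length (map2 (+) P \<xi>) = nUE S"
    using assms by (simp add: Nn_length)
  show "map2 (+) P \<xi> ! i \<in> Ni S i" if "i < nUE S" for i
    using Nn_nth[OF assms(1) that] Nn_nth[OF assms(2) that]
    unfolding map2_add_nth[OF assms that] Ni_def by auto
qed

lemma KmP_carrier:
  assumes "P \<in> Nn S" "j < nUE S"
  shows "Km S i j * P ! j \<in> carrier_mat (nRx S) (nStr S j)"
  using Nn_nth[OF assms] by (intro mult_carrier_mat[OF Km_carrier])

text \<open>The coefficient with which \<open>K\<^sub>i\<^sub>j \<xi>\<^sub>j\<close> enters half of the differential of the rate of user \<open>i\<close>.\<close>

definition rate_coeff :: "network \<Rightarrow> complex mat list \<Rightarrow> nat \<Rightarrow> nat \<Rightarrow> complex mat"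
  where "rate_coeff S P i j =
    (if j = i then minv (rx_cov S P i {..<nUE S})
     else minv (rx_cov S P i {..<nUE S}) - minv (rx_cov S P i ({..<nUE S} - {i}))) * (Km S i j * P ! j)"

text \<open>Component \<open>j\<close> collects the effect of precoder \<open>j\<close> on the rates
  of all receivers \<open>i\<close>. In \<open>- 2\<close> the sign comes from the negation of the
  sum rate and the 2 from the differential of the logarithm; \<open>(Km S i j)\<^sup>H\<close> is
  the adjoint of the channel acting on the increment.\<close>

definition wsr_grad :: "network \<Rightarrow> complex mat list \<Rightarrow> complex mat list"
  where "wsr_grad S P = map (\<lambda>j. msum (nserv S j * nTx S) (nStr S j)
    (\<lambda>i. (- 2 * wt S i) *\<^sub>r ((Km S i j)\<^sup>H * rate_coeff S P i j)) {..<nUE S}) [0..<nUE S]"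

section \<open>The differential of the weighted sum rate at a fixed point\<close>

context
  fixes S :: network and P :: "complex mat list"
  assumes valid: "valid_network S" and P: "P \<in> Nn S"
begin

lemma nvar_pos: "nvar S > 0"
  using valid by (simp add: valid_network_def)

lemma rx_cov_minv:
  assumes "J \<subseteq> {..<nUE S}"
  shows "minv (rx_cov S P i J) \<in> carrier_mat (nRx S) (nRx S)"
    "rx_cov S P i J * minv (rx_cov S P i J) = 1\<^sub>m (nRx S)"
    "minv (rx_cov S P i J) * rx_cov S P i J = 1\<^sub>m (nRx S)"
proof -
  have "Km S i j * P ! j \<in> carrier_mat (nRx S) (nStr S j)" if "j \<in> J" for j
    using that assms by (intro KmP_carrier P) auto
  note * = covariance_minv[of J "\<lambda>j. Km S i j * P ! j", OF this nvar_pos]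
  show "minv (rx_cov S P i J) \<in> carrier_mat (nRx S) (nRx S)"
    "rx_cov S P i J * minv (rx_cov S P i J) = 1\<^sub>m (nRx S)"
    "minv (rx_cov S P i J) * rx_cov S P i J = 1\<^sub>m (nRx S)"
    unfolding rx_cov_def using * by simp_all
qed

lemma rate_coeff_carrier:
  assumes "j < nUE S"
  shows "rate_coeff S P i j \<in> carrier_mat (nRx S) (nStr S j)"
  unfolding rate_coeff_def
  by (intro mult_carrier_mat[OF _ KmP_carrier[OF P assms]])
     (auto intro!: minus_carrier_mat rx_cov_minv(1))

text \<open>The variable is the increment of \<open>P\<close> and the scale is its norm, so
  \<open>expands\<close> expresses first-order approximation at \<open>P\<close>.\<close>

interpretation infinitesimal "small (Nn S) (ipN S)" "\<lambda>\<xi>. complex_of_real (sqrt (ipN S \<xi> \<xi>))"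
  by (rule infinitesimal_small) (rule ipN_nonneg)

lemma eventually_Nn: "(\<And>\<xi>. \<xi> \<in> Nn S \<Longrightarrow> Q \<xi>) \<Longrightarrow> eventually Q (small (Nn S) (ipN S))"
  by (auto simp: eventually_small[of "Nn S" "ipN S", OF ipN_nonneg] intro: exI[of _ 1])

text \<open>An increment of the precoders changes the received precoder \<open>K_ij P_j\<close> by
  \<open>K_ij\<close> times its component \<open>j\<close>, to which the expansion for covariances
  applies.\<close>

lemma expands_ln_det_rx_cov:
  assumes J: "J \<subseteq> {..<nUE S}"
  shows "expands (\<lambda>\<xi>. complex_of_real (ln (Re (det (rx_cov S (map2 (+) P \<xi>) i J)))))
    (complex_of_real (ln (Re (det (rx_cov S P i J)))))
    (\<lambda>\<xi>. complex_of_real (\<Sum>j\<in>J. 2 * mat_ip (minv (rx_cov S P i J) * (Km S i j * P ! j)) (Km S i j * \<xi> ! j)))"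
proof -
  \<comment> \<open>Entries of \<open>K_ij\<close> times component \<open>j\<close> of the
    increment, spelled out as finite sums so that the bound on single coordinates carries
    over.\<close>
  define z where "z \<xi> j = (\<lambda>(a, c). \<Sum>e\<in>{0..<nserv S j * nTx S}. Km S i j $$ (a, e) * \<xi> ! j $$ (e, c))"
    for \<xi> :: "complex mat list" and j
  have lt: "j < nUE S" if "j \<in> J" for j
    using J that by auto
  have entry: "(\<lambda>\<xi>. \<xi> ! j $$ (e, c)) \<in> O[small (Nn S) (ipN S)](\<lambda>\<xi>. complex_of_real (sqrt (ipN S \<xi> \<xi>)))"
    if "j < nUE S" "e < nserv S j * nTx S" "c < nStr S j" for j e c
  proof (rule bigoI[of _ 1], rule eventually_Nn)
    fix \<xi> assume "\<xi> \<in> Nn S"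
    from entry_le_ipN[OF this that]
    show "cmod (\<xi> ! j $$ (e, c)) \<le> 1 * cmod (complex_of_real (sqrt (ipN S \<xi> \<xi>)))"
      by (simp add: ipN_nonneg)
  qed
  have "expands (\<lambda>\<xi>. complex_of_real (ln (Re (det (covariance (nRx S) (nvar S)
        (\<lambda>j. Km S i j * P ! j + mat (nRx S) (nStr S j) (z \<xi> j)) J)))))
    (complex_of_real (ln (Re (det (rx_cov S P i J)))))
    (\<lambda>\<xi>. complex_of_real (\<Sum>j\<in>J. 2 * mat_ip (minv (rx_cov S P i J) * (Km S i j * P ! j))
        (mat (nRx S) (nStr S j) (z \<xi> j))))"
    unfolding rx_cov_def
  proof (rule expands_ln_det_covariance)
    fix j a c assume "j \<in> J" "a < nRx S" "c < nStr S j"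
    then show "(\<lambda>\<xi>. z \<xi> j (a, c)) \<in> O[small (Nn S) (ipN S)](\<lambda>\<xi>. complex_of_real (sqrt (ipN S \<xi> \<xi>)))"
      by (auto simp: z_def lt intro!: big_sum_in_bigo entry)
  qed (auto simp: lt nvar_pos intro!: KmP_carrier P)
  then show ?thesis
  \<comment> \<open>Matrix sums and products have the right dimensions only for increments in
    \<open>Nn S\<close>; the filter sees no others.\<close>
  proof (rule expands_cong; intro eventually_Nn)
    fix \<xi> assume xi: "\<xi> \<in> Nn S"
    have z: "mat (nRx S) (nStr S j) (z \<xi> j) = Km S i j * \<xi> ! j" if "j \<in> J" for j
      using Nn_nth[OF xi lt[OF that]] by (intro eq_matI) (auto simp: z_def scalar_prod_def)
    show "complex_of_real (\<Sum>j\<in>J. 2 * mat_ip (minv (rx_cov S P i J) * (Km S i j * P ! j)) (Km S i j * \<xi> ! j)) =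
        complex_of_real (\<Sum>j\<in>J. 2 * mat_ip (minv (rx_cov S P i J) * (Km S i j * P ! j))
        (mat (nRx S) (nStr S j) (z \<xi> j)))"
      by (simp add: z cong: sum.cong)
    have "Km S i j * map2 (+) P \<xi> ! j = Km S i j * P ! j + mat (nRx S) (nStr S j) (z \<xi> j)" if "j \<in> J" for j
      unfolding map2_add_nth[OF P xi lt[OF that]] z[OF that]
      by (rule mult_add_distrib_mat[OF Km_carrier Nn_nth[OF P lt[OF that]] Nn_nth[OF xi lt[OF that]]])
    then have "rx_cov S (map2 (+) P \<xi>) i J =
        covariance (nRx S) (nvar S) (\<lambda>j. Km S i j * P ! j + mat (nRx S) (nStr S j) (z \<xi> j)) J"
      unfolding rx_cov_def covariance_def by (intro arg_cong2[of _ _ _ _ "(+)"] msum_cong) simp_all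
    then show "complex_of_real (ln (Re (det (rx_cov S (map2 (+) P \<xi>) i J)))) =
      complex_of_real (ln (Re (det (covariance (nRx S) (nvar S)
        (\<lambda>j. Km S i j * P ! j + mat (nRx S) (nStr S j) (z \<xi> j)) J))))"
      by simp
  qed
qed

text \<open>For \<open>j = i\<close> only the first determinant varies, since \<open>R_i\<close>
  omits user \<open>i\<close>; for other \<open>j\<close> both vary and the inverses are subtracted.
  These are the two cases of \<open>rate_coeff\<close>.\<close>

lemma expands_rate:
  assumes i: "i < nUE S"
  shows "expands (\<lambda>\<xi>. complex_of_real (rate S (map2 (+) P \<xi>) i)) (complex_of_real (rate S P i))
    (\<lambda>\<xi>. complex_of_real (\<Sum>j<nUE S. 2 * mat_ip (rate_coeff S P i j) (Km S i j * \<xi> ! j)))"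
proof -
  let ?J = "{..<nUE S} - {i}"
  let ?Y = "minv (rx_cov S P i {..<nUE S})" and ?R = "minv (rx_cov S P i ?J)"
  have "expands (\<lambda>\<xi>. complex_of_real (ln (Re (det (rx_cov S (map2 (+) P \<xi>) i {..<nUE S})))) +
      (- 1) * complex_of_real (ln (Re (det (rx_cov S (map2 (+) P \<xi>) i ?J)))))
    (complex_of_real (ln (Re (det (rx_cov S P i {..<nUE S})))) +
      (- 1) * complex_of_real (ln (Re (det (rx_cov S P i ?J)))))
    (\<lambda>\<xi>. complex_of_real (\<Sum>j<nUE S. 2 * mat_ip (?Y * (Km S i j * P ! j)) (Km S i j * \<xi> ! j)) +
      (- 1) * complex_of_real (\<Sum>j\<in>?J. 2 * mat_ip (?R * (Km S i j * P ! j)) (Km S i j * \<xi> ! j)))"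
    by (intro expands_add expands_cmult expands_ln_det_rx_cov) auto
  moreover have "complex_of_real (ln (Re (det (rx_cov S P i {..<nUE S})))) +
      (- 1) * complex_of_real (ln (Re (det (rx_cov S P i ?J)))) = complex_of_real (rate S P i)"
    by (simp add: rate_eq[OF i P])
  ultimately show ?thesis
  proof (simp only:, elim expands_cong; intro eventually_Nn)
    fix \<xi> assume xi: "\<xi> \<in> Nn S"
    show "complex_of_real (rate S (map2 (+) P \<xi>) i) =
      complex_of_real (ln (Re (det (rx_cov S (map2 (+) P \<xi>) i {..<nUE S})))) +
      (- 1) * complex_of_real (ln (Re (det (rx_cov S (map2 (+) P \<xi>) i ?J))))"
      by (simp add: rate_eq[OF i map2_add_Nn[OF P xi]])
    have coeff: "mat_ip (rate_coeff S P i j) (Km S i j * \<xi> ! j) =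
        mat_ip (?Y * (Km S i j * P ! j)) (Km S i j * \<xi> ! j) -
        (if j \<in> ?J then mat_ip (?R * (Km S i j * P ! j)) (Km S i j * \<xi> ! j) else 0)" if "j < nUE S" for j
    proof -
      have B: "Km S i j * P ! j \<in> carrier_mat (nRx S) (nStr S j)"
        "Km S i j * \<xi> ! j \<in> carrier_mat (nRx S) (nStr S j)"
        by (rule KmP_carrier[OF P that], rule KmP_carrier[OF xi that])
      have Y: "?Y \<in> carrier_mat (nRx S) (nRx S)" and R: "?R \<in> carrier_mat (nRx S) (nRx S)"
        by (intro rx_cov_minv(1); auto)+
      have "mat_ip ((?Y - ?R) * (Km S i j * P ! j)) (Km S i j * \<xi> ! j) =
        mat_ip (?Y * (Km S i j * P ! j)) (Km S i j * \<xi> ! j) - mat_ip (?R * (Km S i j * P ! j)) (Km S i j * \<xi> ! j)"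
        unfolding minus_mult_distrib_mat[OF Y R B(1)]
        by (intro mat_ip_diff[of _ "nRx S" "nStr S j"] mult_carrier_mat[OF Y B(1)] mult_carrier_mat[OF R B(1)] B(2))
      then show ?thesis
        using that by (simp add: rate_coeff_def)
    qed
    have "(\<Sum>j<nUE S. 2 * mat_ip (rate_coeff S P i j) (Km S i j * \<xi> ! j)) =
      (\<Sum>j<nUE S. 2 * mat_ip (?Y * (Km S i j * P ! j)) (Km S i j * \<xi> ! j)) -
      (\<Sum>j<nUE S. if j \<in> ?J then 2 * mat_ip (?R * (Km S i j * P ! j)) (Km S i j * \<xi> ! j) else 0)"
      unfolding sum_subtractf[symmetric] by (intro sum.cong refl) (simp add: coeff)
    also have "(\<Sum>j<nUE S. if j \<in> ?J then 2 * mat_ip (?R * (Km S i j * P ! j)) (Km S i j * \<xi> ! j) else 0) =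
        (\<Sum>j\<in>?J. 2 * mat_ip (?R * (Km S i j * P ! j)) (Km S i j * \<xi> ! j))"
      by (intro sum.mono_neutral_cong_right) auto
    finally show "complex_of_real (\<Sum>j<nUE S. 2 * mat_ip (rate_coeff S P i j) (Km S i j * \<xi> ! j)) =
      complex_of_real (\<Sum>j<nUE S. 2 * mat_ip (?Y * (Km S i j * P ! j)) (Km S i j * \<xi> ! j)) +
      (- 1) * complex_of_real (\<Sum>j\<in>?J. 2 * mat_ip (?R * (Km S i j * P ! j)) (Km S i j * \<xi> ! j))"
      by simp
  qed
qed

lemma herm_Km_coeff_carrier:
  assumes "j < nUE S"
  shows "(Km S i j)\<^sup>H * rate_coeff S P i j \<in> carrier_mat (nserv S j * nTx S) (nStr S j)"
  by (intro mult_carrier_mat[OF herm_carrier[OF Km_carrier]] rate_coeff_carrier assms)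

lemma wsr_grad_nth:
  assumes "j < nUE S"
  shows "wsr_grad S P ! j = msum (nserv S j * nTx S) (nStr S j)
    (\<lambda>i. (- 2 * wt S i) *\<^sub>r ((Km S i j)\<^sup>H * rate_coeff S P i j)) {..<nUE S}"
  using assms by (simp add: wsr_grad_def)

text \<open>The expansion of the objective sums over receivers outside and transmitters inside.
  Exchanging the two sums and moving \<open>K_ij\<close> across the inner product displays it as an
  inner product with \<open>wsr_grad\<close>.\<close>

lemma is_grad_N_wsr: "is_grad_N S (neg_wsr S) P (wsr_grad S P)"
  unfolding is_grad_N_def
proof (rule is_gradientI)
  show "0 \<le> ipN S \<xi> \<xi>" for \<xi>
    by (rule ipN_nonneg)
  show "wsr_grad S P \<in> Nn S"
    by (auto simp: Nn_def Ni_def wsr_grad_def)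
  have "expands (\<lambda>\<xi>. \<Sum>i<nUE S. complex_of_real (- wt S i) * complex_of_real (rate S (map2 (+) P \<xi>) i))
    (\<Sum>i<nUE S. complex_of_real (- wt S i) * complex_of_real (rate S P i))
    (\<lambda>\<xi>. \<Sum>i<nUE S. complex_of_real (- wt S i) *
       complex_of_real (\<Sum>j<nUE S. 2 * mat_ip (rate_coeff S P i j) (Km S i j * \<xi> ! j)))"
    by (intro expands_sum expands_cmult expands_rate) auto
  moreover have "(\<Sum>i<nUE S. complex_of_real (- wt S i) * complex_of_real (rate S Q i)) =
      complex_of_real (neg_wsr S Q)" for Q
    by (simp add: neg_wsr_def sum_negf)
  ultimately show "expands (\<lambda>\<xi>. complex_of_real (neg_wsr S (map2 (+) P \<xi>)))
     (complex_of_real (neg_wsr S P)) (\<lambda>\<xi>. complex_of_real (ipN S (wsr_grad S P) \<xi>))"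
  proof (simp only:, elim expands_cong; intro eventually_Nn)
    fix \<xi> assume xi: "\<xi> \<in> Nn S"
    have "ipN S (wsr_grad S P) \<xi> = (\<Sum>j<nUE S. \<Sum>i<nUE S. - 2 * wt S i *
        mat_ip (rate_coeff S P i j) (Km S i j * \<xi> ! j))"
      unfolding ipN_def
    proof (intro sum.cong refl)
      fix j assume "j \<in> {..<nUE S}"
      then have j: "j < nUE S" by simp
      note c = herm_Km_coeff_carrier[OF j] Nn_nth[OF xi j]
      have "mat_ip (wsr_grad S P ! j) (\<xi> ! j) =
        (\<Sum>i<nUE S. mat_ip ((- 2 * wt S i) *\<^sub>r ((Km S i j)\<^sup>H * rate_coeff S P i j)) (\<xi> ! j))"
        unfolding wsr_grad_nth[OF j] by (intro mat_ip_msum smult_carrier_mat c)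
      also have "\<dots> = (\<Sum>i<nUE S. - 2 * wt S i * mat_ip (rate_coeff S P i j) (Km S i j * \<xi> ! j))"
        by (intro sum.cong refl)
           (simp only: mat_ip_scale[OF c] mat_ip_mult[OF rate_coeff_carrier[OF j] Km_carrier c(2)])
      finally show "mat_ip (wsr_grad S P ! j) (\<xi> ! j) =
        (\<Sum>i<nUE S. - 2 * wt S i * mat_ip (rate_coeff S P i j) (Km S i j * \<xi> ! j))" .
    qed
    also have "\<dots> = (\<Sum>i<nUE S. - wt S i * (\<Sum>j<nUE S. 2 * mat_ip (rate_coeff S P i j) (Km S i j * \<xi> ! j)))"
      by (subst sum.swap) (simp add: sum_distrib_left mult_ac sum_negf)
    finally show "complex_of_real (ipN S (wsr_grad S P) \<xi>) = (\<Sum>i<nUE S. complex_of_real (- wt S i) *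
       complex_of_real (\<Sum>j<nUE S. 2 * mat_ip (rate_coeff S P i j) (Km S i j * \<xi> ! j)))"
      by (simp only: of_real_sum of_real_mult)
  qed simp
qed

text \<open>Woodbury with \<open>B = K_ii P_i\<close>, \<open>N = R_i^-1\<close> and
  \<open>M = Y_i^-1\<close>: \<open>M B = N B C\<close> gives the coefficient of the user's own
  precoder, and \<open>M - N = - N B C B^H N\<close> those of the interfering ones.\<close>

lemma rate_coeff_formula:
  assumes i: "i < nUE S" and j: "j < nUE S"
  defines "X \<equiv> minv (Rm S P i) * Hm S i * Wm S i * P ! i * Cm S P i"
  shows "rate_coeff S P i i = X"
    and "j \<noteq> i \<Longrightarrow> rate_coeff S P i j = - (X * (P ! i)\<^sup>H * (Wm S i)\<^sup>H * (Hm S i)\<^sup>H * minv (Rm S P i) *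
      Hm S i * Wm S j * P ! j)"
    and "Cm S P i \<in> carrier_mat (nStr S i) (nStr S i)"
proof -
  let ?J = "{..<nUE S} - {i}"
  let ?B = "Km S i i * P ! i" and ?M = "minv (rx_cov S P i {..<nUE S})" and ?N = "minv (Rm S P i)"
  have sub: "{..<nUE S} \<subseteq> {..<nUE S}" "?J \<subseteq> {..<nUE S}"
    by auto
  note Y = rx_cov_minv[OF sub(1), of i] and R = rx_cov_minv[OF sub(2), of i, folded Rm_eq[OF P]]
  have Yc: "rx_cov S P i J \<in> carrier_mat (nRx S) (nRx S)" for J
    by (simp add: rx_cov_def)
  have Rc: "Rm S P i \<in> carrier_mat (nRx S) (nRx S)"
    by (simp add: Rm_eq[OF P] Yc)
  note B = KmP_carrier[OF P i, of i]
  note w = woodbury[OF Rc R(1,3) Yc Y(1,2,3) R(2) B rx_cov_all[OF i P]]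
  have dims: "dim_row (P ! i) = nserv S i * nTx S" "dim_col (P ! i) = nStr S i"
    "dim_row ?N = nRx S" "dim_col ?N = nRx S" "dim_row (P ! j) = nserv S j * nTx S"
    using Nn_nth[OF P i] Nn_nth[OF P j] R(1) by auto
  have C: "Cm S P i = minv (1\<^sub>m (nStr S i) + ?B\<^sup>H * ?N * ?B)"
    using dims by (simp add: Cm_def Km_def herm_mult mult_mat_assoc)
  have Cd: "dim_row (Cm S P i) = nStr S i" "dim_col (Cm S P i) = nStr S i"
    using w(1) unfolding C by auto
  then show "Cm S P i \<in> carrier_mat (nStr S i) (nStr S i)"
    by (rule carrier_matI)
  have X: "X = ?N * ?B * Cm S P i"
    using dims Cd by (simp add: X_def Km_def mult_mat_assoc)
  show "rate_coeff S P i i = X"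
    unfolding rate_coeff_def X C w(2) by simp
  assume ne: "j \<noteq> i"
  have M: "?M \<in> carrier_mat (nRx S) (nRx S)"
    by (rule Y(1))
  have "?M - ?N = - (?N - ?M)"
    using M R(1) by (intro eq_matI) auto
  also have "?N - ?M = ?N * ?B * Cm S P i * ?B\<^sup>H * ?N"
    unfolding C w(3) ..
  finally have eq: "?M - ?N = - (?N * ?B * Cm S P i * ?B\<^sup>H * ?N)" .
  have "rate_coeff S P i j = - (?N * ?B * Cm S P i * ?B\<^sup>H * ?N) * (Km S i j * P ! j)"
    unfolding rate_coeff_def Rm_eq[OF P, of i, symmetric] eq using ne by simp
  also have "\<dots> = - (?N * ?B * Cm S P i * ?B\<^sup>H * ?N * (Km S i j * P ! j))"
    using dims Cd by (intro uminus_mult_left_mat) auto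
  also have "?N * ?B * Cm S P i * ?B\<^sup>H * ?N * (Km S i j * P ! j) =
    X * (P ! i)\<^sup>H * (Wm S i)\<^sup>H * (Hm S i)\<^sup>H * minv (Rm S P i) * Hm S i * Wm S j * P ! j"
    using dims Cd by (simp add: X Km_def herm_mult mult_mat_assoc)
  finally show "rate_coeff S P i j = - (X * (P ! i)\<^sup>H * (Wm S i)\<^sup>H * (Hm S i)\<^sup>H * minv (Rm S P i) *
      Hm S i * Wm S j * P ! j)" .
qed

text \<open>The interference coefficients carry a minus sign, which turns
  \<open>- 2 * wt S j\<close> into \<open>+ 2 * wt S j\<close>; after factoring out
  \<open>- 2\<close> they are subtracted inside the bracket.\<close>

lemma block_wsr_grad:
  assumes i: "i < nUE S" and n: "n < nserv S i"
  defines "k \<equiv> bss S i ! n"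
  shows "block S i (wsr_grad S P ! i) n =
    (- 2) *\<^sub>r (wt S i *\<^sub>r ((chan S i k)\<^sup>H * minv (Rm S P i) * Hm S i * Wm S i * P ! i * Cm S P i)
      - msum (nTx S) (nStr S i)
          (\<lambda>j. wt S j *\<^sub>r ((chan S j k)\<^sup>H * minv (Rm S P j) * Hm S j * Wm S j * P ! j * Cm S P j
             * (P ! j)\<^sup>H * (Wm S j)\<^sup>H * (Hm S j)\<^sup>H * minv (Rm S P j) * Hm S j * Wm S i * P ! i))
          ({..<nUE S} - {i}))"
    (is "_ = (- 2) *\<^sub>r (wt S i *\<^sub>r ?own - msum _ _ (\<lambda>j. wt S j *\<^sub>r ?other j) _)")
proof -
  have ch: "chan S j k \<in> carrier_mat (nRx S) (nTx S)" if "j < nUE S" for j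
    unfolding k_def using valid that i n by (rule chan_carrier)
  have dims: "dim_row (minv (Rm S P j)) = nRx S" "dim_col (minv (Rm S P j)) = nRx S"
    "dim_row (P ! j) = nserv S j * nTx S" "dim_col (P ! j) = nStr S j"
    "dim_row (chan S j k) = nRx S" "dim_col (chan S j k) = nTx S"
    "dim_row (Cm S P j) = nStr S j" "dim_col (Cm S P j) = nStr S j" if "j < nUE S" for j
  proof -
    show "dim_row (minv (Rm S P j)) = nRx S" "dim_col (minv (Rm S P j)) = nRx S"
      using rx_cov_minv(1)[of "{..<nUE S} - {j}" j] unfolding Rm_eq[OF P] by auto
    show "dim_row (P ! j) = nserv S j * nTx S" "dim_col (P ! j) = nStr S j"
      using Nn_nth[OF P that] by auto
    show "dim_row (chan S j k) = nRx S" "dim_col (chan S j k) = nTx S"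
      using ch[OF that] by auto
    show "dim_row (Cm S P j) = nStr S j" "dim_col (Cm S P j) = nStr S j"
      using rate_coeff_formula(3)[OF that that] by auto
  qed
  have own: "(chan S i k)\<^sup>H * rate_coeff S P i i = ?own"
    unfolding rate_coeff_formula(1)[OF i i] using dims[OF i] by (simp add: mult_mat_assoc)
  have other: "(chan S j k)\<^sup>H * rate_coeff S P j i = - ?other j" if "j \<in> {..<nUE S} - {i}" for j
  proof -
    have j: "j < nUE S" and ne: "i \<noteq> j"
      using that by auto
    show ?thesis
      unfolding rate_coeff_formula(2)[OF j i ne] using dims[OF i] dims[OF j]
      by (subst uminus_mult_right_mat) (simp_all add: mult_mat_assoc)
  qed
  \<comment> \<open>Opaque names for the long products keep the simplifier from expanding their
    entries into scalar products.\<close>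
  define A where "A = ?own"
  define D where "D = (\<lambda>j. ?other j)"
  have A: "dim_row A = nTx S" "dim_col A = nStr S i" "(chan S i k)\<^sup>H * rate_coeff S P i i = A"
    using dims[OF i] own by (simp_all only: A_def index_mult_mat dim_herm)
  have D: "dim_row (D j) = nTx S" "dim_col (D j) = nStr S i"
    "(chan S j k)\<^sup>H * rate_coeff S P j i = - D j" if "j \<in> {..<nUE S} - {i}" for j
  proof -
    show "dim_row (D j) = nTx S" "dim_col (D j) = nStr S i"
      unfolding D_def using dims[OF i] dims[of j] that by simp_all
    show "(chan S j k)\<^sup>H * rate_coeff S P j i = - D j"
      unfolding D_def by (rule other[OF that])
  qed
  have "block S i (wsr_grad S P ! i) n =
    (- 2) *\<^sub>r (wt S i *\<^sub>r A - msum (nTx S) (nStr S i) (\<lambda>j. wt S j *\<^sub>r D j) ({..<nUE S} - {i}))"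
  proof (rule eq_matI)
    fix a b
    assume "a < dim_row ((- 2) *\<^sub>r (wt S i *\<^sub>r A - msum (nTx S) (nStr S i) (\<lambda>j. wt S j *\<^sub>r D j) ({..<nUE S} - {i})))"
      "b < dim_col ((- 2) *\<^sub>r (wt S i *\<^sub>r A - msum (nTx S) (nStr S i) (\<lambda>j. wt S j *\<^sub>r D j) ({..<nUE S} - {i})))"
    then have ab: "a < nTx S" "b < nStr S i"
      by simp_all
    have na: "n * nTx S + a < nserv S i * nTx S"
      using n ab by (intro block_index_less)
    have ent: "((- 2 * wt S j) *\<^sub>r ((Km S j i)\<^sup>H * rate_coeff S P j i)) $$ (n * nTx S + a, b) =
        complex_of_real (- 2 * wt S j) * ((chan S j k)\<^sup>H * rate_coeff S P j i) $$ (a, b)" if "j < nUE S" for j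
    proof -
      have "dim_col (rate_coeff S P j i) = nStr S i"
        using rate_coeff_carrier[OF i, of j] by auto
      then show ?thesis
        using herm_Km_mult_index[OF valid that i n ab rate_coeff_carrier[OF i, of j]] na ab
        by (simp add: k_def del: index_mult_mat(1))
    qed
    have "block S i (wsr_grad S P ! i) n $$ (a, b) =
        (\<Sum>j<nUE S. ((- 2 * wt S j) *\<^sub>r ((Km S j i)\<^sup>H * rate_coeff S P j i)) $$ (n * nTx S + a, b))"
      using ab na by (simp add: block_def wsr_grad_nth[OF i] del: index_mult_mat(1) index_smult_mat(1))
    also have "\<dots> = (\<Sum>j<nUE S. complex_of_real (- 2 * wt S j) * ((chan S j k)\<^sup>H * rate_coeff S P j i) $$ (a, b))"
      by (intro sum.cong refl ent) simp
    also have "\<dots> = complex_of_real (- 2 * wt S i) * A $$ (a, b) +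
        (\<Sum>j\<in>{..<nUE S} - {i}. complex_of_real (- 2 * wt S j) * ((chan S j k)\<^sup>H * rate_coeff S P j i) $$ (a, b))"
      using i by (subst sum.remove[of _ i]) (auto simp only: A(3) finite_lessThan lessThan_iff)
    also have "(\<Sum>j\<in>{..<nUE S} - {i}. complex_of_real (- 2 * wt S j) * ((chan S j k)\<^sup>H * rate_coeff S P j i) $$ (a, b)) =
        (\<Sum>j\<in>{..<nUE S} - {i}. complex_of_real (2 * wt S j) * D j $$ (a, b))"
    proof (intro sum.cong refl)
      fix j assume j: "j \<in> {..<nUE S} - {i}"
      then have "a < dim_row (D j)" "b < dim_col (D j)"
        using ab D by simp_all
      then show "complex_of_real (- 2 * wt S j) * ((chan S j k)\<^sup>H * rate_coeff S P j i) $$ (a, b) =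
        complex_of_real (2 * wt S j) * D j $$ (a, b)"
        unfolding D(3)[OF j] by simp
    qed
    also have "\<dots> = 2 * (\<Sum>j\<in>{..<nUE S} - {i}. (wt S j *\<^sub>r D j) $$ (a, b))"
      unfolding sum_distrib_left
    proof (intro sum.cong refl)
      fix j assume j: "j \<in> {..<nUE S} - {i}"
      then have "a < dim_row (D j)" "b < dim_col (D j)"
        using ab D by simp_all
      then show "complex_of_real (2 * wt S j) * D j $$ (a, b) = 2 * (wt S j *\<^sub>r D j) $$ (a, b)"
        by simp
    qed
    also have "complex_of_real (- 2 * wt S i) * A $$ (a, b) = - 2 * (wt S i *\<^sub>r A) $$ (a, b)"
      using ab A by simp
    finally show "block S i (wsr_grad S P ! i) n $$ (a, b) =
      ((- 2) *\<^sub>r (wt S i *\<^sub>r A - msum (nTx S) (nStr S i) (\<lambda>j. wt S j *\<^sub>r D j) ({..<nUE S} - {i}))) $$ (a, b)"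
      using ab A(1,2) D(1,2) by (simp add: sum_distrib_left right_diff_distrib sum_negf)
  qed (simp_all add: block_def)
  then show ?thesis
    by (simp only: A_def D_def)
qed

end

section \<open>The Riemannian gradient\<close>

text \<open>Coordinates of the whole space as triples (user, row, column). In this form they can be
  regrouped by base station, across users.\<close>

definition entries :: "network \<Rightarrow> (nat \<times> nat \<times> nat) set"
  where "entries S = (SIGMA i:{..<nUE S}. {..<nserv S i * nTx S} \<times> {..<nStr S i})"

definition ent :: "complex mat list \<Rightarrow> nat \<times> nat \<times> nat \<Rightarrow> complex"
  where "ent X = (\<lambda>(i, a, b). X ! i $$ (a, b))"

definition of_ent :: "network \<Rightarrow> (nat \<times> nat \<times> nat \<Rightarrow> complex) \<Rightarrow> complex mat list"
  where "of_ent S h = map (\<lambda>i. mat (nserv S i * nTx S) (nStr S i) (\<lambda>(a, b). h (i, a, b))) [0..<nUE S]"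

text \<open>Row \<open>a\<close> of a precoder lies in block \<open>a div nTx S\<close>. Each
  coordinate has exactly one station, so the power constraints concern disjoint sets of
  coordinates.\<close>

definition station :: "network \<Rightarrow> nat \<times> nat \<times> nat \<Rightarrow> nat"
  where "station S = (\<lambda>(i, a, b). bss S i ! (a div nTx S))"

lemma finite_entries [simp]: "finite (entries S)"
  by (simp add: entries_def)

lemma sum_entries:
  "(\<Sum>x\<in>entries S. h x) = (\<Sum>i<nUE S. \<Sum>a<nserv S i * nTx S. \<Sum>b<nStr S i. h (i, a, b))"
proof -
  have "(\<Sum>i<nUE S. \<Sum>p\<in>{..<nserv S i * nTx S} \<times> {..<nStr S i}. h (i, p)) =
      (\<Sum>(i, p)\<in>entries S. h (i, p))"
    unfolding entries_def by (rule sum.Sigma) auto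
  then show ?thesis
    by (simp add: sum.cartesian_product split_def)
qed

lemma of_ent_Nn [simp]: "of_ent S h \<in> Nn S"
  by (auto simp: of_ent_def Nn_def Ni_def)

lemma ent_of_ent [simp]: "x \<in> entries S \<Longrightarrow> ent (of_ent S h) x = h x"
  by (auto simp: ent_def of_ent_def entries_def)

lemma Nn_eqI:
  assumes "X \<in> Nn S" "Y \<in> Nn S" "\<And>x. x \<in> entries S \<Longrightarrow> ent X x = ent Y x"
  shows "X = Y"
proof (rule nth_equalityI)
  show "length X = length Y"
    using assms(1,2) by (simp add: Nn_length)
  fix i assume "i < length X"
  then have i: "i < nUE S"
    using assms(1) by (simp add: Nn_length)
  show "X ! i = Y ! i"
  proof (rule eq_matI)
    fix a b assume "a < dim_row (Y ! i)" "b < dim_col (Y ! i)"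
    then have "(i, a, b) \<in> entries S"
      using Nn_nth[OF assms(2) i] i by (auto simp: entries_def)
    from assms(3)[OF this] show "X ! i $$ (a, b) = Y ! i $$ (a, b)"
      by (simp add: ent_def)
  qed (use Nn_nth[OF assms(1) i] Nn_nth[OF assms(2) i] in auto)
qed

lemma ipN_entries:
  assumes "X \<in> Nn S" "Y \<in> Nn S"
  shows "ipN S X Y = (\<Sum>x\<in>entries S. Re (cnj (ent Y x) * ent X x))"
  unfolding ipN_def sum_entries
proof (intro sum.cong refl)
  fix i assume "i \<in> {..<nUE S}"
  then have i: "i < nUE S" by simp
  show "mat_ip (X ! i) (Y ! i) = (\<Sum>a<nserv S i * nTx S. \<Sum>b<nStr S i.
      Re (cnj (ent Y (i, a, b)) * ent X (i, a, b)))"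
    unfolding mat_ip_entries[OF Nn_nth[OF assms(1) i] Nn_nth[OF assms(2) i]] by (simp add: ent_def)
qed

text \<open>The part of the metric on the coordinates of station \<open>k\<close>;
  \<open>ip_bs S k P P\<close> is the power that this station transmits.\<close>

definition ip_bs :: "network \<Rightarrow> nat \<Rightarrow> complex mat list \<Rightarrow> complex mat list \<Rightarrow> real"
  where "ip_bs S k X Y = (\<Sum>x\<in>{x \<in> entries S. station S x = k}. Re (cnj (ent Y x) * ent X x))"

lemma Re_cnj_mult_commute: "Re (cnj z * w) = Re (cnj w * z)"
  by simp

lemma ip_bs_commute: "ip_bs S k X Y = ip_bs S k Y X"
  unfolding ip_bs_def by (intro sum.cong refl Re_cnj_mult_commute)

lemma Re_cnj_self: "Re (cnj z * z) = (cmod z)\<^sup>2"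
  unfolding cmod_power2 by (simp add: power2_eq_square)

lemma station_less:
  assumes "valid_network S" "x \<in> entries S"
  shows "station S x < nBS S"
  using assms by (auto simp: station_def entries_def intro!: bss_less less_mult_imp_div_less)

lemma ipN_ip_bs:
  assumes "valid_network S" "X \<in> Nn S" "Y \<in> Nn S"
  shows "ipN S X Y = (\<Sum>k<nBS S. ip_bs S k X Y)"
  unfolding ipN_entries[OF assms(2,3)] ip_bs_def
  using station_less[OF assms(1)] by (subst sum.group) auto

section \<open>The power constraints as equations of spheres\<close>

lemma Qm_carrier [simp]: "Qm S k \<in> carrier_mat (nBS S * nTx S) (nBS S * nTx S)"
  by (simp add: Qm_def block_matrix_def)

lemma Qm_dim [simp]: "dim_row (Qm S k) = nBS S * nTx S" "dim_col (Qm S k) = nBS S * nTx S"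
  by (simp_all add: Qm_def block_matrix_def)

lemma Qm_index:
  assumes "r < nBS S * nTx S" "c < nBS S * nTx S"
  shows "Qm S k $$ (r, c) = (if r = c \<and> r div nTx S = k then 1 else 0)"
proof -
  have t: "nTx S > 0"
    using assms(1) by (rule less_mult_pos)
  have "r = c \<longleftrightarrow> r div nTx S = c div nTx S \<and> r mod nTx S = c mod nTx S"
    by (metis div_mult_mod_eq)
  then show ?thesis
    using assms t by (auto simp: Qm_def block_matrix_def)
qed

text \<open>The serving stations of a user are distinct, so different columns of
  \<open>Wm S i\<close> have their 1 in different rows.\<close>

lemma bs_row_inj:
  assumes "valid_network S" "i < nUE S" "a < nserv S i * nTx S" "b < nserv S i * nTx S"
  shows "bs_row S i a = bs_row S i b \<longleftrightarrow> a = b"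
proof
  assume eq: "bs_row S i a = bs_row S i b"
  note dm = bs_row_div_mod[OF less_mult_pos[OF assms(3)], of i]
  have "bss S i ! (a div nTx S) = bss S i ! (b div nTx S)" "a mod nTx S = b mod nTx S"
    using dm(1)[of a] dm(1)[of b] dm(2)[of a] dm(2)[of b] eq by simp_all
  moreover have "distinct (bss S i)"
    using assms(1,2) by (simp add: valid_network_def)
  ultimately have "a div nTx S = b div nTx S" "a mod nTx S = b mod nTx S"
    using assms(3,4) by (auto simp: nth_eq_iff_index_eq less_mult_imp_div_less)
  then show "a = b"
    by (metis div_mult_mod_eq)
qed simp

text \<open>The matrix \<open>W_i^H Q_k W_i\<close> is diagonal with entries 0 and 1: it keeps
  exactly the rows of the block transmitted by station \<open>k\<close>.\<close>

lemma station_projection: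
  assumes valid: "valid_network S" and i: "i < nUE S" and X: "X \<in> carrier_mat (nserv S i * nTx S) d"
  shows "(Wm S i)\<^sup>H * Qm S k * Wm S i * X =
    mat (nserv S i * nTx S) d (\<lambda>(a, b). if bss S i ! (a div nTx S) = k then X $$ (a, b) else 0)"
proof -
  let ?n = "nserv S i * nTx S" and ?m = "nBS S * nTx S"
  let ?E = "(Wm S i)\<^sup>H * Qm S k * Wm S i"
  have E: "?E $$ (a, c) = (if a = c \<and> bss S i ! (a div nTx S) = k then 1 else 0)" if ac: "a < ?n" "c < ?n" for a c
  proof -
    note r = bs_row_less[OF valid i ac(1)] bs_row_less[OF valid i ac(2)]
    have "?E $$ (a, c) = ((Wm S i)\<^sup>H * Qm S k) $$ (a, bs_row S i c)"
      using valid i ac by (intro mult_Wm_index[of S i _ ?n] mult_carrier_mat[of _ _ ?m]) auto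
    \<comment> \<open>Column selection is available for right factors \<open>Wm S i\<close> only;
      taking the adjoint brings the left factor \<open>(Wm S i)\<^sup>H\<close> into that
      position.\<close>
    also have "\<dots> = ((Qm S k)\<^sup>H * Wm S i)\<^sup>H $$ (a, bs_row S i c)"
      by (simp add: herm_mult)
    also have "\<dots> = cnj (((Qm S k)\<^sup>H * Wm S i) $$ (bs_row S i c, a))"
      using ac r by (intro index_herm) auto
    also have "((Qm S k)\<^sup>H * Wm S i) $$ (bs_row S i c, a) = (Qm S k)\<^sup>H $$ (bs_row S i c, bs_row S i a)"
      using valid i ac r by (intro mult_Wm_index[of S i _ ?m]) auto
    also have "cnj \<dots> = Qm S k $$ (bs_row S i a, bs_row S i c)"
      using r by simp
    also have "\<dots> = (if a = c \<and> bss S i ! (a div nTx S) = k then 1 else 0)"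
      using r by (simp add: Qm_index bs_row_inj[OF valid i ac] bs_row_div_mod less_mult_pos[OF ac(1)])
    finally show ?thesis .
  qed
  have dE: "dim_row ?E = ?n" "dim_col ?E = ?n"
    by simp_all
  show ?thesis
  proof (rule eq_matI)
    fix a b
    assume "a < dim_row (mat ?n d (\<lambda>(a, b). if bss S i ! (a div nTx S) = k then X $$ (a, b) else 0))"
      "b < dim_col (mat ?n d (\<lambda>(a, b). if bss S i ! (a div nTx S) = k then X $$ (a, b) else 0))"
    then have ab: "a < ?n" "b < d" by auto
    have "(?E * X) $$ (a, b) = row ?E a \<bullet> col X b"
      using ab X by (intro index_mult_mat(1)) (simp, auto)
    also have "\<dots> = (\<Sum>c\<in>{0..<?n}. ?E $$ (a, c) * X $$ (c, b))"
    proof -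
      have "row ?E a $ c * col X b $ c = ?E $$ (a, c) * X $$ (c, b)" if "c < ?n" for c
        using that ab X dE by (subst index_row(1)) (auto simp del: index_mult_mat(1))
      moreover have "dim_vec (col X b) = ?n"
        using X by simp
      ultimately show ?thesis
        unfolding scalar_prod_def by (intro sum.cong) auto
    qed
    also have "\<dots> = (\<Sum>c\<in>{0..<?n}. if c = a then (if bss S i ! (a div nTx S) = k then X $$ (a, b) else 0) else 0)"
      using ab by (intro sum.cong refl) (simp only: E atLeastLessThan_iff, simp)
    also have "\<dots> = (if bss S i ! (a div nTx S) = k then X $$ (a, b) else 0)"
      using ab by simp
    finally show "(?E * X) $$ (a, b) =
        mat ?n d (\<lambda>(a, b). if bss S i ! (a div nTx S) = k then X $$ (a, b) else 0) $$ (a, b)"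
      using ab by simp
  qed (use X in auto)
qed

text \<open>The projection reduces each trace to the entries at station \<open>k\<close>. It serves
  twice: \<open>X = P\<close> gives the constraint, and \<open>X\<close> the Euclidean gradient
  gives the numerator of \<open>lambda_k\<close>.\<close>

lemma sum_served_trace:
  assumes valid: "valid_network S" and P: "P \<in> Nn S" and X: "X \<in> Nn S"
  shows "(\<Sum>i\<in>served S k. tr ((P ! i)\<^sup>H * (Wm S i)\<^sup>H * Qm S k * Wm S i * X ! i)) =
    (\<Sum>x\<in>{x \<in> entries S. station S x = k}. cnj (ent P x) * ent X x)"
proof -
  let ?h = "\<lambda>x. if station S x = k then cnj (ent P x) * ent X x else 0"
  have "(\<Sum>i\<in>served S k. tr ((P ! i)\<^sup>H * (Wm S i)\<^sup>H * Qm S k * Wm S i * X ! i)) =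
     (\<Sum>i\<in>served S k. \<Sum>a<nserv S i * nTx S. \<Sum>b<nStr S i. ?h (i, a, b))"
  proof (intro sum.cong refl)
    fix i assume "i \<in> served S k"
    then have i: "i < nUE S" by (simp add: served_def)
    note Pi = Nn_nth[OF P i] and Xi = Nn_nth[OF X i]
    have "(P ! i)\<^sup>H * (Wm S i)\<^sup>H * Qm S k * Wm S i * X ! i =
        (P ! i)\<^sup>H * ((Wm S i)\<^sup>H * Qm S k * Wm S i * X ! i)"
      using Pi Xi by (simp add: mult_mat_assoc del: assoc_mult_mat)
    also have "tr \<dots> = (\<Sum>a<nserv S i * nTx S. \<Sum>b<nStr S i. ?h (i, a, b))"
      unfolding station_projection[OF valid i Xi]
      using Pi by (subst tr_herm_mult[of _ "nserv S i * nTx S" "nStr S i"])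
        (auto intro!: sum.cong simp: station_def ent_def)
    finally show "tr ((P ! i)\<^sup>H * (Wm S i)\<^sup>H * Qm S k * Wm S i * X ! i) =
        (\<Sum>a<nserv S i * nTx S. \<Sum>b<nStr S i. ?h (i, a, b))" .
  qed
  \<comment> \<open>A user outside \<open>served S k\<close> has no entry at station
    \<open>k\<close>, so its summand vanishes.\<close>
  also have "\<dots> = (\<Sum>i<nUE S. \<Sum>a<nserv S i * nTx S. \<Sum>b<nStr S i. ?h (i, a, b))"
  proof (rule sum.mono_neutral_left)
    show "\<forall>i\<in>{..<nUE S} - served S k. (\<Sum>a<nserv S i * nTx S. \<Sum>b<nStr S i. ?h (i, a, b)) = 0"
    proof
      fix i assume i: "i \<in> {..<nUE S} - served S k"
      have "station S (i, a, b) \<noteq> k" if "a < nserv S i * nTx S" for a b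
      proof -
        have "bss S i ! (a div nTx S) \<in> set (bss S i)"
          using that by (intro nth_mem less_mult_imp_div_less)
        then show ?thesis
          using i by (auto simp: served_def station_def)
      qed
      then show "(\<Sum>a<nserv S i * nTx S. \<Sum>b<nStr S i. ?h (i, a, b)) = 0"
        by (intro sum.neutral ballI) auto
    qed
  qed (auto simp: served_def)
  also have "\<dots> = (\<Sum>x\<in>entries S. ?h x)"
    by (rule sum_entries[symmetric])
  also have "\<dots> = (\<Sum>x\<in>{x \<in> entries S. station S x = k}. cnj (ent P x) * ent X x)"
    by (simp add: sum.inter_filter)
  finally show ?thesis .
qed

text \<open>The complex constraint is an equation between reals, because its left side is a sum of
  squared moduli. The manifold is cut out by one sphere equation for each group of
  coordinates.\<close>

lemma Mm_iff:
  assumes valid: "valid_network S"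
  shows "P \<in> Mm S \<longleftrightarrow> P \<in> Nn S \<and> (\<forall>k<nBS S. ip_bs S k P P = pwr S k)"
proof -
  have "(\<Sum>x\<in>{x \<in> entries S. station S x = k}. cnj (ent P x) * ent P x) = complex_of_real (ip_bs S k P P)" for k
    unfolding ip_bs_def of_real_sum
    by (intro sum.cong refl) (simp only: Re_cnj_self, simp only: complex_norm_square mult.commute)
  then show ?thesis
    by (auto simp: Mm_def sum_served_trace[OF valid])
qed

section \<open>Tangent vectors of the product of spheres\<close>

lemma smooth_curve_entries:
  assumes "smooth_curve S A P X c" "x \<in> entries S"
  shows "((\<lambda>t. ent (c t) x) has_vector_derivative ent X x) (at 0)"
  using assms by (auto simp: smooth_curve_def entries_def ent_def)

lemma DERIV_Re_cnj_mult:
  assumes "(u has_vector_derivative u') (at t)" "(v has_vector_derivative v') (at t)"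
  shows "((\<lambda>t. Re (cnj (u t) * v t)) has_real_derivative Re (cnj u' * v t) + Re (cnj (u t) * v')) (at t)"
proof -
  have "((\<lambda>t. cnj (u t)) has_vector_derivative cnj u') (at t)"
    by (rule bounded_linear.has_vector_derivative[OF bounded_linear_cnj assms(1)])
  from bounded_bilinear.has_vector_derivative[OF bounded_bilinear_mult this assms(2)]
  have "((\<lambda>t. cnj (u t) * v t) has_vector_derivative cnj (u t) * v' + cnj u' * v t) (at t)" .
  from bounded_linear.has_vector_derivative[OF bounded_linear_Re this]
  show ?thesis
    by (simp add: has_real_derivative_iff_has_vector_derivative algebra_simps)
qed

text \<open>Along the curve the power of station \<open>k\<close> is constant, and its derivative at
  0 is twice the inner product of velocity and position.\<close>

lemma tangent_orthogonal:
  assumes valid: "valid_network S" and c: "smooth_curve S (Mm S) P X c" and k: "k < nBS S"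
  shows "ip_bs S k X P = 0"
proof -
  obtain e where e: "e > 0" "\<And>t. t \<in> {-e<..<e} \<Longrightarrow> c t \<in> Mm S"
    using c unfolding smooth_curve_def by blast
  have c0: "c 0 = P"
    using c by (simp add: smooth_curve_def)
  have "((\<lambda>t. ip_bs S k (c t) (c t)) has_real_derivative
      (\<Sum>x\<in>{x \<in> entries S. station S x = k}. Re (cnj (ent X x) * ent (c 0) x) + Re (cnj (ent (c 0) x) * ent X x))) (at 0)"
    unfolding ip_bs_def
    by (intro DERIV_sum DERIV_Re_cnj_mult smooth_curve_entries[OF c]) auto
  moreover have "ip_bs S k (c t) (c t) = pwr S k" if "\<bar>0 - t\<bar> < e" for t
    using e(2)[of t] that k by (auto simp: Mm_iff[OF valid] abs_less_iff)
  then have "\<forall>t. \<bar>0 - t\<bar> < e \<longrightarrow> ip_bs S k (c 0) (c 0) = ip_bs S k (c t) (c t)"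
    using e(1) by simp
  ultimately have "(\<Sum>x\<in>{x \<in> entries S. station S x = k}.
      Re (cnj (ent X x) * ent (c 0) x) + Re (cnj (ent (c 0) x) * ent X x)) = 0"
    using e(1) by (intro DERIV_local_const)
  then have "ip_bs S k P X + ip_bs S k X P = 0"
    by (simp only: sum.distrib ip_bs_def c0)
  then show ?thesis
    by (simp add: ip_bs_commute[of S k P X])
qed

text \<open>All derivatives of \<open>t \<mapsto> cos(\<omega>t) p + sin(\<omega>t) y\<close> have this form.\<close>

definition rotation :: "real \<Rightarrow> complex \<Rightarrow> complex \<Rightarrow> nat \<Rightarrow> real \<Rightarrow> complex"
  where "rotation \<omega> p y n t = complex_of_real (\<omega> ^ n * cos (\<omega> * t + of_nat n * (pi / 2))) * p +
    complex_of_real (\<omega> ^ n * sin (\<omega> * t + of_nat n * (pi / 2))) * y"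

lemma has_vector_derivative_of_real_mult:
  assumes "(h has_real_derivative h') (at t)"
  shows "((\<lambda>t. complex_of_real (h t) * p) has_vector_derivative complex_of_real h' * p) (at t)"
proof -
  have "bounded_linear (\<lambda>s. complex_of_real s * p)"
    by (intro bounded_linear_compose[OF bounded_linear_mult_left bounded_linear_of_real])
  from bounded_linear.has_vector_derivative[OF this]
  show ?thesis
    using assms by (simp add: has_real_derivative_iff_has_vector_derivative)
qed

lemma rotation_derivative:
  "(rotation \<omega> p y n has_vector_derivative rotation \<omega> p y (Suc n) t) (at t)"
proof -
  \<comment> \<open>Differentiation of sine and cosine is a phase shift by a quarter period, which
    is what raising the index by one adds.\<close>
  have shift: "\<omega> * t + of_nat (Suc n) * (pi / 2) = (\<omega> * t + of_nat n * (pi / 2)) + pi / 2"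
    by (simp add: algebra_simps)
  have c: "cos (\<omega> * t + of_nat (Suc n) * (pi / 2)) = - sin (\<omega> * t + of_nat n * (pi / 2))"
    and s: "sin (\<omega> * t + of_nat (Suc n) * (pi / 2)) = cos (\<omega> * t + of_nat n * (pi / 2))"
    unfolding shift by (simp_all add: cos_add sin_add)
  have "((\<lambda>t. \<omega> ^ n * cos (\<omega> * t + of_nat n * (pi / 2))) has_real_derivative
      \<omega> ^ Suc n * cos (\<omega> * t + of_nat (Suc n) * (pi / 2))) (at t)"
    unfolding c by (auto intro!: derivative_eq_intros)
  moreover have "((\<lambda>t. \<omega> ^ n * sin (\<omega> * t + of_nat n * (pi / 2))) has_real_derivative
      \<omega> ^ Suc n * sin (\<omega> * t + of_nat (Suc n) * (pi / 2))) (at t)"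
    unfolding s by (auto intro!: derivative_eq_intros)
  ultimately show ?thesis
    unfolding rotation_def
    by (intro has_vector_derivative_add has_vector_derivative_of_real_mult)
qed

text \<open>The curve rotates every \<open>P\<^sub>k\<close>-sphere of the product manifold at the speed prescribed by \<open>X\<close>; for a
  component of speed zero the division by zero yields the constant curve, as desired.\<close>

lemma orthogonal_tangent:
  assumes valid: "valid_network S" and P: "P \<in> Mm S" and X: "X \<in> Nn S"
    and orth: "\<And>k. k < nBS S \<Longrightarrow> ip_bs S k X P = 0"
  shows "X \<in> tangent_space S (Mm S) P"
proof -
  have PN: "P \<in> Nn S" and Pk: "\<And>k. k < nBS S \<Longrightarrow> ip_bs S k P P = pwr S k"
    using P by (auto simp: Mm_iff[OF valid])
  have pos: "pwr S k > 0" if "k < nBS S" for k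
    using valid that by (simp add: valid_network_def)
  have nonneg: "0 \<le> ip_bs S k X X" for k
    unfolding ip_bs_def Re_cnj_self by (intro sum_nonneg) simp
  \<comment> \<open>Angular speed at the station of \<open>x\<close>: norm of the component of
    \<open>X\<close> divided by the radius \<open>sqrt (pwr S k)\<close>. For nonzero speed,
    \<open>Y\<close> is then orthogonal to \<open>P\<close> on the sphere and has the same
    radius.\<close>
  define \<omega> where "\<omega> x = sqrt (ip_bs S (station S x) X X / pwr S (station S x))" for x
  define Y where "Y x = ent X x / complex_of_real (\<omega> x)" for x
  define w where "w k = sqrt (ip_bs S k X X / pwr S k)" for k
  have Y: "complex_of_real (\<omega> x) * Y x = ent X x" if x: "x \<in> entries S" for x
  proof (cases "\<omega> x = 0")
    case True
    let ?k = "station S x"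
    \<comment> \<open>Speed zero means that the whole component of \<open>X\<close> at this station
      vanishes, so the default value of the division does no harm.\<close>
    have "ip_bs S ?k X X = 0"
      using True pos[OF station_less[OF valid x]] by (simp add: \<omega>_def)
    then have "(\<Sum>x\<in>{x \<in> entries S. station S x = ?k}. (cmod (ent X x))\<^sup>2) = 0"
      unfolding ip_bs_def Re_cnj_self .
    then have "\<forall>x\<in>{x \<in> entries S. station S x = ?k}. (cmod (ent X x))\<^sup>2 = 0"
      by (subst (asm) sum_nonneg_eq_0_iff) (simp_all del: mem_Collect_eq)
    then have "(cmod (ent X x))\<^sup>2 = 0"
      using x by blast
    then show ?thesis
      using True by simp
  qed (simp add: Y_def)
  define c where "c t = of_ent S (\<lambda>x. rotation (\<omega> x) (ent P x) (Y x) 0 t)" for t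
  have ent_c: "ent (c t) x = rotation (\<omega> x) (ent P x) (Y x) 0 t" if "x \<in> entries S" for t x
    using that by (simp add: c_def)
  have "c 0 = P"
    by (rule Nn_eqI[OF _ PN]) (simp_all add: c_def rotation_def)
  moreover have "c t \<in> Mm S" for t
    unfolding Mm_iff[OF valid]
  proof (intro conjI allI impI)
    show "c t \<in> Nn S" by (simp add: c_def)
    fix k assume k: "k < nBS S"
    let ?I = "{x \<in> entries S. station S x = k}"
    let ?C = "cos (w k * t)" and ?S = "sin (w k * t)"
    have wx: "\<omega> x = w k" if "x \<in> ?I" for x
      using that by (simp add: \<omega>_def w_def)
    have PY: "(\<Sum>x\<in>?I. Re (cnj (ent P x) * Y x)) = 0"
    proof -
      have "(\<Sum>x\<in>?I. Re (cnj (ent P x) * Y x)) = (\<Sum>x\<in>?I. Re (cnj (ent P x) * ent X x) / w k)"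
        by (intro sum.cong refl) (simp add: Y_def wx add_divide_distrib)
      also have "\<dots> = ip_bs S k X P / w k"
        by (simp only: ip_bs_def sum_divide_distrib)
      finally show ?thesis
        using orth[OF k] by simp
    qed
    \<comment> \<open>The factor \<open>?S\<^sup>2\<close> is kept so that the claim also holds at
      speed zero, where \<open>Y\<close> is 0 instead of a vector of the right length but the sine
      vanishes.\<close>
    have YY: "?S\<^sup>2 * (\<Sum>x\<in>?I. (cmod (Y x))\<^sup>2) = ?S\<^sup>2 * pwr S k"
    proof (cases "w k = 0")
      case False
      have "(\<Sum>x\<in>?I. (cmod (Y x))\<^sup>2) = (\<Sum>x\<in>?I. (cmod (ent X x))\<^sup>2 / (w k)\<^sup>2)"
        by (intro sum.cong refl) (simp add: Y_def wx norm_divide power_divide)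
      also have "\<dots> = ip_bs S k X X / (w k)\<^sup>2"
        by (simp only: ip_bs_def Re_cnj_self sum_divide_distrib)
      also have "(w k)\<^sup>2 = ip_bs S k X X / pwr S k"
        using nonneg[of k] pos[OF k] by (simp add: w_def)
      also have "ip_bs S k X X / (ip_bs S k X X / pwr S k) = pwr S k"
        using False by (auto simp: w_def)
      finally show ?thesis by simp
    qed simp
    have "ip_bs S k (c t) (c t) = (\<Sum>x\<in>?I. ?C\<^sup>2 * (cmod (ent P x))\<^sup>2 + 2 * ?C * ?S * Re (cnj (ent P x) * Y x) +
        ?S\<^sup>2 * (cmod (Y x))\<^sup>2)"
      unfolding ip_bs_def
    proof (intro sum.cong refl)
      fix x assume x: "x \<in> ?I"
      then have "ent (c t) x = complex_of_real ?C * ent P x + complex_of_real ?S * Y x"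
        by (simp add: ent_c rotation_def wx)
      then show "Re (cnj (ent (c t) x) * ent (c t) x) =
        ?C\<^sup>2 * (cmod (ent P x))\<^sup>2 + 2 * ?C * ?S * Re (cnj (ent P x) * Y x) + ?S\<^sup>2 * (cmod (Y x))\<^sup>2"
        by (simp only: cmod_power2) (simp add: power2_eq_square algebra_simps)
    qed
    also have "\<dots> = ?C\<^sup>2 * ip_bs S k P P + 2 * ?C * ?S * (\<Sum>x\<in>?I. Re (cnj (ent P x) * Y x)) +
        ?S\<^sup>2 * (\<Sum>x\<in>?I. (cmod (Y x))\<^sup>2)"
      unfolding ip_bs_def Re_cnj_self by (simp only: sum.distrib sum_distrib_left)
    also have "\<dots> = (?C\<^sup>2 + ?S\<^sup>2) * pwr S k"
      unfolding PY YY Pk[OF k] by (simp only: distrib_right mult_zero_right add_0_right)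
    finally show "ip_bs S k (c t) (c t) = pwr S k"
      by (simp only: sin_cos_squared_add2 mult_1)
  qed
  \<comment> \<open>The curve exists for all times, so the radius 1 is an arbitrary choice; the
    derivative of order \<open>n\<close> is \<open>rotation\<close> with index
    \<open>n\<close>.\<close>
  moreover have "smooth_on_interval 1 (\<lambda>t. ent (c t) x)" if "x \<in> entries S" for x
    unfolding smooth_on_interval_def
    by (intro exI[of _ "rotation (\<omega> x) (ent P x) (Y x)"]) (simp add: ent_c[OF that] rotation_derivative)
  moreover have "((\<lambda>t. ent (c t) x) has_vector_derivative ent X x) (at 0)" if "x \<in> entries S" for x
  proof -
    have "rotation (\<omega> x) (ent P x) (Y x) (Suc 0) 0 = ent X x"
      using Y[OF that] by (simp add: rotation_def)
    then show ?thesis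
      using rotation_derivative[of "\<omega> x" "ent P x" "Y x" 0 0] by (simp add: ent_c[OF that])
  qed
  ultimately have "smooth_curve S (Mm S) P X c"
    unfolding smooth_curve_def using X
    by (intro conjI exI[of _ 1]) (auto simp: entries_def ent_def)
  then show ?thesis
    unfolding tangent_space_def by blast
qed

text \<open>This links the two notions of differential, by norm estimates on the linear space and
  along curves on the submanifold. With \<open>c t - P\<close> as increment, the linear part has
  derivative \<open>ipN S G X\<close>; the remainder is \<open>o(t)\<close>, because the increment
  has norm at most \<open>K * \<bar>t\<bar>\<close>.\<close>

lemma gradient_chain_rule:
  assumes G: "is_grad_N S f P G" and P: "P \<in> Nn S" and sub: "A \<subseteq> Nn S" and c: "smooth_curve S A P X c"
  shows "((\<lambda>t. f (c t)) has_real_derivative ipN S G X) (at 0)"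
proof -
  \<comment> \<open>Built from entries so that it lies in \<open>Nn S\<close> for all
    \<open>t\<close>, also where nothing is known about \<open>c t\<close>.\<close>
  define \<xi> where "\<xi> t = of_ent S (\<lambda>x. ent (c t) x - ent P x)" for t
  have c0: "c 0 = P" and XN: "X \<in> Nn S"
    using c by (simp_all add: smooth_curve_def)
  have GN: "G \<in> Nn S"
    using G by (simp add: is_grad_N_def is_gradient_def)
  obtain e where e: "e > 0" "\<And>t. t \<in> {-e<..<e} \<Longrightarrow> c t \<in> A"
    using c unfolding smooth_curve_def by blast
  have xi: "\<xi> t \<in> Nn S" for t
    by (simp add: \<xi>_def)
  have add: "map2 (+) P (\<xi> t) = c t" if "\<bar>t\<bar> < e" for t
  proof (rule Nn_eqI[OF map2_add_Nn[OF P xi]])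
    show "c t \<in> Nn S"
      using e(2)[of t] that sub by (auto simp: abs_less_iff)
    fix x assume x: "x \<in> entries S"
    then obtain i a b where x': "x = (i, a, b)" and i: "i < nUE S" "a < nserv S i * nTx S" "b < nStr S i"
      by (auto simp: entries_def)
    have "ent (map2 (+) P (\<xi> t)) x = ent P x + ent (\<xi> t) x"
      using i Nn_nth[OF xi i(1), of t] by (simp add: x' ent_def map2_add_nth[OF P xi])
    also have "\<dots> = ent (c t) x"
      using x by (simp add: \<xi>_def)
    finally show "ent (map2 (+) P (\<xi> t)) x = ent (c t) x" .
  qed
  have lin: "((\<lambda>t. ipN S G (\<xi> t)) has_real_derivative ipN S G X) (at 0)"
  proof -
    have "((\<lambda>t. \<Sum>x\<in>entries S. Re (cnj (ent (c t) x - ent P x) * ent G x)) has_real_derivative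
        (\<Sum>x\<in>entries S. Re (cnj (ent X x - 0) * ent G x) + Re (cnj (ent (c 0) x - ent P x) * 0))) (at 0)"
      by (intro DERIV_sum DERIV_Re_cnj_mult has_vector_derivative_diff smooth_curve_entries[OF c]
          has_vector_derivative_const)
    moreover have "(\<Sum>x\<in>entries S. Re (cnj (ent (c t) x - ent P x) * ent G x)) = ipN S G (\<xi> t)" for t
      unfolding ipN_entries[OF GN xi] by (intro sum.cong refl) (simp add: \<xi>_def)
    moreover have "(\<Sum>x\<in>entries S. Re (cnj (ent X x - 0) * ent G x) + Re (cnj (ent (c 0) x - ent P x) * 0)) = ipN S G X"
      by (simp add: ipN_entries[OF GN XN])
    ultimately show ?thesis
      by simp
  qed
  \<comment> \<open>A coordinate moves by at most its speed times \<open>\<bar>t\<bar>\<close> plus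
    an error that is eventually below \<open>\<bar>t\<bar>\<close>; the 1 accounts for the
    error.\<close>
  define C where "C x = cmod (ent X x) + 1" for x
  \<comment> \<open>The added 1 makes \<open>K\<close> positive, so that it can be divided
    by.\<close>
  define K where "K = sqrt (\<Sum>x\<in>entries S. (C x)\<^sup>2) + 1"
  have K: "K > 0"
    unfolding K_def by (intro add_nonneg_pos) (auto intro: sum_nonneg)
  have "\<forall>\<^sub>F t in at 0. cmod (ent (c t) x - ent P x) \<le> C x * \<bar>t\<bar>" if "x \<in> entries S" for x
  proof -
    have "((\<lambda>t. norm (ent (c t) x - ent (c 0) x - (t - 0) *\<^sub>R ent X x) / norm (t - 0)) \<longlongrightarrow> 0) (at 0)"
      using smooth_curve_entries[OF c that]
      unfolding has_vector_derivative_def has_derivative_iff_norm by simp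
    then have "\<forall>\<^sub>F t in at 0. norm (ent (c t) x - ent (c 0) x - (t - 0) *\<^sub>R ent X x) / norm (t - 0) < 1"
      by (rule order_tendstoD) simp
    moreover have "\<forall>\<^sub>F t in at 0. t \<noteq> (0 :: real)"
      by (simp add: eventually_at_filter)
    ultimately show ?thesis
    proof eventually_elim
      case (elim t)
      then have "norm (ent (c t) x - ent P x - t *\<^sub>R ent X x) \<le> \<bar>t\<bar>"
        by (simp add: c0 field_simps)
      moreover have "norm (ent (c t) x - ent P x) \<le> norm (ent (c t) x - ent P x - t *\<^sub>R ent X x) + norm (t *\<^sub>R ent X x)"
        by (metis diff_add_cancel norm_triangle_ineq)
      ultimately show ?case
        by (simp add: C_def algebra_simps)
    qed
  qed
  then have "\<forall>\<^sub>F t in at 0. \<forall>x\<in>entries S. cmod (ent (c t) x - ent P x) \<le> C x * \<bar>t\<bar>"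
    by (intro eventually_ball_finite) auto
  then have bound: "\<forall>\<^sub>F t in at 0. sqrt (ipN S (\<xi> t) (\<xi> t)) \<le> K * \<bar>t\<bar>"
  proof eventually_elim
    case (elim t)
    have "ipN S (\<xi> t) (\<xi> t) = (\<Sum>x\<in>entries S. (cmod (ent (c t) x - ent P x))\<^sup>2)"
      unfolding ipN_entries[OF xi xi] Re_cnj_self by (intro sum.cong refl) (simp add: \<xi>_def)
    also have "\<dots> \<le> (\<Sum>x\<in>entries S. (C x * \<bar>t\<bar>)\<^sup>2)"
      using elim by (intro sum_mono power_mono) auto
    also have "\<dots> = (\<Sum>x\<in>entries S. (C x)\<^sup>2) * t\<^sup>2"
      by (simp add: power_mult_distrib sum_distrib_right)
    finally have "sqrt (ipN S (\<xi> t) (\<xi> t)) \<le> sqrt ((\<Sum>x\<in>entries S. (C x)\<^sup>2) * t\<^sup>2)"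
      by (rule real_sqrt_le_mono)
    also have "\<dots> \<le> K * \<bar>t\<bar>"
      by (simp add: real_sqrt_mult K_def algebra_simps)
    finally show ?case .
  qed
  define h where "h t = f (c t) - f P - ipN S G (\<xi> t)" for t
  have h0: "h 0 = 0"
    unfolding h_def ipN_entries[OF GN xi] c0 by (simp add: \<xi>_def c0)
  have "(h has_real_derivative 0) (at 0)"
    unfolding has_field_derivative_iff
  proof (rule tendstoI)
    fix \<epsilon> :: real assume "\<epsilon> > 0"
    \<comment> \<open>The \<open>K\<close> cancels the bound on the increment, and the 2 leaves room
      for the strict inequality.\<close>
    then have "\<epsilon> / (2 * K) > 0"
      using K by simp
    then obtain \<delta> where d: "\<delta> > 0" "\<And>\<eta>. \<eta> \<in> Nn S \<Longrightarrow> sqrt (ipN S \<eta> \<eta>) < \<delta> \<Longrightarrow>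
        \<bar>f (map2 (+) P \<eta>) - f P - ipN S G \<eta>\<bar> \<le> \<epsilon> / (2 * K) * sqrt (ipN S \<eta> \<eta>)"
      using G unfolding is_grad_N_def is_gradient_def by metis
    \<comment> \<open>Below \<open>e\<close> the curve equals \<open>P\<close> plus the increment;
      below \<open>\<delta> / K\<close> the increment is short enough for the estimate.\<close>
    have "\<forall>\<^sub>F t in at 0. \<bar>t\<bar> < min e (\<delta> / K)"
      using e(1) d(1) K by (auto simp: eventually_at intro!: exI[of _ "min e (\<delta> / K)"])
    moreover have "\<forall>\<^sub>F t in at 0. t \<noteq> (0 :: real)"
      by (simp add: eventually_at_filter)
    ultimately show "\<forall>\<^sub>F t in at 0. dist ((h t - h 0) / (t - 0)) 0 < \<epsilon>"
      using bound
    proof eventually_elim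
      case (elim t)
      then have "K * \<bar>t\<bar> < \<delta>"
        using K by (simp add: field_simps)
      with elim have "sqrt (ipN S (\<xi> t) (\<xi> t)) < \<delta>"
        by linarith
      then have "\<bar>h t\<bar> \<le> \<epsilon> / (2 * K) * sqrt (ipN S (\<xi> t) (\<xi> t))"
        using d(2)[OF xi, of t] elim by (simp add: add h_def)
      also have "\<dots> \<le> \<epsilon> / (2 * K) * (K * \<bar>t\<bar>)"
        using elim \<open>\<epsilon> / (2 * K) > 0\<close> by (intro mult_left_mono) auto
      also have "\<dots> = \<epsilon> / 2 * \<bar>t\<bar>"
        using K by simp
      also have "\<dots> < \<epsilon> * \<bar>t\<bar>"
        using elim \<open>\<epsilon> > 0\<close> by simp
      finally show ?case
        using elim by (simp add: h0 dist_real_def field_simps)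
    qed
  qed
  from DERIV_add[OF DERIV_add[OF DERIV_const[of "f P"] lin] this]
  show ?thesis
    by (simp add: h_def)
qed

text \<open>The normal space at \<open>P\<close> is spanned by the components of \<open>P\<close> belonging to the single base stations,
  which are mutually orthogonal and of norm \<open>sqrt (pwr S k)\<close>.\<close>

lemma riemannian_gradient:
  assumes valid: "valid_network S" and P: "P \<in> Mm S" and G: "is_grad_N S f P G"
    and lam: "\<And>k. k < nBS S \<Longrightarrow> lam k = ip_bs S k G P / pwr S k"
    and R: "R \<in> Nn S" "\<And>x. x \<in> entries S \<Longrightarrow> ent R x = ent G x - complex_of_real (lam (station S x)) * ent P x"
  shows "\<exists>!R. is_riem_grad S (Mm S) f P R" "riem_grad S (Mm S) f P = R"
proof -
  have PN: "P \<in> Nn S" and Pk: "\<And>k. k < nBS S \<Longrightarrow> ip_bs S k P P = pwr S k"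
    using P by (auto simp: Mm_iff[OF valid])
  have pos: "pwr S k > 0" if "k < nBS S" for k
    using valid that by (simp add: valid_network_def)
  have GN: "G \<in> Nn S"
    using G by (simp add: is_grad_N_def is_gradient_def)
  have sub: "Mm S \<subseteq> Nn S"
    by (auto simp: Mm_def)
  \<comment> \<open>On the coordinates of station \<open>k\<close> the multiplier is the constant
    \<open>lam k\<close>. Taking \<open>X = P\<close> shows that \<open>R\<close> is orthogonal to
    every component of \<open>P\<close>; for tangent \<open>X\<close> the correction
    disappears.\<close>
  have RX: "ip_bs S k R X = ip_bs S k G X - lam k * ip_bs S k P X" for k X
    unfolding ip_bs_def sum_distrib_left sum_subtractf[symmetric]
    by (intro sum.cong refl) (auto simp: R(2) algebra_simps)
  have "R \<in> tangent_space S (Mm S) P"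
  proof (rule orthogonal_tangent[OF valid P R(1)])
    show "ip_bs S k R P = 0" if "k < nBS S" for k
      using pos[OF that] by (simp add: RX lam[OF that] Pk[OF that])
  qed
  moreover have "((\<lambda>t. f (c t)) has_real_derivative ipN S R X) (at 0)" if c: "smooth_curve S (Mm S) P X c" for X c
  proof -
    have X: "X \<in> Nn S"
      using c by (simp add: smooth_curve_def)
    have "ipN S R X = ipN S G X"
      unfolding ipN_ip_bs[OF valid R(1) X] ipN_ip_bs[OF valid GN X]
      using tangent_orthogonal[OF valid c]
      by (intro sum.cong refl) (simp add: RX ip_bs_commute[of S _ P X])
    then show ?thesis
      using gradient_chain_rule[OF G PN sub c] by simp
  qed
  ultimately have grad: "is_riem_grad S (Mm S) f P R"
    by (simp add: is_riem_grad_def)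
  \<comment> \<open>Both candidates are tangent vectors and hence admissible test directions.
    Testing on \<open>R\<close> and on \<open>R'\<close> makes the squared norm of
    \<open>R' - R\<close> zero.\<close>
  have unique: "R' = R" if R': "is_riem_grad S (Mm S) f P R'" for R'
  proof -
    obtain c c' where c: "smooth_curve S (Mm S) P R c" "smooth_curve S (Mm S) P R' c'"
      using grad R' by (auto simp: is_riem_grad_def tangent_space_def)
    have R'N: "R' \<in> Nn S"
      using c(2) by (simp add: smooth_curve_def)
    have "ipN S R R = ipN S R' R" "ipN S R R' = ipN S R' R'"
      using grad R' c unfolding is_riem_grad_def by (meson DERIV_unique)+
    then have "(\<Sum>x\<in>entries S. Re (cnj (ent R x) * ent R x) - Re (cnj (ent R x) * ent R' x) -
       (Re (cnj (ent R' x) * ent R x) - Re (cnj (ent R' x) * ent R' x))) = 0"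
      by (simp only: sum_subtractf ipN_entries[OF R(1) R(1)] ipN_entries[OF R'N R(1)]
          ipN_entries[OF R(1) R'N] ipN_entries[OF R'N R'N])
    moreover have "Re (cnj z * z) - Re (cnj z * z') - (Re (cnj z' * z) - Re (cnj z' * z')) = (cmod (z' - z))\<^sup>2" for z z'
      by (simp only: cmod_power2) (simp add: power2_eq_square algebra_simps)
    ultimately have "(\<Sum>x\<in>entries S. (cmod (ent R' x - ent R x))\<^sup>2) = 0"
      by (simp only:)
    then have "ent R' x = ent R x" if "x \<in> entries S" for x
      using that by (subst (asm) sum_nonneg_eq_0_iff) auto
    then show "R' = R"
      by (rule Nn_eqI[OF R'N R(1)])
  qed
  note ex1 = ex1_the[of "is_riem_grad S (Mm S) f P", OF grad unique]
  show "\<exists>!R. is_riem_grad S (Mm S) f P R" "riem_grad S (Mm S) f P = R"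
    using ex1 by (simp_all add: riem_grad_def)
qed

theorem theorem2:
  fixes S :: network and P :: "complex mat list"
  assumes "valid_network S"
    and "P \<in> Nn S"
  shows
    "((\<exists>!G. is_grad_N S (neg_wsr S) P G) \<and>
      grad_N S (neg_wsr S) P = map (\<lambda>i. grad_Ni S (neg_wsr S) P i) [0..<nUE S]) \<and>
     (\<forall>i<nUE S.
       (\<exists>!G. is_grad_Ni S (neg_wsr S) P i G) \<and>
       grad_Ni S (neg_wsr S) P i = stack S i (\<lambda>n. grad_Nik S (neg_wsr S) P i n)) \<and>
     (\<forall>i<nUE S. \<forall>n<nserv S i.
       (\<exists>!G. is_grad_Nik S (neg_wsr S) P i n G) \<and>
       (let k = bss S i ! n in
        grad_Nik S (neg_wsr S) P i n =
          (-2) *\<^sub>r (wt S i *\<^sub>r ((chan S i k)\<^sup>H * minv (Rm S P i) * Hm S i * Wm S i * P ! i * Cm S P i)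
            - msum (nTx S) (nStr S i)
                (\<lambda>j. wt S j *\<^sub>r ((chan S j k)\<^sup>H * minv (Rm S P j) * Hm S j * Wm S j * P ! j * Cm S P j
                   * (P ! j)\<^sup>H * (Wm S j)\<^sup>H * (Hm S j)\<^sup>H * minv (Rm S P j) * Hm S j * Wm S i * P ! i))
                ({..<nUE S} - {i})))) \<and>
     (P \<in> Mm S \<longrightarrow>
       (\<exists>!G. is_riem_grad S (Mm S) (neg_wsr S) P G) \<and>
       (let lam = (\<lambda>k. 1 / pwr S k *
              (\<Sum>i\<in>served S k.
                 Re (tr ((P ! i)\<^sup>H * (Wm S i)\<^sup>H * Qm S k * Wm S i * grad_Ni S (neg_wsr S) P i)))) in
        riem_grad S (Mm S) (neg_wsr S) P =
          map (\<lambda>i. grad_Ni S (neg_wsr S) P i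
                - msum (nserv S i * nTx S) (nStr S i)
                    (\<lambda>k. lam k *\<^sub>r ((Wm S i)\<^sup>H * Qm S k * Wm S i * P ! i)) (set (bss S i)))
            [0..<nUE S]))"
proof -
  note valid = assms(1) and P = assms(2)
  let ?f = "neg_wsr S" and ?G = "wsr_grad S P"
  \<comment> \<open>The only differentiation in this proof; the gradients on users and blocks and
    the Riemannian gradient are derived from it.\<close>
  have G: "is_grad_N S ?f P ?G"
    using valid P by (rule is_grad_N_wsr)
  then have GN: "?G \<in> Nn S"
    by (simp add: is_grad_N_def is_gradient_def)
  note uniq = gradients_unique[OF G P]
  have N: "(\<exists>!G. is_grad_N S ?f P G) \<and> grad_N S ?f P = map (\<lambda>i. grad_Ni S ?f P i) [0..<nUE S]"
  proof (intro conjI uniq(1))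
    show "grad_N S ?f P = map (\<lambda>i. grad_Ni S ?f P i) [0..<nUE S]"
      unfolding uniq(2) using Nn_length[OF GN] by (intro nth_equalityI) (simp_all add: uniq(4))
  qed
  moreover have "(\<exists>!G. is_grad_Ni S ?f P i G) \<and> grad_Ni S ?f P i = stack S i (\<lambda>n. grad_Nik S ?f P i n)"
    if i: "i < nUE S" for i
  proof (intro conjI uniq(3)[OF i])
    have "stack S i (\<lambda>n. grad_Nik S ?f P i n) = stack S i (block S i (?G ! i))"
    proof (rule eq_matI)
      fix a b
      assume "a < dim_row (stack S i (block S i (?G ! i)))" "b < dim_col (stack S i (block S i (?G ! i)))"
      then show "stack S i (\<lambda>n. grad_Nik S ?f P i n) $$ (a, b) = stack S i (block S i (?G ! i)) $$ (a, b)"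
        by (simp add: stack_def block_matrix_def uniq(6)[OF i] less_mult_imp_div_less)
    qed (simp_all add: stack_def block_matrix_def)
    also have "\<dots> = ?G ! i"
      using GN i by (intro stack_block) (simp add: Nn_def)
    finally show "grad_Ni S ?f P i = stack S i (\<lambda>n. grad_Nik S ?f P i n)"
      using uniq(4)[OF i] by simp
  qed
  moreover have "(\<exists>!G. is_grad_Nik S ?f P i n G) \<and>
       (let k = bss S i ! n in
        grad_Nik S ?f P i n =
          (-2) *\<^sub>r (wt S i *\<^sub>r ((chan S i k)\<^sup>H * minv (Rm S P i) * Hm S i * Wm S i * P ! i * Cm S P i)
            - msum (nTx S) (nStr S i)
                (\<lambda>j. wt S j *\<^sub>r ((chan S j k)\<^sup>H * minv (Rm S P j) * Hm S j * Wm S j * P ! j * Cm S P j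
                   * (P ! j)\<^sup>H * (Wm S j)\<^sup>H * (Hm S j)\<^sup>H * minv (Rm S P j) * Hm S j * Wm S i * P ! i))
                ({..<nUE S} - {i})))"
    if i: "i < nUE S" and n: "n < nserv S i" for i n
    unfolding Let_def uniq(6)[OF i n]
    by (intro conjI uniq(5)[OF i n] block_wsr_grad[OF valid P i n])
  moreover have "(\<exists>!G. is_riem_grad S (Mm S) ?f P G) \<and>
       (let lam = (\<lambda>k. 1 / pwr S k *
              (\<Sum>i\<in>served S k.
                 Re (tr ((P ! i)\<^sup>H * (Wm S i)\<^sup>H * Qm S k * Wm S i * grad_Ni S ?f P i)))) in
        riem_grad S (Mm S) ?f P =
          map (\<lambda>i. grad_Ni S ?f P i
                - msum (nserv S i * nTx S) (nStr S i)
                    (\<lambda>k. lam k *\<^sub>r ((Wm S i)\<^sup>H * Qm S k * Wm S i * P ! i)) (set (bss S i)))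
            [0..<nUE S])"
    if M: "P \<in> Mm S"
  proof -
    define lam where "lam k = 1 / pwr S k * (\<Sum>i\<in>served S k.
      Re (tr ((P ! i)\<^sup>H * (Wm S i)\<^sup>H * Qm S k * Wm S i * grad_Ni S ?f P i)))" for k
    define R where "R = map (\<lambda>i. grad_Ni S ?f P i - msum (nserv S i * nTx S) (nStr S i)
      (\<lambda>k. lam k *\<^sub>r ((Wm S i)\<^sup>H * Qm S k * Wm S i * P ! i)) (set (bss S i))) [0..<nUE S]"
    \<comment> \<open>Up to the real part, the traces defining \<open>lam k\<close> are the inner
      product of gradient and \<open>P\<close> at station \<open>k\<close>, which is the radial
      coefficient for the sphere of that station.\<close>
    have lam: "lam k = ip_bs S k ?G P / pwr S k" for k
    proof -
      have "(\<Sum>i\<in>served S k. Re (tr ((P ! i)\<^sup>H * (Wm S i)\<^sup>H * Qm S k * Wm S i * grad_Ni S ?f P i))) =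
        Re (\<Sum>i\<in>served S k. tr ((P ! i)\<^sup>H * (Wm S i)\<^sup>H * Qm S k * Wm S i * ?G ! i))"
        unfolding Re_sum by (intro sum.cong refl) (simp add: uniq(4) served_def)
      also have "\<dots> = ip_bs S k ?G P"
        unfolding sum_served_trace[OF valid P GN] Re_sum ip_bs_def ..
      finally show ?thesis
        by (simp add: lam_def)
    qed
    have RN: "R \<in> Nn S"
      by (auto simp: R_def Nn_def Ni_def intro!: minus_carrier_mat)
    have R: "ent R x = ent ?G x - complex_of_real (lam (station S x)) * ent P x" if x: "x \<in> entries S" for x
    proof -
      obtain i a b where x': "x = (i, a, b)" and i: "i < nUE S" and ab: "a < nserv S i * nTx S" "b < nStr S i"
        using x by (auto simp: entries_def)
      have st: "station S x \<in> set (bss S i)"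
        using ab(1) by (simp add: x' station_def less_mult_imp_div_less)
      have "(lam k *\<^sub>r ((Wm S i)\<^sup>H * Qm S k * Wm S i * P ! i)) $$ (a, b) =
          (if k = station S x then complex_of_real (lam k) * ent P x else 0)" for k
        unfolding station_projection[OF valid i Nn_nth[OF P i]]
        using ab by (auto simp: x' station_def ent_def)
      \<comment> \<open>Of all projections in the sum, only the one for the station of the entry is
        nonzero there, and that station serves user \<open>i\<close>.\<close>
      then have "(\<Sum>k\<in>set (bss S i). (lam k *\<^sub>r ((Wm S i)\<^sup>H * Qm S k * Wm S i * P ! i)) $$ (a, b)) =
          complex_of_real (lam (station S x)) * ent P x"
        using st by (simp only: sum.delta finite_set if_True)
      then show ?thesis
        using ab i by (simp add: x' ent_def R_def uniq(4) del: index_smult_mat(1) index_mult_mat(1))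
    qed
    note riem = riemannian_gradient[OF valid M G lam RN R]
    then show ?thesis
      unfolding Let_def R_def lam_def by blast
  qed
  ultimately show ?thesis
    by blast
qed

end
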